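(* For a pair $v,u$ of compactly supported $C^\infty$ functions on $\mathbb{R}$, define for $\Re s>2$ $$F_0(s)=\frac{1}{2i\pi}\int_{\Re\nu=1}\left(1+2^{-s+\nu}\right)^{-1}\frac{\zeta(s-\nu)}{\zeta(2(s-\nu))}\times\frac{\left(1-2^{-\nu}\right)^{-1}}{\zeta(\nu)}\,\langle \mathfrak{E}_{-\nu},\,\mathrm{Wig}(v,u)\rangle\,d\nu$$ (an analytic function of $s$ in $\Re s>2$, the integrand at $\nu=1$ being understood by continuity). Assume that for every such pair $v,u$ the function $F_0$ extends as an analytic function to the half-plane $\{s:\Re s>\frac32\}$. Then every zero of the Riemann zeta function has real part $\le\frac12$.
   Context: $\mathrm{Wig}(v,u)(x,\xi)=\int_{\mathbb{R}}\overline{v}(x+t)u(x-t)e^{2i\pi\xi t}dt$. The Eisenstein distribution $\mathfrak{E}_{-\nu}$ is defined for $\Re\nu>1$ by $\langle\mathfrak{E}_{-\nu},h\rangle=\sum_{(j,k)\in\mathbb{Z}^2\setminus\{0\}}\int_0^\infty t^{\nu}h(jt,kt)\,dt$ for $h\in\mathcal{S}(\mathbb{R}^2)$, and is extended to $\nu\in\mathbb{C}\setminus\{\pm1\}$ by meromorphic continuation (it has simple poles only at $\nu=\pm1$). *)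

theory Defs
  imports "HOL-Complex_Analysis.Complex_Analysis"
begin

text \<open>
  The holomorphic function on \<^term>\<open>B\<close> that agrees with \<^term>\<open>g\<close> on \<^term>\<open>A\<close>.
  It is unique when \<^term>\<open>B\<close> is open and connected and \<^term>\<open>A\<close> is a nonempty open subset
  (lemma \<open>hol_continuation_eq\<close>); values outside \<^term>\<open>B\<close> are unspecified.
\<close>
definition hol_continuation ::
    "complex set \<Rightarrow> complex set \<Rightarrow> (complex \<Rightarrow> complex) \<Rightarrow> complex \<Rightarrow> complex" where
  "hol_continuation A B g = (SOME f. f holomorphic_on B \<and> (\<forall>z\<in>A. f z = g z))"

lemma hol_continuation_eq:
  assumes "open A" "A \<noteq> {}" "A \<subseteq> B" "open B" "connected B"
    and f: "f holomorphic_on B" "\<And>z. z \<in> A \<Longrightarrow> f z = g z"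
    and z: "z \<in> B"
  shows "hol_continuation A B g z = f z"
proof -
  let ?h = "hol_continuation A B g"
  have h: "?h holomorphic_on B \<and> (\<forall>z\<in>A. ?h z = g z)"
    unfolding hol_continuation_def by (rule someI[where x = f]) (use f in auto)
  show ?thesis
    by (rule analytic_continuation_open[of A B ?h f])
       (use assms h in auto)
qed

definition zeta_series :: "complex \<Rightarrow> complex" where
  "zeta_series s = (\<Sum>n. 1 / of_nat (Suc n) powr s)"

text \<open>The value at the pole \<open>s = 1\<close> is unspecified.\<close>
definition zeta :: "complex \<Rightarrow> complex" where
  "zeta = hol_continuation {s. Re s > 1} (- {1}) zeta_series"

definition smooth :: "(real \<Rightarrow> complex) \<Rightarrow> bool" where
  "smooth f \<longleftrightarrow>
     (\<forall>n x. ((\<lambda>g y. vector_derivative g (at y)) ^^ n) f differentiable (at x))"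

definition compactly_supported :: "(real \<Rightarrow> complex) \<Rightarrow> bool" where
  "compactly_supported f \<longleftrightarrow> compact (closure (support_on UNIV f))"

definition Wig :: "(real \<Rightarrow> complex) \<Rightarrow> (real \<Rightarrow> complex) \<Rightarrow> real \<Rightarrow> real \<Rightarrow> complex" where
  "Wig v u x \<xi> =
     (LINT t|lborel. cnj (v (x + t)) * u (x - t) * exp (2 * \<i> * pi * \<xi> * t))"

definition eisenstein_series :: "complex \<Rightarrow> (real \<Rightarrow> real \<Rightarrow> complex) \<Rightarrow> complex" where
  "eisenstein_series \<nu> h =
     (\<Sum>\<^sub>\<infinity>(j, k)\<in>(UNIV :: (int \<times> int) set) - {(0, 0)}.
        LINT t:{0<..}|lborel. complex_of_real t powr \<nu> * h (of_int j * t) (of_int k * t))"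

text \<open>
  The pairing \<open>\<langle>E\<^bsub>-\<nu>\<^esub>, h\<rangle>\<close> for a Schwartz function \<open>h\<close> on the plane. Since the only poles are
  at \<open>\<nu> = 1\<close> and \<open>\<nu> = -1\<close>, the meromorphic continuation is the holomorphic continuation to
  the complement of these two points, where the values are unspecified.
\<close>
definition eisenstein :: "complex \<Rightarrow> (real \<Rightarrow> real \<Rightarrow> complex) \<Rightarrow> complex" where
  "eisenstein \<nu> h =
     hol_continuation {\<mu>. Re \<mu> > 1} (- {1, -1}) (\<lambda>\<mu>. eisenstein_series \<mu> h) \<nu>"

lemma zeta_eqI:
  assumes "f holomorphic_on - {1}" "\<And>s. Re s > 1 \<Longrightarrow> f s = zeta_series s" "s \<noteq> 1"
  shows "zeta s = f s"
  unfolding zeta_def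
proof (rule hol_continuation_eq)
  show "{s. Re s > 1} \<noteq> {}"
    by (auto intro: exI[of _ 2])
  show "connected (- {1 :: complex})"
    by (rule connected_punctured_universe) simp
qed (use assms in \<open>auto simp: open_halfspace_Re_gt\<close>)

lemma eisenstein_eqI:
  assumes "f holomorphic_on - {1, -1}" "\<And>\<mu>. Re \<mu> > 1 \<Longrightarrow> f \<mu> = eisenstein_series \<mu> h"
    "\<nu> \<noteq> 1" "\<nu> \<noteq> -1"
  shows "eisenstein \<nu> h = f \<nu>"
  unfolding eisenstein_def
proof (rule hol_continuation_eq)
  show "{s. Re s > 1} \<noteq> {}"
    by (auto intro: exI[of _ 2])
  have "connected (UNIV - {1, -1 :: complex})"
    by (rule connected_open_delete_finite) auto
  then show "connected (- {1, -1 :: complex})"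
    by (simp add: Compl_eq_Diff_UNIV)
  show "open (- {1, -1 :: complex})"
    by (intro open_Compl finite_imp_closed) auto
qed (use assms in \<open>auto simp: open_halfspace_Re_gt\<close>)

definition F0_integrand ::
    "(real \<Rightarrow> complex) \<Rightarrow> (real \<Rightarrow> complex) \<Rightarrow> complex \<Rightarrow> complex \<Rightarrow> complex" where
  "F0_integrand v u s \<nu> =
     inverse (1 + 2 powr (- s + \<nu>)) * (zeta (s - \<nu>) / zeta (2 * (s - \<nu>)))
       * (inverse (1 - 2 powr (- \<nu>)) / zeta \<nu>) * eisenstein \<nu> (Wig v u)"

text \<open>
  The line \<open>Re \<nu> = 1\<close> is parametrized by \<open>\<nu> = 1 + \<i> y\<close>, so \<open>d\<nu> = \<i> dy\<close>. The integrand is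
  given its limit as value at \<open>\<nu> = 1\<close>, where the pole of the Eisenstein pairing is
  cancelled by the zero of \<open>1 / zeta\<close>.
\<close>
definition F0 :: "(real \<Rightarrow> complex) \<Rightarrow> (real \<Rightarrow> complex) \<Rightarrow> complex \<Rightarrow> complex" where
  "F0 v u s =
     1 / (2 * \<i> * pi) *
       (LINT y|lborel.
          ((F0_integrand v u s)(1 := Lim (at 1) (F0_integrand v u s))) (Complex 1 y) * \<i>)"

end

theory Submission
  imports Defs "HOL-Number_Theory.Number_Theory" "HOL-Real_Asymp.Real_Asymp" "HOL-Probability.Sinc_Integral"
begin

text \<open>
  The residue of the integrand at \<open>\<nu> = s - 1\<close> is a nonzero constant times
  \<open>(1 - 2\<^bsup>1-s\<^esup>)\<^sup>-\<^sup>1 \<langle>E\<^bsub>1-s\<^esub>, Wig(v,u)\<rangle> / \<zeta>(s - 1)\<close>.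
  For \<open>2 < Re s < 2 + \<epsilon>\<close>, moving the line of integration from \<open>Re \<nu> = 1\<close> to \<open>Re \<nu> = 1 + \<epsilon>\<close>
  therefore splits \<open>F\<^sub>0\<close> into this residue term and an integral that is holomorphic for
  \<open>3/2 + \<epsilon> < Re s < 2 + \<epsilon>\<close>. If \<open>F\<^sub>0\<close> continues to \<open>Re s > 3/2\<close>, so does the residue term, and
  at a zero \<open>\<rho>\<close> of \<open>\<zeta>\<close> with \<open>Re \<rho> > 1/2\<close> the pairing \<open>\<langle>E\<^bsub>-\<rho>\<^esub>, Wig(v,u)\<rangle>\<close> must vanish.

  It does not vanish for a suitable pair. Poisson summation in \<open>k\<close> turns the pairing into the sum over
  \<open>j, n\<close> of the integrals of \<open>t\<^bsup>\<nu>-1\<^esup> v(jt + n/t) u(jt - n/t)\<close>, where conjugation is dropped because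
  \<open>v\<close> is real. If \<open>v\<close> and \<open>u\<close> are small bumps around \<open>5/2\<close> and
  \<open>3/2\<close>, then \<open>jn = ((jt + n/t)\<^sup>2 - (jt - n/t)\<^sup>2) / 4\<close> is close to \<open>1\<close> on the support, so only
  \<open>j = n = 1\<close> contributes. The pairing is then the Mellin transform of a nonnegative bump around \<open>t = 2\<close>:
  it is entire, decays rapidly on vertical lines, and is nonzero at a given \<open>\<rho>\<close> if the bump is narrow enough.
\<close>

section \<open>Continuation of the zeta function\<close>

text \<open>The line Re \<nu> = 1 is the edge of the region where \<zeta> is known to have no zeros,
  and the integrand divides by \<zeta>(\<nu>) there. Moving the line therefore needs an explicit
  lower bound up to this edge, polynomial in the height; it comes from the 3-4-1 inequality and is
  beaten by the rapid decay of the Mellin transform. The other quotient, in w = s - \<nu>, has the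
  denominator \<zeta>(2w), bounded below once Re w exceeds 1/2 by a fixed amount; with Re \<nu> = 1
  + \<epsilon> this is what restricts s to Re s > 3/2 + \<epsilon>. Since \<rho> + 1 has real part >
  3/2, a small \<epsilon> makes it reachable. Poles are cleared beforehand: \<open>Zf\<close>
  replaces \<zeta>, and the final identity is multiplied by \<open>Zf (s - 1)\<close>, so that only
  holomorphic functions are continued. The bump centres are the values 2 + 1/2 and 2 - 1/2 of t +
  1/t and t - 1/t at t = 2. As \<open>zeta\<close> and \<open>eisenstein\<close> are continuations
  picked by a choice operator, a continuation has to be constructed before their values are
  known.\<close>

lemma suminf_has_field_derivative:
  fixes f :: "nat \<Rightarrow> complex \<Rightarrow> complex"
  assumes "open S" "z \<in> S"
    and "\<And>n x. x \<in> S \<Longrightarrow> (f n has_field_derivative f' n x) (at x)"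
    and "\<And>x. x \<in> S \<Longrightarrow> \<exists>d h. 0 < d \<and> summable h \<and> (\<forall>n. \<forall>y\<in>ball x d \<inter> S. norm (f n y) \<le> h n)"
  shows "((\<lambda>z. \<Sum>n. f n z) has_field_derivative (\<Sum>n. f' n z)) (at z)"
    and "summable (\<lambda>n. f' n z)"
proof -
  have "\<exists>g g'. \<forall>x\<in>S. ((\<lambda>n. f n x) sums g x) \<and> ((\<lambda>n. f' n x) sums g' x) \<and>
                 (g has_field_derivative g' x) (at x)"
  proof (rule series_and_derivative_comparison_local[OF assms(1,3)])
    fix x assume "x \<in> S"
    then show "\<exists>d h. 0 < d \<and> summable h \<and> (\<forall>\<^sub>F n in sequentially. \<forall>y\<in>ball x d \<inter> S. norm (f n y) \<le> h n)"
      by (rule assms(4)[THEN ex_forward, THEN exE]) (auto intro!: exI always_eventually)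
  qed
  then obtain g g' where g: "\<And>x. x \<in> S \<Longrightarrow> (\<lambda>n. f n x) sums g x"
      "\<And>x. x \<in> S \<Longrightarrow> (\<lambda>n. f' n x) sums g' x"
      "\<And>x. x \<in> S \<Longrightarrow> (g has_field_derivative g' x) (at x)"
    by blast
  have "((\<lambda>z. \<Sum>n. f n z) has_field_derivative g' z) (at z)"
    using g(3)[OF assms(2)]
    by (rule has_field_derivative_transform_within_open[OF _ assms(1,2)])
       (use g(1) in \<open>auto simp: sums_iff\<close>)
  then show "((\<lambda>z. \<Sum>n. f n z) has_field_derivative (\<Sum>n. f' n z)) (at z)"
    and "summable (\<lambda>n. f' n z)"
    using g(2)[OF assms(2)] by (simp_all add: sums_iff)
qed

text \<open>Only the terms need a locally uniform summable bound; by Cauchy's estimates it controls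
  the derivatives too.\<close>

lemma suminf_holomorphic:
  fixes f :: "nat \<Rightarrow> complex \<Rightarrow> complex"
  assumes "open S" and "\<And>n. f n holomorphic_on S"
    and "\<And>x. x \<in> S \<Longrightarrow> \<exists>d h. 0 < d \<and> summable h \<and> (\<forall>n. \<forall>y\<in>ball x d \<inter> S. norm (f n y) \<le> h n)"
  shows "(\<lambda>z. \<Sum>n. f n z) holomorphic_on S"
proof -
  have "((\<lambda>z. \<Sum>n. f n z) has_field_derivative (\<Sum>n. deriv (f n) z)) (at z)" if "z \<in> S" for z
    by (rule suminf_has_field_derivative(1)[OF assms(1) that _ assms(3)])
       (use assms holomorphic_derivI in blast)+
  then show ?thesis
    using assms(1) by (auto simp: holomorphic_on_open)
qed

lemma nat_plus_real_nonzero [simp]: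
  assumes "0 \<le> x"
  shows "complex_of_nat n + 1 + complex_of_real x \<noteq> 0"
proof
  assume "complex_of_nat n + 1 + complex_of_real x = 0"
  then have "Re (complex_of_nat n + 1 + complex_of_real x) = 0" by simp
  with assms show False by simp
qed

lemma norm_of_real_powr:
  "r > 0 \<Longrightarrow> norm (of_real r powr (s::complex)) = r powr Re s"
  by (simp add: norm_powr_real_powr)

lemma summable_Suc_powr: "\<sigma> > 1 \<Longrightarrow> summable (\<lambda>n. (real n + 1) powr (- \<sigma>))"
  using summable_real_powr_iff[of "-\<sigma>"] summable_Suc_iff[of "\<lambda>n. of_nat n powr (-\<sigma>) :: real"]
  by (simp add: add_ac)

section \<open>Integrals of periodic weights against x^(-s)\<close>

definition Jterm :: "(real \<Rightarrow> real) \<Rightarrow> nat \<Rightarrow> complex \<Rightarrow> complex" where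
  "Jterm p n s = integral {0..1} (\<lambda>x. of_real (p x) * of_real (real n + 1 + x) powr (- s))"

text \<open>With \<open>p\<close> extended to period 1, this is the integral of p(x) x^(-s) over x
  \<ge> 1, cut at the integers.\<close>

definition J :: "(real \<Rightarrow> real) \<Rightarrow> complex \<Rightarrow> complex" where
  "J p s = (\<Sum>n. Jterm p n s)"

lemma Jterm_continuous:
  assumes "continuous_on {0..1} p"
  shows "continuous_on {0..1} (\<lambda>x. of_real (p x) * of_real (real n + 1 + x) powr (- s) :: complex)"
  by (intro continuous_intros assms) (auto simp: complex_nonpos_Reals_iff)

lemma Jterm_holomorphic:
  assumes "continuous_on {0..1} p"
  shows "Jterm p n holomorphic_on UNIV"
proof -
  have "(\<lambda>s. integral (cbox 0 1) (\<lambda>x. of_real (p x) * of_real (real n + 1 + x) powr (- s) :: complex))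
          holomorphic_on UNIV"
  proof (rule leibniz_rule_holomorphic)
    fix s :: complex and t :: real
    assume t: "t \<in> cbox 0 1"
    have nz: "complex_of_real (real n + 1 + t) \<noteq> 0"
      using t by simp
    show "((\<lambda>s. of_real (p t) * of_real (real n + 1 + t) powr (- s)) has_field_derivative
            - of_real (p t) * Ln (of_real (real n + 1 + t)) * of_real (real n + 1 + t) powr (- s)) (at s within UNIV)"
      using nz by (auto intro!: derivative_eq_intros simp: powr_def)
  next
    fix s :: complex
    show "(\<lambda>x. of_real (p x) * of_real (real n + 1 + x) powr (- s) :: complex) integrable_on cbox 0 1"
      using integrable_continuous_real[OF Jterm_continuous[OF assms]] by simp
  next
    have c: "continuous_on (UNIV \<times> {0..1}) (\<lambda>z::complex\<times>real. p (snd z))"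
      by (rule continuous_on_compose2[OF assms]) (auto intro: continuous_intros)
    show "continuous_on (UNIV \<times> cbox 0 1) (\<lambda>(s, t). - of_real (p t) * Ln (of_real (real n + 1 + t))
            * of_real (real n + 1 + t) powr (- s) :: complex)"
      unfolding split_beta using c
      by (auto intro!: continuous_intros simp: complex_nonpos_Reals_iff)
  qed auto
  then show ?thesis
    by (simp add: Jterm_def[abs_def])
qed

lemma Jterm_bound:
  assumes "continuous_on {0..1} p" "\<And>x. x \<in> {0..1} \<Longrightarrow> \<bar>p x\<bar> \<le> B" "0 \<le> Re s"
  shows "norm (Jterm p n s) \<le> B * (real n + 1) powr (- Re s)"
proof -
  have B: "0 \<le> B"
    using assms(2)[of 0] by simp
  have "norm (Jterm p n s) \<le> B * (real n + 1) powr (- Re s) * (1 - 0)"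
    unfolding Jterm_def
  proof (rule integral_bound)
    fix x :: real assume x: "x \<in> {0..1}"
    have "norm (complex_of_real (real n + 1 + x) powr (- s)) = (real n + 1 + x) powr (- Re s)"
        using x by (subst norm_of_real_powr) auto
      also have "\<dots> \<le> (real n + 1) powr (- Re s)"
        using x assms(3) by (intro powr_mono2') auto
      finally show "norm (of_real (p x) * of_real (real n + 1 + x) powr (- s))
            \<le> B * (real n + 1) powr (- Re s)"
      using assms(2)[OF x] B by (simp add: norm_mult mult_mono)
  qed (use Jterm_continuous[OF assms(1)] in auto)
  then show ?thesis by simp
qed

lemma bounded_on_unit:
  assumes "continuous_on {0..1::real} p"
  obtains B :: real where "\<And>x. x \<in> {0..1} \<Longrightarrow> \<bar>p x\<bar> \<le> B" "B \<ge> 0"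
proof -
  have "bounded (p ` {0..1})"
    by (intro compact_imp_bounded compact_continuous_image assms) auto
  then obtain B where "\<And>x. x \<in> {0..1} \<Longrightarrow> \<bar>p x\<bar> \<le> B"
    unfolding bounded_iff by (metis imageI real_norm_def)
  moreover from this[of 0] have "B \<ge> 0"
    by simp
  ultimately show ?thesis using that by blast
qed

lemma Jterm_summable:
  assumes "continuous_on {0..1} p" "Re s > 1"
  shows "summable (\<lambda>n. Jterm p n s)"
proof -
  obtain B where B: "\<And>x. x \<in> {0..1} \<Longrightarrow> \<bar>p x\<bar> \<le> B"
    using bounded_on_unit[OF assms(1)] by blast
  show ?thesis
    by (rule summable_comparison_test'[of "\<lambda>n. B * (real n + 1) powr (- Re s)" 0])
       (use assms Jterm_bound[OF assms(1) B] in \<open>auto intro!: summable_mult summable_Suc_powr\<close>)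
qed

lemma J_bound:
  assumes "continuous_on {0..1} p" "\<sigma> > 1"
  obtains C where "\<And>s. Re s \<ge> \<sigma> \<Longrightarrow> norm (J p s) \<le> C" "C \<ge> 0"
proof -
  obtain B where B: "\<And>x. x \<in> {0..1} \<Longrightarrow> \<bar>p x\<bar> \<le> B" "B \<ge> 0"
    using bounded_on_unit[OF assms(1)] by blast
  have sm: "summable (\<lambda>n. B * (real n + 1) powr (- \<sigma>))"
    by (intro summable_mult summable_Suc_powr assms)
  show ?thesis
  proof (rule that[of "\<Sum>n. B * (real n + 1) powr (- \<sigma>)"])
    fix s :: complex assume s: "Re s \<ge> \<sigma>"
    have "norm (Jterm p n s) \<le> B * (real n + 1) powr (- \<sigma>)" for n
    proof -
      have "norm (Jterm p n s) \<le> B * (real n + 1) powr (- Re s)"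
        by (rule Jterm_bound) (use assms B s in auto)
      also have "\<dots> \<le> B * (real n + 1) powr (- \<sigma>)"
        using s B by (intro mult_left_mono powr_mono) auto
      finally show ?thesis .
    qed
    then show "norm (J p s) \<le> (\<Sum>n. B * (real n + 1) powr (- \<sigma>))"
      unfolding J_def by (rule norm_suminf_le[OF _ sm])
  qed (use B in \<open>auto intro!: suminf_nonneg sm\<close>)
qed

lemma J_holomorphic:
  assumes "continuous_on {0..1} p"
  shows "J p holomorphic_on {s. Re s > 1}"
proof -
  obtain B where B: "\<And>x. x \<in> {0..1} \<Longrightarrow> \<bar>p x\<bar> \<le> B" "B \<ge> 0"
    using bounded_on_unit[OF assms(1)] by blast
  have "(\<lambda>s. \<Sum>n. Jterm p n s) holomorphic_on {s. Re s > 1}"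
  proof (rule suminf_holomorphic)
    fix s :: complex assume s: "s \<in> {s. Re s > 1}"
    \<comment> \<open>Half the distance from s to the line Re = 1, so that the ball of radius d
      stays in Re y \<ge> 1 + d.\<close>
    define d where "d = (Re s - 1) / 2"
    have d: "d > 0" "1 + d > 1" "Re s - d = 1 + d"
      using s by (auto simp: d_def field_simps)
    have "norm (Jterm p n y) \<le> B * (real n + 1) powr (- (1 + d))" if "y \<in> ball s d" for n y
    proof -
      have "\<bar>Re s - Re y\<bar> \<le> norm (s - y)"
        by (metis abs_Re_le_cmod minus_complex.simps(1))
      then have y: "Re y \<ge> 1 + d"
        using that d by (auto simp: dist_norm)
      have "norm (Jterm p n y) \<le> B * (real n + 1) powr (- Re y)"
        by (rule Jterm_bound) (use assms B y d in auto)
      also have "\<dots> \<le> B * (real n + 1) powr (- (1 + d))"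
        using y B by (intro mult_left_mono powr_mono) auto
      finally show ?thesis .
    qed
    then show "\<exists>d h. 0 < d \<and> summable h \<and> (\<forall>n. \<forall>y\<in>ball s d \<inter> {s. 1 < Re s}. norm (Jterm p n y) \<le> h n)"
      using d by (intro exI[of _ d] exI[of _ "\<lambda>n. B * (real n + 1) powr (- (1 + d))"])
         (use summable_mult[OF summable_Suc_powr[OF d(2)], of B] in auto)
  qed (auto simp: open_halfspace_Re_gt intro: holomorphic_on_subset[OF Jterm_holomorphic[OF assms]])
  then show ?thesis
    by (simp add: J_def[abs_def])
qed

lemma powr_has_vector_derivative:
  assumes "a + x > 0"
  shows "((\<lambda>x. complex_of_real (a + x) powr s) has_vector_derivative
            s * of_real (a + x) powr (s - 1)) (at x within A)"
proof -
  have "((\<lambda>z. z powr s) has_field_derivative s * of_real (a + x) powr (s - 1)) (at (complex_of_real (a + x)))"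
    using assms by (intro has_field_derivative_powr) (auto simp: complex_nonpos_Reals_iff)
  moreover have "((\<lambda>x. complex_of_real (a + x)) has_vector_derivative 1) (at x within A)"
    by (auto intro!: derivative_eq_intros)
  ultimately show ?thesis
    using field_vector_diff_chain_within[of "\<lambda>x. complex_of_real (a + x)" 1 x A "\<lambda>z. z powr s"]
    by (auto simp: o_def has_field_derivative_at_within)
qed

lemma powr_tendsto_0_at_top:
  assumes "Re s < 0"
  shows "(\<lambda>n. complex_of_real (real n + 1) powr s) \<longlonglongrightarrow> 0"
proof (rule tendsto_norm_zero_cancel)
  have "(\<lambda>n. (real n + 1) powr Re s) \<longlonglongrightarrow> 0"
    using assms by real_asymp
  moreover have "norm (complex_of_real (real n + 1) powr s) = (real n + 1) powr Re s" for n
    by (rule norm_of_real_powr) simp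
  ultimately show "(\<lambda>n. norm (complex_of_real (real n + 1) powr s)) \<longlonglongrightarrow> 0"
    by simp
qed

lemma Jterm_one:
  assumes "s \<noteq> 1"
  shows "Jterm (\<lambda>_. 1) n s =
     (of_real (real n + 1) powr (1 - s) - of_real (real (Suc n) + 1) powr (1 - s)) / (s - 1)"
proof -
  have "((\<lambda>x. (1 - s) * of_real (real n + 1 + x) powr (1 - s - 1)) has_integral
          of_real (real n + 1 + 1) powr (1 - s) - of_real (real n + 1 + 0) powr (1 - s)) {0..1}"
    by (intro fundamental_theorem_of_calculus powr_has_vector_derivative) auto
  from has_integral_mult_right[OF this, of "inverse (1 - s)"] assms
  have "((\<lambda>x. of_real (real n + 1 + x) powr (- s)) has_integral inverse (1 - s) *
          (of_real (real n + 1 + 1) powr (1 - s) - of_real (real n + 1 + 0) powr (1 - s))) {0..1}"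
    by (simp flip: mult.assoc)
  then have "Jterm (\<lambda>_. 1) n s = inverse (1 - s) *
          (of_real (real n + 1 + 1) powr (1 - s) - of_real (real n + 1 + 0) powr (1 - s))"
    unfolding Jterm_def by (simp add: integral_unique)
  then show ?thesis
    using assms by (simp add: field_simps)
qed

lemma J_one:
  assumes "Re s > 1"
  shows "J (\<lambda>_. 1) s = 1 / (s - 1)"
proof -
  have s: "s \<noteq> 1" using assms by auto
  have "(\<lambda>n. of_real (real n + 1) powr (1 - s) - of_real (real (Suc n) + 1) powr (1 - s) :: complex)
          sums (of_real (real 0 + 1) powr (1 - s) - 0)"
    by (rule telescope_sums'[OF powr_tendsto_0_at_top]) (use assms in auto)
  from sums_divide[OF this, of "s - 1"] show ?thesis
    unfolding J_def Jterm_one[OF s] by (simp add: sums_iff)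
qed

text \<open>Subtracting the mean \<open>c\<close> makes the primitive \<open>P\<close> vanish at
  both ends of [0, 1]. The boundary terms then disappear, and \<open>P\<close> is again a continuous
  weight, so the step can be repeated.\<close>

lemma Jterm_by_parts:
  assumes p: "continuous_on {0..1} p"
  defines "c \<equiv> integral {0..1} p"
  defines "P \<equiv> (\<lambda>x. integral {0..x} (\<lambda>y. p y - c))"
  shows "Jterm p n s = of_real c * Jterm (\<lambda>_. 1) n s + s * Jterm P n (s + 1)"
    and "continuous_on {0..1} P"
proof -
  have pc: "continuous_on {0..1} (\<lambda>y. p y - c)"
    by (intro continuous_intros p)
  have dP: "(P has_vector_derivative (p x - c)) (at x within {0..1})" if "x \<in> {0..1}" for x
    unfolding P_def using integral_has_vector_derivative[OF pc that] .
  then show cP: "continuous_on {0..1} P"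
    by (meson continuous_on_eq_continuous_within has_vector_derivative_continuous)
  have P1: "P 1 = 0"
  proof -
    have "P 1 = integral {0..1} p - integral {0..1} (\<lambda>_::real. c)"
      unfolding P_def by (rule integral_diff) (auto intro!: integrable_continuous_real p continuous_intros)
    then show ?thesis by (simp add: c_def)
  qed
  have P0: "P 0 = 0" by (simp add: P_def)
  let ?a = "\<lambda>x. complex_of_real (real n + 1 + x)"
  let ?g = "\<lambda>x. of_real (p x) * ?a x powr (- s)"
  let ?g1 = "\<lambda>x. of_real 1 * ?a x powr (- s)"
  let ?h = "\<lambda>x. of_real (P x) * ?a x powr (- (s + 1))"
  have e: "- s - 1 = - 1 - s" by simp
  have "((\<lambda>x. of_real (P x) * ((- s) * ?a x powr (- s - 1)) + of_real (p x - c) * ?a x powr (- s))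
     has_integral of_real (P 1) * ?a 1 powr (- s) - of_real (P 0) * ?a 0 powr (- s)) {0..1}"
  proof (rule fundamental_theorem_of_calculus)
    fix x :: real assume x: "x \<in> {0..1}"
    have "((\<lambda>x. complex_of_real (P x)) has_vector_derivative of_real (p x - c)) (at x within {0..1})"
      using dP[OF x] by (intro has_vector_derivative_of_real)
        (simp add: has_real_derivative_iff_has_vector_derivative)
    from has_vector_derivative_mult[OF this powr_has_vector_derivative[of "real n + 1" x "- s"]] x
    show "((\<lambda>x. of_real (P x) * ?a x powr (- s)) has_vector_derivative
       of_real (P x) * ((- s) * ?a x powr (- s - 1)) + of_real (p x - c) * ?a x powr (- s)) (at x within {0..1})"
      by auto
  qed auto
  then have I: "((\<lambda>x. ?g x - of_real c * ?g1 x - s * ?h x) has_integral 0) {0..1}"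
    by (simp add: P0 P1 algebra_simps e)
  have "((\<lambda>x. ?g x - of_real c * ?g1 x - s * ?h x) has_integral
           Jterm p n s - of_real c * Jterm (\<lambda>_. 1) n s - s * Jterm P n (s + 1)) {0..1}"
    unfolding Jterm_def
    by (intro has_integral_diff has_integral_mult_right integrable_integral integrable_continuous_real
              Jterm_continuous p cP) auto
  from has_integral_unique[OF this I] show "Jterm p n s = of_real c * Jterm (\<lambda>_. 1) n s + s * Jterm P n (s + 1)"
    by (simp add: algebra_simps)
qed

text \<open>
  With \<open>s' = s + 1\<close>, the factor \<open>s * J P (s + 1)\<close> is \<open>(s' - 1) * J P s'\<close>. It has the same form as the left-hand
  side, so iterating this identity continues \<open>(s - 1) * J p s\<close> to the left, one unit at a time.
\<close>
lemma J_by_parts: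
  assumes p: "continuous_on {0..1} p"
  obtains c P where "continuous_on {0..1} P"
    "\<And>s. Re s > 1 \<Longrightarrow> (s - 1) * J p s = of_real c + (s - 1) * (s * J P (s + 1))"
proof -
  define c where "c = integral {0..1} p"
  define P where "P = (\<lambda>x. integral {0..x} (\<lambda>y. p y - c))"
  note parts = Jterm_by_parts[OF p, folded c_def, folded P_def]
  show ?thesis
  proof (rule that[OF parts(2)])
    fix s :: complex assume s: "Re s > 1"
    have "J p s = (\<Sum>n. of_real c * Jterm (\<lambda>_. 1) n s + s * Jterm P n (s + 1))"
      by (simp add: J_def parts(1))
    also have "\<dots> = of_real c * J (\<lambda>_. 1) s + s * J P (s + 1)"
      unfolding J_def using s
      by (subst suminf_add[symmetric] suminf_mult[symmetric];
          auto intro!: summable_mult Jterm_summable parts(2) continuous_on_const)+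
    finally show "(s - 1) * J p s = of_real c + (s - 1) * (s * J P (s + 1))"
      using s by (auto simp: J_one distrib_left)
  qed
qed

lemma J_extend_halfplane:
  assumes "continuous_on {0..1} p"
  shows "\<exists>g. g holomorphic_on {s. Re s > 1 - real N} \<and> (\<forall>s. Re s > 1 \<longrightarrow> g s = (s - 1) * J p s)"
  using assms
proof (induction N arbitrary: p)
  case 0
  show ?case
    by (intro exI[of _ "\<lambda>s. (s - 1) * J p s"]) (auto intro!: holomorphic_intros J_holomorphic 0)
next
  case (Suc N)
  obtain c P where P: "continuous_on {0..1} P"
    and eq: "\<And>s. Re s > 1 \<Longrightarrow> (s - 1) * J p s = of_real c + (s - 1) * (s * J P (s + 1))"
    using J_by_parts[OF Suc.prems] by blast
  obtain g where g: "g holomorphic_on {s. Re s > 1 - real N}" "\<And>s. Re s > 1 \<Longrightarrow> g s = (s - 1) * J P s"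
    using Suc.IH[OF P] by blast
  have "(\<lambda>s. g (s + 1)) holomorphic_on {s. Re s > 1 - real (Suc N)}"
    using holomorphic_on_compose_gen[of "\<lambda>s. s + 1" "{s. Re s > 1 - real (Suc N)}" g "{s. Re s > 1 - real N}"] g(1)
    by (fastforce simp: o_def intro: holomorphic_intros)
  then show ?case
    using eq g(2) by (intro exI[of _ "\<lambda>s. of_real c + (s - 1) * g (s + 1)"]) (auto intro!: holomorphic_intros)
qed

text \<open>By the identity theorem the extensions to two half-planes agree on the smaller one, so
  they glue to one entire function.\<close>

lemma holomorphic_extend_halfplanes:
  assumes "\<And>N::nat. \<exists>g. g holomorphic_on {s. Re s > 1 - real N} \<and> (\<forall>s. Re s > 1 \<longrightarrow> g s = f s)"
  obtains g where "g holomorphic_on UNIV" "\<And>s. Re s > 1 \<Longrightarrow> g s = f s"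
proof -
  obtain G where G: "\<And>N. G N holomorphic_on {s. Re s > 1 - real N}" "\<And>N s. Re s > 1 \<Longrightarrow> G N s = f s"
    using assms by metis
  have agree: "G M s = G N s" if "M \<le> N" "Re s > 1 - real M" for M N s
  proof (rule analytic_continuation_open[of "{s. Re s > 1}" "{s. Re s > 1 - real M}" "G M" "G N"])
    show "G N holomorphic_on {s. Re s > 1 - real M}"
      by (rule holomorphic_on_subset[OF G(1)]) (use that in auto)
    show "{s. Re s > 1} \<noteq> {}" by (auto intro: exI[of _ 2])
    show "connected {s. Re s > 1 - real M}"
      by (intro convex_connected convex_halfspace_Re_gt)
  qed (use that G in \<open>auto simp: open_halfspace_Re_gt\<close>)
  \<comment> \<open>An index whose half-plane certainly contains s: 1 - k(s) \<le> Re s - 1.\<close>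
  define k where "k = (\<lambda>s::complex. nat \<lceil>2 - Re s\<rceil>)"
  have k: "1 - real (k s) < Re s" for s
    unfolding k_def by linarith
  define g where "g = (\<lambda>s. G (k s) s)"
  have gG: "g s = G N s" if "Re s > 1 - real N" for s N
    unfolding g_def by (metis agree k nat_le_linear that)
  have "g holomorphic_on {s. Re s > 1 - real N}" for N
    by (rule holomorphic_transform[OF G(1)[of N]]) (simp add: gG)
  then have "g field_differentiable (at s)" for s
    using k[of s] by (intro holomorphic_on_imp_differentiable_at[of g "{z. Re z > 1 - real (k s)}"])
      (auto simp: open_halfspace_Re_gt)
  then have "g holomorphic_on UNIV"
    by (simp add: holomorphic_on_def)
  moreover have "g s = f s" if "Re s > 1" for s
    using gG[of 0 s] G(2)[of s 0] that by simp
  ultimately show ?thesis using that by blast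
qed

text \<open>First-order Euler-Maclaurin summation. On each unit interval the constant 1 is
  integrated to x - 1, which vanishes at the right end; the boundary then contributes only (n +
  1)^(-s), a term of the zeta series.\<close>

lemma zeta_series_eq_J:
  assumes "Re s > 1"
  shows "zeta_series s = 1 / (s - 1) + s * J (\<lambda>x. 1 - x) (s + 1)"
proof -
  have trm: "1 / of_nat (Suc n) powr s = Jterm (\<lambda>_. 1) n s + s * Jterm (\<lambda>x. 1 - x) n (s + 1)" for n
  proof -
    let ?a = "\<lambda>x. complex_of_real (real n + 1 + x)"
    have e: "- s - 1 = - 1 - s" by simp
    have c: "continuous_on {0..1} (\<lambda>x::real. 1 - x)"
      by (intro continuous_intros)
    have "((\<lambda>x. of_real (x - 1) * ((- s) * ?a x powr (- s - 1)) + 1 * ?a x powr (- s))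
     has_integral of_real (1 - 1) * ?a 1 powr (- s) - of_real (0 - 1) * ?a 0 powr (- s)) {0..1}"
    proof (rule fundamental_theorem_of_calculus)
      fix x :: real assume x: "x \<in> {0..1}"
      have "((\<lambda>x. complex_of_real (x - 1)) has_vector_derivative 1) (at x within {0..1})"
        by (auto intro!: derivative_eq_intros)
      from has_vector_derivative_mult[OF this powr_has_vector_derivative[of "real n + 1" x "- s"]] x
      show "((\<lambda>x. of_real (x - 1) * ?a x powr (- s)) has_vector_derivative
       of_real (x - 1) * ((- s) * ?a x powr (- s - 1)) + 1 * ?a x powr (- s)) (at x within {0..1})"
        by auto
    qed auto
    moreover have "((\<lambda>x. of_real 1 * ?a x powr (- s) + s * (of_real (1 - x) * ?a x powr (- (s + 1)))) has_integral
       Jterm (\<lambda>_. 1) n s + s * Jterm (\<lambda>x. 1 - x) n (s + 1)) {0..1}"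
      unfolding Jterm_def
      by (intro has_integral_add has_integral_mult_right integrable_integral integrable_continuous_real
              Jterm_continuous c) auto
    ultimately have "Jterm (\<lambda>_. 1) n s + s * Jterm (\<lambda>x. 1 - x) n (s + 1) = ?a 0 powr (- s)"
      by (intro has_integral_unique) (auto simp: algebra_simps e)
    then show ?thesis
      by (simp add: powr_minus_divide add_ac)
  qed
  have "zeta_series s = (\<Sum>n. Jterm (\<lambda>_. 1) n s + s * Jterm (\<lambda>x. 1 - x) n (s + 1))"
    by (simp add: zeta_series_def flip: trm)
  also have "\<dots> = J (\<lambda>_. 1) s + s * J (\<lambda>x. 1 - x) (s + 1)"
    unfolding J_def using assms
    by (subst suminf_add[symmetric] suminf_mult[symmetric];
        auto intro!: summable_mult Jterm_summable continuous_on_const continuous_on_diff continuous_on_id)+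
  finally show ?thesis
    using assms by (simp add: J_one)
qed

text \<open>Clears the only pole of \<zeta>. The value at 1 is the residue of \<zeta>, which makes
  the function entire and bypasses the unspecified \<open>zeta 1\<close>.\<close>

definition Zf :: "complex \<Rightarrow> complex" where
  "Zf s = (if s = 1 then 1 else (s - 1) * zeta s)"

text \<open>The half-plane extensions of \<open>J\<close> give entireness. The formula with
  \<open>J\<close> itself holds already for Re s > 0 and is recorded because the growth of
  \<open>Zf\<close> is read off from it.\<close>

lemma
  shows Zf_holomorphic: "Zf holomorphic_on UNIV"
    and zeta_eq_zeta_series: "\<And>s. Re s > 1 \<Longrightarrow> zeta s = zeta_series s"
    and Zf_eq_J: "\<And>s. Re s > 0 \<Longrightarrow> Zf s = 1 + (s - 1) * (s * J (\<lambda>x. 1 - x) (s + 1))"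
proof -
  have c: "continuous_on {0..1} (\<lambda>x::real. 1 - x)"
    by (intro continuous_intros)
  obtain g where g: "g holomorphic_on UNIV" "\<And>s. Re s > 1 \<Longrightarrow> g s = (s - 1) * J (\<lambda>x. 1 - x) s"
    using holomorphic_extend_halfplanes[OF J_extend_halfplane[OF c]] by blast
  have g1: "(\<lambda>s. g (s + 1)) holomorphic_on A" for A
    using holomorphic_on_compose_gen[of "\<lambda>s. s + 1" A g UNIV] g(1)
    by (simp add: o_def holomorphic_intros)
  define f where "f = (\<lambda>s. 1 / (s - 1) + g (s + 1))"
  have z: "zeta s = f s" if "s \<noteq> 1" for s
  proof (rule zeta_eqI[OF _ _ that])
    show "f holomorphic_on - {1}"
      unfolding f_def by (intro holomorphic_intros g1) auto
    show "f s = zeta_series s" if "Re s > 1" for s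
      using that by (simp add: f_def zeta_series_eq_J g)
  qed
  show "zeta s = zeta_series s" if "Re s > 1" for s
  proof -
    have "s \<noteq> 1" using that by auto
    from z[OF this] that show ?thesis by (simp add: f_def zeta_series_eq_J g)
  qed
  have Z: "Zf s = 1 + (s - 1) * g (s + 1)" for s
    by (simp add: Zf_def z f_def field_simps)
  show "Zf holomorphic_on UNIV"
    unfolding Z[abs_def] by (intro holomorphic_intros g1)
  show "Zf s = 1 + (s - 1) * (s * J (\<lambda>x. 1 - x) (s + 1))" if "Re s > 0" for s
    using that by (simp add: Z g)
qed

lemma Zf_1 [simp]: "Zf 1 = 1"
  by (simp add: Zf_def)

text \<open>For Re s \<ge> 1/2 the argument s + 1 has real part at least 3/2, where \<open>J\<close>
  is bounded, so only the two linear factors grow.\<close>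

lemma Zf_bound:
  obtains C where "\<And>s. Re s \<ge> 1 / 2 \<Longrightarrow> norm (Zf s) \<le> C * (1 + norm s) ^ 2" "C \<ge> 1"
proof -
  have c: "continuous_on {0..1} (\<lambda>x::real. 1 - x)"
    by (intro continuous_intros)
  obtain C where C: "\<And>s. Re s \<ge> 3 / 2 \<Longrightarrow> norm (J (\<lambda>x. 1 - x) s) \<le> C" "C \<ge> 0"
    using J_bound[OF c, of "3/2"] by auto
  show ?thesis
  proof (rule that[of "1 + C"])
    fix s :: complex assume s: "Re s \<ge> 1 / 2"
    have "norm (Zf s) \<le> 1 + norm (s - 1) * (norm s * norm (J (\<lambda>x. 1 - x) (s + 1)))"
      using s norm_triangle_ineq[of 1 "(s - 1) * (s * J (\<lambda>x. 1 - x) (s + 1))"]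
      by (simp add: Zf_eq_J norm_mult)
    also have "\<dots> \<le> 1 + (1 + norm s) * ((1 + norm s) * C)"
      using s C norm_triangle_ineq4[of s 1]
      by (intro add_left_mono mult_mono) (auto intro: mult_nonneg_nonneg)
    also have "\<dots> \<le> (1 + norm s)^2 + (1 + norm s) * ((1 + norm s) * C)"
      by (simp add: one_le_power)
    also have "\<dots> = (1 + C) * (1 + norm s) ^ 2"
      by (simp add: power2_eq_square algebra_simps)
    finally show "norm (Zf s) \<le> (1 + C) * (1 + norm s) ^ 2" .
  qed (use C in auto)
qed

section \<open>Lower bounds for the zeta function\<close>

lemma summable_ln_powr:
  assumes "\<sigma> > 1"
  shows "summable (\<lambda>n. (1 + ln (real n + 1)) * (real n + 1) powr (- \<sigma>))"
proof -
  define d where "d = (\<sigma> - 1) / 2"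
  have d: "d > 0" "\<sigma> - d > 1" using assms by (auto simp: d_def field_simps)
  show ?thesis
  proof (rule summable_comparison_test'[of "\<lambda>n. (1 + 1 / d) * (real n + 1) powr (- (\<sigma> - d))" 0])
    fix n :: nat
    have "ln (real n + 1) \<le> (real n + 1) powr d / d"
      by (rule ln_powr_bound) (use d in auto)
    moreover have "1 \<le> (real n + 1) powr d"
      using d by (intro ge_one_powr_ge_zero) auto
    ultimately have "1 + ln (real n + 1) \<le> (1 + 1 / d) * (real n + 1) powr d"
      by (simp add: algebra_simps)
    then have "(1 + ln (real n + 1)) * (real n + 1) powr (- \<sigma>)
        \<le> (1 + 1 / d) * (real n + 1) powr d * (real n + 1) powr (- \<sigma>)"
      by (intro mult_right_mono) auto
    then show "norm ((1 + ln (real n + 1)) * (real n + 1) powr (- \<sigma>)) \<le> (1 + 1 / d) * (real n + 1) powr (- (\<sigma> - d))"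
      by (simp add: mult.assoc flip: powr_add)
  qed (use d in \<open>intro summable_mult summable_Suc_powr\<close>)
qed

section \<open>Dirichlet series with coefficients of logarithmic growth\<close>

definition dseries :: "(nat \<Rightarrow> real) \<Rightarrow> complex \<Rightarrow> complex" where
  "dseries a s = (\<Sum>n. of_real (a (Suc n)) * of_nat (Suc n) powr (- s))"

lemma norm_Suc_powr: "norm (of_nat (Suc n) powr (s :: complex)) = (real n + 1) powr Re s"
  using norm_of_real_powr[of "real n + 1" s] by (simp add: add_ac)

text \<open>The bound 1 + ln n covers all coefficient sequences that are summed below: 1, ln,
  \<open>mangoldt\<close> and \<open>log_zeta_coeff\<close>.\<close>

lemma dseries_term_bound:
  assumes "\<And>n. n \<ge> 1 \<Longrightarrow> \<bar>a n\<bar> \<le> 1 + ln (real n)" "Re s \<ge> \<sigma>"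
  shows "norm (of_real (a (Suc n)) * of_nat (Suc n) powr (- s))
    \<le> (1 + ln (real n + 1)) * (real n + 1) powr (- \<sigma>)"
proof -
  have "\<bar>a (Suc n)\<bar> \<le> 1 + ln (real n + 1)"
    using assms(1)[of "Suc n"] by (simp add: add_ac)
  moreover have "(real n + 1) powr (- Re s) \<le> (real n + 1) powr (- \<sigma>)"
    using assms(2) by (intro powr_mono) auto
  ultimately show ?thesis
    unfolding norm_mult norm_Suc_powr by (intro mult_mono) auto
qed

lemma dseries_abs_summable:
  assumes "\<And>n. n \<ge> 1 \<Longrightarrow> \<bar>a n\<bar> \<le> 1 + ln (real n)" "Re s > 1"
  shows "summable (\<lambda>n. norm (of_real (a (Suc n)) * of_nat (Suc n) powr (- s)))"
  by (rule summable_comparison_test'[OF summable_ln_powr[OF assms(2)], of 0])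
     (use dseries_term_bound[where a=a, OF assms(1), of "Re s" s] in auto)

text \<open>The coefficients of the derivative may grow like the square of ln n. Their series needs
  no bound of its own: its convergence comes with the differentiation of the locally dominated
  series.\<close>

lemma dseries_has_field_derivative:
  assumes "\<And>n. n \<ge> 1 \<Longrightarrow> \<bar>a n\<bar> \<le> 1 + ln (real n)" "Re s > 1"
  shows "(dseries a has_field_derivative - dseries (\<lambda>n. ln (real n) * a n) s) (at s)"
proof -
  have deriv_term: "((\<lambda>s. of_real (a (Suc n)) * of_nat (Suc n) powr (- s)) has_field_derivative
              - (of_real (ln (real (Suc n)) * a (Suc n)) * of_nat (Suc n) powr (- s))) (at s)" for n and s :: complex
  proof -
    have "((\<lambda>s. of_nat (Suc n) powr (- s)) has_field_derivative
              - (of_real (ln (real (Suc n))) * of_nat (Suc n) powr (- s))) (at s)"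
      using DERIV_chain2[OF has_field_derivative_powr_right[of "of_nat (Suc n)" "- s"] DERIV_minus[OF DERIV_ident]]
      by (simp add: Ln_of_nat del: of_nat_Suc)
    from DERIV_cmult[OF this, of "of_real (a (Suc n))"] show ?thesis
      by (simp add: mult_ac del: of_nat_Suc)
  qed
  have dom: "\<exists>d h. 0 < d \<and> summable h \<and> (\<forall>n. \<forall>y\<in>ball s d \<inter> {s. 1 < Re s}.
        norm (of_real (a (Suc n)) * of_nat (Suc n) powr (- y)) \<le> h n)" if s: "s \<in> {s. Re s > 1}" for s
  proof -
    define d where "d = (Re s - 1) / 2"
    have d: "d > 0" "1 + d > 1" "Re s - d = 1 + d"
      using s by (auto simp: d_def field_simps)
    have "norm (of_real (a (Suc n)) * of_nat (Suc n) powr (- y))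
        \<le> (1 + ln (real n + 1)) * (real n + 1) powr (- (1 + d))" if "y \<in> ball s d" for n y
    proof (rule dseries_term_bound[OF assms(1)])
      have "\<bar>Re s - Re y\<bar> \<le> norm (s - y)"
        by (metis abs_Re_le_cmod minus_complex.simps(1))
      then show "Re y \<ge> 1 + d"
        using that d by (auto simp: dist_norm)
    qed
    then show ?thesis
      using d(1) summable_ln_powr[OF d(2)]
      by (intro exI[of _ d] exI[of _ "\<lambda>n. (1 + ln (real n + 1)) * (real n + 1) powr (- (1 + d))"] conjI allI ballI)
         blast+
  qed
  have "s \<in> {s. Re s > 1}" using assms by simp
  note D = suminf_has_field_derivative[OF open_halfspace_Re_gt this deriv_term dom]
  have "(\<Sum>n. - (of_real (ln (real (Suc n)) * a (Suc n)) * of_nat (Suc n) powr (- s)))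
      = - dseries (\<lambda>n. ln (real n) * a n) s"
    unfolding dseries_def using D(2) by (subst suminf_minus[symmetric]) (auto simp only: summable_minus_iff)
  with D(1) show ?thesis by (simp only: dseries_def[abs_def])
qed

text \<open>Unordered summation is the form in which a product of two series can be
  regrouped.\<close>

lemma dseries_eq_infsum:
  assumes "\<And>n. n \<ge> 1 \<Longrightarrow> \<bar>a n\<bar> \<le> 1 + ln (real n)" "Re s > 1"
  shows "(\<lambda>n. norm (of_real (a n) * of_nat n powr (- s))) summable_on {1..}"
    and "dseries a s = (\<Sum>\<^sub>\<infinity>n\<in>{1..}. of_real (a n) * of_nat n powr (- s))"
proof -
  let ?f = "\<lambda>n. of_real (a n) * of_nat n powr (- s)"
  have b: "bij_betw Suc UNIV {1..}"
    by (rule bij_betwI[of _ _ _ "\<lambda>n. n - 1"]) auto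
  note sm = dseries_abs_summable[of a s, OF assms]
  have "(\<lambda>n. norm (?f (Suc n))) summable_on UNIV"
    using sm by (intro norm_summable_imp_summable_on) auto
  then show "(\<lambda>n. norm (?f n)) summable_on {1..}"
    using summable_on_reindex_bij_betw[OF b, of "\<lambda>n. norm (?f n)"] by simp
  have "((\<lambda>n. ?f (Suc n)) has_sum dseries a s) UNIV"
    unfolding dseries_def
    by (rule norm_summable_imp_has_sum[OF sm summable_sums[OF summable_norm_cancel[OF sm]]])
  then show "dseries a s = (\<Sum>\<^sub>\<infinity>n\<in>{1..}. ?f n)"
    using has_sum_reindex_bij_betw[OF b, of ?f "dseries a s"] by (simp add: infsumI)
qed

text \<open>Dirichlet convolution: the double sum over (d, e) is regrouped by n = d e, and the
  divisor sum of \<open>mangoldt\<close> is ln n. In other words, -\<zeta>'/\<zeta> is the Mangoldt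
  series.\<close>

lemma dseries_mangoldt_mult_zeta:
  assumes s: "Re s > 1"
  shows "dseries mangoldt s * dseries (\<lambda>_. 1) s = dseries (\<lambda>n. ln (real n)) s"
proof -
  let ?f = "\<lambda>n::nat. of_real (mangoldt n) * of_nat n powr (- s)"
  let ?g = "\<lambda>n::nat. of_real 1 * of_nat n powr (- s)"
  let ?F = "\<lambda>(d, e). ?f d * ?g e"
  have a1: "\<bar>mangoldt n\<bar> \<le> 1 + ln (real n)" if "n \<ge> 1" for n
    using mangoldt_le[of n] mangoldt_nonneg[of n] that by simp
  have a2: "\<bar>1\<bar> \<le> 1 + ln (real n)" if "n \<ge> 1" for n
    using that by simp
  note f = dseries_eq_infsum[where a=mangoldt, OF a1 s]
  note g = dseries_eq_infsum[where a="\<lambda>_. 1", OF a2 s]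
  have F: "(\<lambda>x. norm (?F x)) summable_on {1..} \<times> {1..}"
  proof (subst Infinite_Sum.abs_summable_on_Sigma_iff, intro conjI ballI)
    fix d :: nat
    show "(\<lambda>e. norm (?F (d, e))) summable_on {1..}"
      using summable_on_cmult_right[OF g(1), of "norm (?f d)"] by (simp add: norm_mult)
  next
    have "(\<lambda>d. norm (?f d) * (\<Sum>\<^sub>\<infinity>e\<in>{1..}. norm (?g e))) summable_on {1..}"
      by (rule summable_on_cmult_left[OF f(1)])
    moreover have "(\<Sum>\<^sub>\<infinity>e\<in>{1..}. norm (?F (d, e))) = norm (?f d) * (\<Sum>\<^sub>\<infinity>e\<in>{1..}. norm (?g e))" for d
      by (simp add: norm_mult infsum_cmult_right')
    ultimately show "(\<lambda>d. norm (\<Sum>\<^sub>\<infinity>e\<in>{1..}. norm (?F (d, e)))) summable_on {1..}"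
      by (simp add: infsum_nonneg)
  qed
  \<comment> \<open>A pair (n, d) with d dividing n corresponds to the pair (d, n/d); n \<ge> 1
    keeps both factors positive.\<close>
  have b: "bij_betw (\<lambda>(n, d). (d, n div d)) (SIGMA n:{1::nat..}. {d. d dvd n}) ({1..} \<times> {1..})"
    by (rule bij_betwI[of _ _ _ "\<lambda>(d, e). (d * e, d)"])
       (auto elim!: dvdE simp: Suc_le_eq)
  have "dseries mangoldt s * dseries (\<lambda>_. 1) s = (\<Sum>\<^sub>\<infinity>d\<in>{1..}. \<Sum>\<^sub>\<infinity>e\<in>{1..}. ?f d * ?g e)"
    by (simp only: f(2) g(2) infsum_cmult_right' infsum_cmult_left')
  also have "\<dots> = infsum ?F ({1..} \<times> {1..})"
    using infsum_Sigma'_banach[OF abs_summable_summable[OF F]] by simp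
  also have "\<dots> = (\<Sum>\<^sub>\<infinity>(n, d)\<in>(SIGMA n:{1..}. {d. d dvd n}). ?F (d, n div d))"
    using infsum_reindex_bij_betw[OF b, of ?F] by (simp add: case_prod_unfold)
  also have "\<dots> = (\<Sum>\<^sub>\<infinity>n\<in>{1..}. \<Sum>\<^sub>\<infinity>d\<in>{d. d dvd n}. ?F (d, n div d))"
  proof (rule infsum_Sigma'_banach[symmetric])
    show "(\<lambda>(n, d). ?F (d, n div d)) summable_on (SIGMA n:{1::nat..}. {d. d dvd n})"
      using summable_on_reindex_bij_betw[OF b, of ?F] abs_summable_summable[OF F] by (simp add: case_prod_unfold)
  qed
  also have "\<dots> = (\<Sum>\<^sub>\<infinity>n\<in>{1..}. of_real (ln (real n)) * of_nat n powr (- s))"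
  proof (rule infsum_cong)
    fix n :: nat assume n: "n \<in> {1..}"
    have "(\<Sum>\<^sub>\<infinity>d\<in>{d. d dvd n}. ?F (d, n div d)) = (\<Sum>d | d dvd n. ?F (d, n div d))"
      using n by (intro infsum_finite) auto
    also have "\<dots> = (\<Sum>d | d dvd n. of_real (mangoldt d) * of_nat n powr (- s))"
    proof (rule sum.cong)
      fix d assume "d \<in> {d. d dvd n}"
      then obtain e where e: "n = d * e" by auto
      with n have "d > 0" "e > 0" by (auto intro!: Nat.gr0I)
      then show "?F (d, n div d) = of_real (mangoldt d) * of_nat n powr (- s)"
        using powr_times_real[of "of_nat d" "of_nat e" "-s"] by (simp add: e)
    qed simp
    also have "\<dots> = of_real (\<Sum>d | d dvd n. mangoldt d) * of_nat n powr (- s)"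
      by (simp add: sum_distrib_right)
    also have "(\<Sum>d | d dvd n. mangoldt d :: real) = ln (real n)"
      using n mangoldt_sum[of n, where 'a=real] by simp
    finally show "(\<Sum>\<^sub>\<infinity>d\<in>{d. d dvd n}. ?F (d, n div d)) = of_real (ln (real n)) * of_nat n powr (- s)" .
  qed
  also have "\<dots> = dseries (\<lambda>n. ln (real n)) s"
    by (rule dseries_eq_infsum(2)[symmetric]) (use s in auto)
  finally show ?thesis .
qed

section \<open>The logarithm of zeta and the 3-4-1 inequality\<close>

text \<open>The value at \<open>n = 1\<close> is \<open>0 / 0 = 0\<close>.\<close>
definition log_zeta_coeff :: "nat \<Rightarrow> real" where
  "log_zeta_coeff n = mangoldt n / ln (real n)"

lemma log_zeta_coeff_nonneg: "log_zeta_coeff n \<ge> 0"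
  by (cases "n = 0") (auto simp: log_zeta_coeff_def mangoldt_nonneg)

lemma log_zeta_coeff_bound: "n \<ge> 1 \<Longrightarrow> \<bar>log_zeta_coeff n\<bar> \<le> 1 + ln (real n)"
proof -
  assume n: "n \<ge> 1"
  have "log_zeta_coeff n \<le> 1"
    using mangoldt_le[of n] n by (cases "n = 1") (auto simp: log_zeta_coeff_def divide_simps)
  moreover have "0 \<le> ln (real n)" using n by simp
  ultimately show ?thesis using log_zeta_coeff_nonneg[of n] by linarith
qed

text \<open>Replaces the Euler product. The logarithmic derivative of \<zeta> is the derivative of
  the series with coefficients \<open>log_zeta_coeff\<close>, so \<zeta> times exp of minus that
  series is constant. The lower bounds ask only that this constant be nonzero.\<close>

lemma zeta_eq_exp:
  obtains c where "c \<noteq> 0" "\<And>s. Re s > 1 \<Longrightarrow> zeta s = c * exp (dseries log_zeta_coeff s)"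
proof -
  have z: "zeta s = dseries (\<lambda>_. 1) s" if "Re s > 1" for s
    using that by (simp add: zeta_eq_zeta_series zeta_series_def dseries_def powr_minus_divide)
  have dl: "(dseries log_zeta_coeff has_field_derivative - dseries mangoldt s) (at s)" if "Re s > 1" for s
  proof -
    have "(\<lambda>n. ln (real n) * log_zeta_coeff n) (Suc k) = mangoldt (Suc k)" for k
      by (cases "k = 0") (auto simp: log_zeta_coeff_def)
    then have "dseries (\<lambda>n. ln (real n) * log_zeta_coeff n) s = dseries mangoldt s"
      by (simp add: dseries_def)
    then show ?thesis
      using dseries_has_field_derivative[OF log_zeta_coeff_bound that] by simp
  qed
  have d1: "(dseries (\<lambda>_. 1) has_field_derivative - (dseries mangoldt s * dseries (\<lambda>_. 1) s)) (at s)"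
    if "Re s > 1" for s
    using dseries_has_field_derivative[of "\<lambda>_. 1" s] that by (simp add: dseries_mangoldt_mult_zeta)
  have "\<exists>c. \<forall>s\<in>{s. Re s > 1}. dseries (\<lambda>_. 1) s * exp (- dseries log_zeta_coeff s) = c"
  proof (rule has_field_derivative_zero_constant)
    fix s :: complex assume s: "s \<in> {s. Re s > 1}"
    show "((\<lambda>s. dseries (\<lambda>_. 1) s * exp (- dseries log_zeta_coeff s)) has_field_derivative 0) (at s within {s. Re s > 1})"
    proof (rule has_field_derivative_at_within)
      have "Re s > 1" using s by simp
      from DERIV_mult[OF d1[OF this] DERIV_fun_exp[OF DERIV_minus[OF dl[OF this]]]]
      show "((\<lambda>s. dseries (\<lambda>_. 1) s * exp (- dseries log_zeta_coeff s)) has_field_derivative 0) (at s)"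
        by (simp add: mult_ac)
    qed
  qed (rule convex_halfspace_Re_gt)
  then obtain c where c: "\<And>s. Re s > 1 \<Longrightarrow> dseries (\<lambda>_. 1) s * exp (- dseries log_zeta_coeff s) = c"
    by auto
  have eq: "zeta s = c * exp (dseries log_zeta_coeff s)" if "Re s > 1" for s
    unfolding c[OF that, symmetric] using that z by (simp add: mult.assoc flip: exp_add)
  \<comment> \<open>If c were 0, \<open>Zf\<close> would vanish for Re s > 1 and, by continuity, at
    1, where its value is 1.\<close>
  have "c \<noteq> 0"
  proof
    assume "c = 0"
    then have Z0: "Zf s = 0" if "Re s > 1" for s
      using eq[OF that] that by (auto simp: Zf_def)
    have "isCont Zf 1"
      using holomorphic_on_imp_continuous_on[OF Zf_holomorphic] by (simp add: continuous_on_eq_continuous_at)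
    moreover have "(\<lambda>n. 1 + complex_of_real (1 / real (Suc n))) \<longlonglongrightarrow> 1 + of_real 0"
      by (intro tendsto_intros LIMSEQ_Suc lim_1_over_n)
    ultimately have "(\<lambda>n. Zf (1 + complex_of_real (1 / real (Suc n)))) \<longlonglongrightarrow> Zf 1"
      by (intro isCont_tendsto_compose[of 1 Zf]) auto
    moreover have "Zf (1 + complex_of_real (1 / real (Suc n))) = 0" for n
      by (rule Z0) auto
    ultimately show False
      by (simp add: LIMSEQ_const_iff)
  qed
  with eq show ?thesis using that by blast
qed

text \<open>At height t the n-th term has real part a(n) n^(-\<sigma>) cos(t ln n). The
  trigonometric inequality with \<theta> = t ln n applies term by term because the coefficients are
  nonnegative.\<close>

lemma Re_dseries_nonneg_comb:
  assumes a: "\<And>n. n \<ge> 1 \<Longrightarrow> \<bar>a n\<bar> \<le> 1 + ln (real n)" "\<And>n. a n \<ge> 0" and "\<sigma> > 1"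
    and "\<And>\<theta>. A + B * cos \<theta> + C * cos (2 * \<theta>) \<ge> (0::real)"
  shows "A * Re (dseries a (Complex \<sigma> 0)) + B * Re (dseries a (Complex \<sigma> t)) + C * Re (dseries a (Complex \<sigma> (2 * t))) \<ge> 0"
proof -
  let ?T = "\<lambda>t n. of_real (a (Suc n)) * of_nat (Suc n) powr (- Complex \<sigma> t)"
  have sm: "summable (?T t)" for t
    using dseries_abs_summable[OF a(1), of "Complex \<sigma> t"] assms(3) by (auto intro: summable_norm_cancel)
  have ReT: "Re (?T t n) = a (Suc n) * (real (Suc n) powr (- \<sigma>) * cos (t * ln (real (Suc n))))" for t n
    by (simp add: powr_def Ln_of_nat Re_exp powr_real_def mult_ac del: of_nat_Suc)
  have S: "(\<lambda>n. Re (?T t n)) sums Re (dseries a (Complex \<sigma> t))" for t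
    unfolding dseries_def by (intro sums_Re summable_sums sm)
  have S0: "(\<lambda>n. A * Re (?T 0 n) + B * Re (?T t n) + C * Re (?T (2 * t) n)) sums
     (A * Re (dseries a (Complex \<sigma> 0)) + B * Re (dseries a (Complex \<sigma> t)) + C * Re (dseries a (Complex \<sigma> (2 * t))))"
    by (intro sums_add sums_mult S)
  have "A * Re (?T 0 n) + B * Re (?T t n) + C * Re (?T (2 * t) n) \<ge> 0" for n
  proof -
    let ?\<theta> = "t * ln (real (Suc n))"
    have "A * Re (?T 0 n) + B * Re (?T t n) + C * Re (?T (2 * t) n) =
       a (Suc n) * real (Suc n) powr (- \<sigma>) * (A + B * cos ?\<theta> + C * cos (2 * ?\<theta>))"
      unfolding ReT by (simp add: algebra_simps)
    also have "\<dots> \<ge> 0"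
      by (intro mult_nonneg_nonneg a assms) auto
    finally show ?thesis .
  qed
  from sums_le[OF this sums_zero S0] show ?thesis .
qed

text \<open>Exponentiated trigonometric inequalities. 1 + cos \<theta> \<ge> 0 serves the
  half-planes Re s \<ge> 1 + \<delta>. Mertens' 3 + 4 cos \<theta> + cos 2\<theta> = 2 (1 + cos
  \<theta>)^2 remains useful up to Re s = 1, because the power 4 at height t exceeds the power 3 of
  the pole.\<close>

lemma zeta_products_lower_bound:
  obtains c where "c > 0"
    "\<And>\<sigma> t. \<sigma> > 1 \<Longrightarrow> norm (zeta (Complex \<sigma> 0)) * norm (zeta (Complex \<sigma> t)) \<ge> c"
    "\<And>\<sigma> t. \<sigma> > 1 \<Longrightarrow> norm (zeta (Complex \<sigma> 0)) ^ 3 * norm (zeta (Complex \<sigma> t)) ^ 4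
          * norm (zeta (Complex \<sigma> (2 * t))) \<ge> c"
    "\<And>s. Re s > 1 \<Longrightarrow> zeta s \<noteq> 0"
proof -
  obtain c where c: "c \<noteq> 0" "\<And>s. Re s > 1 \<Longrightarrow> zeta s = c * exp (dseries log_zeta_coeff s)"
    using zeta_eq_exp by blast
  let ?L = "\<lambda>\<sigma> t. Re (dseries log_zeta_coeff (Complex \<sigma> t))"
  have n: "norm (zeta (Complex \<sigma> t)) = norm c * exp (?L \<sigma> t)" if "\<sigma> > 1" for \<sigma> t
    using c(2)[of "Complex \<sigma> t"] that by (simp add: norm_mult)
  have cos2: "1 * 1 + 1 * cos \<theta> + 0 * cos (2 * \<theta>) \<ge> 0" for \<theta> :: real
    using cos_ge_minus_one[of \<theta>] by linarith
  have cos3: "3 + 4 * cos \<theta> + 1 * cos (2 * \<theta>) \<ge> 0" for \<theta> :: real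
  proof -
    have "3 + 4 * cos \<theta> + 1 * cos (2 * \<theta>) = 2 * (1 + cos \<theta>)\<^sup>2"
      unfolding cos_double_cos by (simp add: power2_eq_square algebra_simps)
    then show ?thesis by simp
  qed
  show ?thesis
  \<comment> \<open>The two products contain 2 and 3 + 4 + 1 = 8 factors c; the minimum serves
    both.\<close>
  proof (rule that[of "min (norm c ^ 2) (norm c ^ 8)"])
    fix \<sigma> t :: real assume s: "\<sigma> > 1"
    have "norm (zeta (Complex \<sigma> 0)) * norm (zeta (Complex \<sigma> t)) = norm c ^ 2 * exp (?L \<sigma> 0 + ?L \<sigma> t)"
      by (simp add: n[OF s] exp_add power2_eq_square)
    also have "\<dots> \<ge> norm c ^ 2 * 1"
      using Re_dseries_nonneg_comb[of log_zeta_coeff \<sigma> 1 1 0 t, OF log_zeta_coeff_bound log_zeta_coeff_nonneg s] cos2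
      by (intro mult_left_mono) auto
    finally show "norm (zeta (Complex \<sigma> 0)) * norm (zeta (Complex \<sigma> t)) \<ge> min (norm c ^ 2) (norm c ^ 8)"
      by simp
    have "norm (zeta (Complex \<sigma> 0)) ^ 3 * norm (zeta (Complex \<sigma> t)) ^ 4 * norm (zeta (Complex \<sigma> (2 * t)))
       = norm c ^ 8 * exp (3 * ?L \<sigma> 0 + 4 * ?L \<sigma> t + 1 * ?L \<sigma> (2 * t))"
    proof -
      have e3: "exp (3 * x) = exp x ^ 3" and e4: "exp (4 * x) = exp x ^ 4" for x :: real
        using exp_of_nat_mult[of 3 x] exp_of_nat_mult[of 4 x] by simp_all
      show ?thesis
        by (simp add: n[OF s] exp_add e3 e4 power_mult_distrib eval_nat_numeral)
    qed
    also have "\<dots> \<ge> norm c ^ 8 * 1"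
      using Re_dseries_nonneg_comb[of log_zeta_coeff \<sigma> 3 4 1 t, OF log_zeta_coeff_bound log_zeta_coeff_nonneg s] cos3
      by (intro mult_left_mono) auto
    finally show "norm (zeta (Complex \<sigma> 0)) ^ 3 * norm (zeta (Complex \<sigma> t)) ^ 4 * norm (zeta (Complex \<sigma> (2 * t)))
        \<ge> min (norm c ^ 2) (norm c ^ 8)"
      by simp
  qed (use c in auto)
qed

lemma zeta_upper_bound:
  assumes "\<delta> > 0"
  obtains K where "K > 0" "\<And>s. Re s \<ge> 1 + \<delta> \<Longrightarrow> norm (zeta s) \<le> K"
proof -
  have sm: "summable (\<lambda>n. (real n + 1) powr (- (1 + \<delta>)))"
    by (rule summable_Suc_powr) (use assms in auto)
  show ?thesis
  proof (rule that[of "\<Sum>n. (real n + 1) powr (- (1 + \<delta>))"])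
    show "0 < (\<Sum>n. (real n + 1) powr (- (1 + \<delta>)))"
      by (rule suminf_pos[OF sm]) auto
    fix s assume s: "Re s \<ge> 1 + \<delta>"
    have "zeta s = (\<Sum>n. of_nat (Suc n) powr (- s))"
      using s assms by (simp add: zeta_eq_zeta_series zeta_series_def powr_minus_divide)
    also have "norm \<dots> \<le> (\<Sum>n. (real n + 1) powr (- (1 + \<delta>)))"
    proof (rule norm_suminf_le[OF _ sm])
      fix n
      show "norm (of_nat (Suc n) powr (- s)) \<le> (real n + 1) powr (- (1 + \<delta>))"
        unfolding norm_Suc_powr using s by (intro powr_mono) auto
    qed
    finally show "norm (zeta s) \<le> (\<Sum>n. (real n + 1) powr (- (1 + \<delta>)))" .
  qed
qed

text \<open>In the first product bound the companion factor, at the real point Re s, is bounded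
  above.\<close>

lemma zeta_lower_bound:
  assumes "\<delta> > 0"
  obtains K where "K > 0" "\<And>s. Re s \<ge> 1 + \<delta> \<Longrightarrow> norm (zeta s) \<ge> K"
proof -
  obtain c where c: "c > 0" "\<And>\<sigma> t. \<sigma> > 1 \<Longrightarrow> norm (zeta (Complex \<sigma> 0)) * norm (zeta (Complex \<sigma> t)) \<ge> c"
    by (rule zeta_products_lower_bound) (rule that)
  obtain K where K: "K > 0" "\<And>s. Re s \<ge> 1 + \<delta> \<Longrightarrow> norm (zeta s) \<le> K"
    using zeta_upper_bound[OF assms] by blast
  show ?thesis
  proof (rule that[of "c / K"])
    fix s assume s: "Re s \<ge> 1 + \<delta>"
    have "c \<le> norm (zeta (Complex (Re s) 0)) * norm (zeta s)"
      using c(2)[of "Re s" "Im s"] s assms by simp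
    also have "\<dots> \<le> K * norm (zeta s)"
      using K(2)[of "Complex (Re s) 0"] s by (intro mult_right_mono) auto
    finally show "c / K \<le> norm (zeta s)"
      using K by (simp add: field_simps)
  qed (use c K in auto)
qed


section \<open>A polynomial lower bound for \<open>Zf\<close> up to the line Re s = 1\<close>

lemma Zf_eq: "s \<noteq> 1 \<Longrightarrow> Zf s = (s - 1) * zeta s"
  by (simp add: Zf_def)

text \<open>Cauchy's estimate on the disc of radius 1/2, which stays in Re \<ge> 1/2. On its
  boundary 1 + |x| is at most 4 (1 + |Im w|), and 32 = 4^2 / (1/2).\<close>

lemma norm_deriv_Zf_bound:
  assumes C: "\<And>s. Re s \<ge> 1 / 2 \<Longrightarrow> norm (Zf s) \<le> C * (1 + norm s) ^ 2" and "C \<ge> 1"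
    and w: "Re w \<ge> 1" "Re w \<le> 2"
  shows "norm (deriv Zf w) \<le> 32 * C * (1 + \<bar>Im w\<bar>) ^ 2"
proof -
  have nw: "norm w \<le> 2 + \<bar>Im w\<bar>"
    using cmod_le[of w] w by linarith
  have "norm ((deriv ^^ 1) Zf w) \<le> fact 1 * (C * (4 * (1 + \<bar>Im w\<bar>)) ^ 2) / (1 / 2) ^ 1"
  proof (rule Cauchy_inequality)
    show "Zf holomorphic_on ball w (1 / 2)" "continuous_on (cball w (1 / 2)) Zf"
      using Zf_holomorphic by (auto intro: holomorphic_on_subset holomorphic_on_imp_continuous_on continuous_on_subset)
    fix x assume x: "norm (w - x) = 1 / 2"
    have "\<bar>Re (w - x)\<bar> \<le> 1 / 2"
      using abs_Re_le_cmod[of "w - x"] x by simp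
    then have re: "Re x \<ge> 1 / 2"
      using w unfolding minus_complex.simps by linarith
    have "norm x \<le> norm w + 1 / 2"
      using norm_triangle_ineq4[of w "w - x"] x by simp
    then have "1 + norm x \<le> 4 * (1 + \<bar>Im w\<bar>)"
      using nw by simp
    then have "(1 + norm x) ^ 2 \<le> (4 * (1 + \<bar>Im w\<bar>)) ^ 2"
      by (intro power_mono) auto
    then show "norm (Zf x) \<le> C * (4 * (1 + \<bar>Im w\<bar>)) ^ 2"
      using C[OF re] assms(2) by (meson mult_left_mono order_trans zero_le_one)
  qed auto
  also have "\<dots> = 32 * C * (1 + \<bar>Im w\<bar>) ^ 2"
    unfolding power_mult_distrib by simp
  finally show ?thesis by simp
qed

text \<open>The height t' is separate from t because the 3-4-1 product involves the height 2t, to be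
  measured in terms of t.\<close>

lemma Zf_Complex_bound:
  assumes C: "\<And>s. Re s \<ge> 1 / 2 \<Longrightarrow> norm (Zf s) \<le> C * (1 + norm s) ^ 2" and "C \<ge> 1"
    and "1 \<le> \<sigma>" "\<sigma> \<le> 2" "\<bar>t'\<bar> \<le> 2 * \<bar>t\<bar>"
  shows "norm (Zf (Complex \<sigma> t')) \<le> 9 * C * (1 + \<bar>t\<bar>) ^ 2"
proof -
  have "norm (Complex \<sigma> t') \<le> 2 + 2 * \<bar>t\<bar>"
    using cmod_le[of "Complex \<sigma> t'"] assms by simp
  then have "(1 + norm (Complex \<sigma> t')) ^ 2 \<le> (3 * (1 + \<bar>t\<bar>)) ^ 2"
    by (intro power_mono) auto
  then have "C * (1 + norm (Complex \<sigma> t')) ^ 2 \<le> C * (3 * (1 + \<bar>t\<bar>)) ^ 2"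
    using assms(2) by (intro mult_left_mono) auto
  also have "\<dots> = 9 * C * (1 + \<bar>t\<bar>) ^ 2"
    unfolding power_mult_distrib by simp
  finally show ?thesis
    using C[of "Complex \<sigma> t'"] assms(3) by simp
qed

text \<open>The 3-4-1 inequality bounds |\<open>Zf\<close>|^4 (1 + |t|)^2 below by a constant times
  (\<sigma> - 1)^3. Measuring \<sigma> - 1 by a fourth power x^4 makes the right side (x^3)^4, so
  that fourth roots can be taken without fractional exponents.\<close>

lemma Zf_lower_bound_right:
  assumes m: "0 < m" "m \<le> 1"
  obtains k where "0 < k" "k \<le> 1"
    "\<And>\<sigma> t x. \<bar>t\<bar> \<ge> m \<Longrightarrow> 0 < x \<Longrightarrow> 1 + x ^ 4 \<le> \<sigma> \<Longrightarrow> \<sigma> \<le> 2 \<Longrightarrow>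
        norm (Zf (Complex \<sigma> t)) \<ge> k * x ^ 3 / (1 + \<bar>t\<bar>)"
proof -
  obtain C where C: "\<And>s. Re s \<ge> 1 / 2 \<Longrightarrow> norm (Zf s) \<le> C * (1 + norm s) ^ 2" "C \<ge> 1"
    using Zf_bound by blast
  obtain c where c: "c > 0"
    "\<And>\<sigma> t. \<sigma> > 1 \<Longrightarrow> norm (zeta (Complex \<sigma> 0)) ^ 3 * norm (zeta (Complex \<sigma> t)) ^ 4
          * norm (zeta (Complex \<sigma> (2 * t))) \<ge> c"
    by (rule zeta_products_lower_bound) (rule that)
  define K where "K = c * m ^ 5 / (9 * C) ^ 4"
  \<comment> \<open>With k \<le> 1 one has k^4 \<le> k \<le> K, which replaces a fourth root of
    K.\<close>
  define k where "k = min 1 K"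
  have K: "K > 0"
    unfolding K_def using c m C by (intro divide_pos_pos mult_pos_pos zero_less_power) auto
  have k: "0 < k" "k \<le> 1" "k ^ 4 \<le> K"
  proof -
    show "0 < k" "k \<le> 1" using K by (auto simp: k_def)
    then have "k ^ 4 \<le> k ^ 1" by (intro power_decreasing) auto
    then show "k ^ 4 \<le> K" by (simp add: k_def)
  qed
  show ?thesis
  proof (rule that[OF k(1,2)])
    fix \<sigma> t x :: real
    assume t: "\<bar>t\<bar> \<ge> m" and x: "0 < x" "1 + x ^ 4 \<le> \<sigma>" and s2: "\<sigma> \<le> 2"
    define T where "T = 1 + \<bar>t\<bar>"
    define \<eta> where "\<eta> = \<sigma> - 1"
    have T: "T \<ge> 1" by (simp add: T_def)
    have \<eta>: "\<eta> \<ge> x ^ 4" "x ^ 4 > 0" using x by (auto simp: \<eta>_def)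
    then have \<eta>0: "\<eta> > 0" by linarith
    have s1: "\<sigma> > 1" using \<eta>0 by (simp add: \<eta>_def)
    have Z: "norm (Zf (Complex \<sigma> r)) = norm (Complex \<eta> r) * norm (zeta (Complex \<sigma> r))" for r
    proof -
      have "Complex \<sigma> r \<noteq> 1" "Complex \<sigma> r - 1 = Complex \<eta> r" using s1 by (auto simp: complex_eq_iff \<eta>_def)
      then show ?thesis by (simp add: Zf_eq norm_mult)
    qed
    define a b d where "a = norm (Zf (Complex \<sigma> 0))" and "b = norm (Zf (Complex \<sigma> t))"
      and "d = norm (Zf (Complex \<sigma> (2 * t)))"
    have n0: "norm (Complex \<eta> 0) = \<eta>" using \<eta>0 by (simp add: cmod_def)
    have n1: "m \<le> norm (Complex \<eta> r)" if "\<bar>r\<bar> \<ge> m" for r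
      using abs_Im_le_cmod[of "Complex \<eta> r"] that by simp
    \<comment> \<open>Passing from \<zeta> to \<open>Zf\<close> costs a factor |s - 1| per
      occurrence: three of them equal \<eta>, at the real point, and 4 + 1 are at least m, at the
      heights t and 2t.\<close>
    have "c * (\<eta> ^ 3 * m ^ 4 * m) \<le> c * (norm (Complex \<eta> 0) ^ 3 * norm (Complex \<eta> t) ^ 4 * norm (Complex \<eta> (2 * t)))"
      unfolding n0 using c(1) m t \<eta>0 n1[of t] n1[of "2 * t"]
      by (intro mult_left_mono mult_mono power_mono) auto
    also have "\<dots> \<le> (norm (zeta (Complex \<sigma> 0)) ^ 3 * norm (zeta (Complex \<sigma> t)) ^ 4
          * norm (zeta (Complex \<sigma> (2 * t)))) * (norm (Complex \<eta> 0) ^ 3 * norm (Complex \<eta> t) ^ 4 * norm (Complex \<eta> (2 * t)))"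
      by (intro mult_right_mono c(2) s1) auto
    also have "\<dots> = a ^ 3 * b ^ 4 * d"
      by (simp add: a_def b_def d_def Z power_mult_distrib)
    also have "\<dots> \<le> (9 * C) ^ 3 * b ^ 4 * (9 * C * T ^ 2)"
    proof (intro mult_mono power_mono)
      show "a \<le> 9 * C"
        using Zf_Complex_bound[OF C, of \<sigma> 0 0] s1 s2 by (simp add: a_def)
      show "d \<le> 9 * C * T ^ 2"
        using Zf_Complex_bound[OF C, of \<sigma> "2 * t" t] s1 s2 by (simp add: d_def T_def)
    qed (use C in \<open>auto simp: a_def b_def d_def\<close>)
    also have "\<dots> = (9 * C) ^ 4 * (b ^ 4 * T ^ 2)"
      by (simp add: eval_nat_numeral)
    finally have "c * m ^ 5 * \<eta> ^ 3 \<le> (9 * C) ^ 4 * (b ^ 4 * T ^ 2)"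
      by (simp add: eval_nat_numeral mult_ac)
    then have 1: "K * \<eta> ^ 3 \<le> b ^ 4 * T ^ 2"
      using C by (simp add: K_def divide_simps mult_ac)
    have "(k * x ^ 3) ^ 4 = k ^ 4 * (x ^ 4) ^ 3"
      by (simp add: power_mult_distrib flip: power_mult)
    also have "\<dots> \<le> K * \<eta> ^ 3"
      using k \<eta> K by (intro mult_mono power_mono) auto
    \<comment> \<open>T^2 is enlarged to T^4 so that both sides are fourth powers.\<close>
    also have "\<dots> \<le> b ^ 4 * T ^ 4"
      using T by (intro order_trans[OF 1] mult_left_mono power_increasing) auto
    also have "\<dots> = (b * T) ^ 4"
      by (simp add: power_mult_distrib)
    finally have "k * x ^ 3 \<le> b * T"
      by (rule power_le_imp_le_base[of _ 3, simplified]) (use T in \<open>auto simp: b_def\<close>)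
    then show "norm (Zf (Complex \<sigma> t)) \<ge> k * x ^ 3 / (1 + \<bar>t\<bar>)"
      using T by (simp add: b_def T_def field_simps)
  qed
qed

text \<open>
  The point \<open>1 + x ^ 4\<close> balances the lower bound \<open>k * x ^ 3 / T\<close> available there against the
  variation \<open>x ^ 4 * 32 * C * T ^ 2\<close> of \<open>Zf\<close> to its left, for \<open>x\<close> a small multiple of \<open>T ^ (-3)\<close>.
\<close>
lemma Zf_lower_bound_away:
  assumes m: "0 < m" "m \<le> 1"
  obtains \<kappa> where "0 < \<kappa>"
    "\<And>s. 1 \<le> Re s \<Longrightarrow> Re s \<le> 2 \<Longrightarrow> m \<le> \<bar>Im s\<bar> \<Longrightarrow> norm (Zf s) \<ge> \<kappa> / (1 + \<bar>Im s\<bar>) ^ 10"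
proof -
  obtain C where C: "\<And>s. Re s \<ge> 1 / 2 \<Longrightarrow> norm (Zf s) \<le> C * (1 + norm s) ^ 2" "C \<ge> 1"
    using Zf_bound by blast
  obtain k where k: "0 < k" "k \<le> 1"
    "\<And>\<sigma> t x. \<bar>t\<bar> \<ge> m \<Longrightarrow> 0 < x \<Longrightarrow> 1 + x ^ 4 \<le> \<sigma> \<Longrightarrow> \<sigma> \<le> 2 \<Longrightarrow>
        norm (Zf (Complex \<sigma> t)) \<ge> k * x ^ 3 / (1 + \<bar>t\<bar>)"
    using Zf_lower_bound_right[OF m] by blast
  \<comment> \<open>64 = 2 * 32: with x = q / T^3 the variation 32 C T^2 x^4 is exactly half of the
    lower bound k x^3 / T.\<close>
  define q where "q = k / (64 * C)"
  have q: "q > 0" "q \<le> 1" using k C by (auto simp: q_def field_simps)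
  show ?thesis
  proof (rule that[of "k * q ^ 3 / 2"])
    fix s :: complex assume s: "1 \<le> Re s" "Re s \<le> 2" "m \<le> \<bar>Im s\<bar>"
    define T where "T = 1 + \<bar>Im s\<bar>"
    have T: "T \<ge> 1" by (simp add: T_def)
    define x where "x = q / T ^ 3"
    have x: "x > 0" "x \<le> 1"
      using q T by (auto simp: x_def divide_le_eq intro: order_trans[OF _ one_le_power])
    have x4: "x ^ 4 \<le> 1" using x by (simp add: power_le_one)
    \<comment> \<open>Origin of the exponent 10: x^3 contributes T^9 and the lower bound itself one
      more T.\<close>
    have main: "k * x ^ 3 / T = k * q ^ 3 / T ^ 10"
      by (simp add: x_def power_divide power_mult_distrib flip: power_mult power_Suc2)
    show "norm (Zf s) \<ge> k * q ^ 3 / 2 / (1 + \<bar>Im s\<bar>) ^ 10"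
    proof (cases "1 + x ^ 4 \<le> Re s")
      case True
      have "k * q ^ 3 / T ^ 10 \<le> norm (Zf (Complex (Re s) (Im s)))"
        using k(3)[OF s(3) x(1) True s(2)] main by (simp add: T_def)
      moreover have "k * q ^ 3 / 2 / T ^ 10 \<le> k * q ^ 3 / T ^ 10"
        using k q T by (intro divide_right_mono) auto
      ultimately show ?thesis by (simp add: T_def)
    next
      case False
      define w where "w = Complex (1 + x ^ 4) (Im s)"
      have seg: "1 \<le> Re z \<and> Re z \<le> 2 \<and> Im z = Im s" if "z \<in> closed_segment s w" for z
      proof -
        from that obtain u where u: "0 \<le> u" "u \<le> 1" "z = (1 - u) *\<^sub>R s + u *\<^sub>R w"
          by (auto simp: closed_segment_def)
        have "Re z \<ge> (1 - u) * 1 + u * 1" "Re z \<le> (1 - u) * 2 + u * 2"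
          using u s x4 x unfolding u(3) w_def plus_complex.simps scaleR_complex.simps complex.sel
          by (intro add_mono mult_left_mono; simp)+
        moreover have "Im z = Im s"
          unfolding u(3) w_def by (simp add: algebra_simps)
        ultimately show ?thesis by (simp add: algebra_simps)
      qed
      have "norm (Zf w - Zf s) \<le> 32 * C * T ^ 2 * norm (w - s)"
      proof (rule field_differentiable_bound[of "closed_segment s w" Zf "deriv Zf"])
        fix z assume z: "z \<in> closed_segment s w"
        show "(Zf has_field_derivative deriv Zf z) (at z within closed_segment s w)"
          using holomorphic_derivI[OF Zf_holomorphic] by (simp add: has_field_derivative_at_within)
        show "norm (deriv Zf z) \<le> 32 * C * T ^ 2"
          using norm_deriv_Zf_bound[OF C, of z] seg[OF z] by (simp add: T_def)
      qed auto
      also have "norm (w - s) \<le> x ^ 4"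
      proof -
        have "w - s = of_real (1 + x ^ 4 - Re s)" by (simp add: w_def complex_eq_iff)
        then have "norm (w - s) = \<bar>1 + x ^ 4 - Re s\<bar>" by (metis norm_of_real)
        then show ?thesis using False s by simp
      qed
      then have "32 * C * T ^ 2 * norm (w - s) \<le> 32 * C * T ^ 2 * x ^ 4"
        using C by (intro mult_left_mono) auto
      also have "32 * C * T ^ 2 * x ^ 4 = (k * q ^ 3 / 2) / T ^ 10"
        using T C by (simp add: x_def q_def power_divide field_simps eval_nat_numeral)
      finally have 1: "norm (Zf w - Zf s) \<le> (k * q ^ 3 / 2) / T ^ 10" .
      have 2: "k * q ^ 3 / T ^ 10 \<le> norm (Zf w)"
        using k(3)[OF s(3) x(1), of "1 + x ^ 4"] x4 main by (simp add: T_def w_def)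
      define e where "e = (k * q ^ 3 / 2) / T ^ 10"
      have "k * q ^ 3 / T ^ 10 = e + e"
        by (simp add: e_def)
      then have "e \<le> norm (Zf s)"
        using 1[folded e_def] 2 norm_triangle_ineq2[of "Zf w" "Zf s"] by linarith
      then show ?thesis by (simp add: e_def T_def)
    qed
  qed (use k q in auto)
qed

text \<open>On the line Re s = 1 the quantitative bound is applied with a threshold m adapted to the
  height of s.\<close>

lemma Zf_nonzero:
  assumes "Re s \<ge> 1"
  shows "Zf s \<noteq> 0"
proof -
  have nz: "zeta s \<noteq> 0" if "Re s > 1" for s
    by (rule zeta_products_lower_bound) (use that in blast)
  consider "s = 1" | "Re s > 1" | "Re s = 1" "Im s \<noteq> 0"
    using assms by (fastforce simp: complex_eq_iff)
  then show ?thesis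
  proof cases
    case 2
    then have "s \<noteq> 1" by auto
    then show ?thesis using nz[OF 2] by (simp add: Zf_eq)
  next
    case 3
    obtain \<kappa> where "0 < \<kappa>"
      "\<And>z. 1 \<le> Re z \<Longrightarrow> Re z \<le> 2 \<Longrightarrow> min 1 \<bar>Im s\<bar> \<le> \<bar>Im z\<bar> \<Longrightarrow> norm (Zf z) \<ge> \<kappa> / (1 + \<bar>Im z\<bar>) ^ 10"
      by (rule Zf_lower_bound_away[of "min 1 \<bar>Im s\<bar>"]) (use 3 in auto)
    from this(1) this(2)[of s] 3 have "norm (Zf s) > 0"
      by (smt (verit) divide_pos_pos zero_less_power)
    then show ?thesis by simp
  qed simp
qed

text \<open>Heights |Im s| \<ge> 1 are covered by the previous bound. The remaining rectangle, which
  contains the point 1, is compact, and \<open>Zf\<close> has no zero on it.\<close>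

lemma Zf_lower_bound:
  obtains \<kappa> where "0 < \<kappa>"
    "\<And>s. 1 \<le> Re s \<Longrightarrow> Re s \<le> 2 \<Longrightarrow> norm (Zf s) \<ge> \<kappa> / (1 + \<bar>Im s\<bar>) ^ 10"
proof -
  obtain \<kappa> where \<kappa>: "0 < \<kappa>"
    "\<And>s. 1 \<le> Re s \<Longrightarrow> Re s \<le> 2 \<Longrightarrow> 1 \<le> \<bar>Im s\<bar> \<Longrightarrow> norm (Zf s) \<ge> \<kappa> / (1 + \<bar>Im s\<bar>) ^ 10"
    by (rule Zf_lower_bound_away[of 1]) auto
  have "\<exists>x\<in>cbox (Complex 1 (-1)) (Complex 2 1). \<forall>y\<in>cbox (Complex 1 (-1)) (Complex 2 1). norm (Zf x) \<le> norm (Zf y)"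
    by (rule continuous_attains_inf)
       (use in_cbox_complex_iff[of 1 "Complex 1 (-1)" "Complex 2 1"] in
         \<open>auto intro!: continuous_intros continuous_on_subset[OF holomorphic_on_imp_continuous_on[OF Zf_holomorphic]]\<close>)
  then obtain x where x: "x \<in> cbox (Complex 1 (-1)) (Complex 2 1)"
    "\<And>y. y \<in> cbox (Complex 1 (-1)) (Complex 2 1) \<Longrightarrow> norm (Zf x) \<le> norm (Zf y)"
    by blast
  have pos: "norm (Zf x) > 0"
    using Zf_nonzero[of x] x(1) by (simp add: in_cbox_complex_iff)
  show ?thesis
  proof (rule that[of "min \<kappa> (norm (Zf x))"])
    fix s :: complex assume s: "1 \<le> Re s" "Re s \<le> 2"
    have "1 \<le> (1 + \<bar>Im s\<bar>) ^ 10" by (intro one_le_power) auto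
    then have 1: "min \<kappa> (norm (Zf x)) / (1 + \<bar>Im s\<bar>) ^ 10 \<le> min \<kappa> (norm (Zf x)) / 1"
      using \<kappa> pos by (intro divide_left_mono) auto
    show "min \<kappa> (norm (Zf x)) / (1 + \<bar>Im s\<bar>) ^ 10 \<le> norm (Zf s)"
    proof (cases "1 \<le> \<bar>Im s\<bar>")
      case True
      have "min \<kappa> (norm (Zf x)) / (1 + \<bar>Im s\<bar>) ^ 10 \<le> \<kappa> / (1 + \<bar>Im s\<bar>) ^ 10"
        by (intro divide_right_mono) auto
      with \<kappa>(2)[OF s True] show ?thesis by linarith
    next
      case False
      then have "norm (Zf x) \<le> norm (Zf s)"
        using s by (intro x(2)) (auto simp: in_cbox_complex_iff)
      with 1 show ?thesis by linarith
    qed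
  qed (use \<kappa> pos in auto)
qed

section \<open>Smooth functions\<close>

text \<open>An explicit tower of derivatives serves as the witness of smoothness. Unlike iterated
  \<open>vector_derivative\<close>, it can be given on a subset such as the half-line t > 0.\<close>

definition derivs_on :: "real set \<Rightarrow> (real \<Rightarrow> complex) \<Rightarrow> (nat \<Rightarrow> real \<Rightarrow> complex) \<Rightarrow> bool" where
  "derivs_on S f F \<longleftrightarrow> F 0 = f \<and> (\<forall>n. \<forall>x\<in>S. (F n has_vector_derivative F (Suc n) x) (at x))"

definition Csmooth :: "real set \<Rightarrow> (real \<Rightarrow> complex) \<Rightarrow> bool" where
  "Csmooth S f \<longleftrightarrow> (\<exists>F. derivs_on S f F)"

text \<open>Smoothness as a greatest fixed point: in a class closed under differentiation,
  derivatives can be chosen forever. Each later instance only has to name a suitable class.\<close>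

lemma Csmooth_coinduct:
  assumes "P f" "\<And>g. P g \<Longrightarrow> \<exists>g'. P g' \<and> (\<forall>x\<in>S. (g has_vector_derivative g' x) (at x))"
  shows "Csmooth S f"
proof -
  obtain D where D: "\<And>g. P g \<Longrightarrow> P (D g) \<and> (\<forall>x\<in>S. (g has_vector_derivative D g x) (at x))"
    using assms(2) by metis
  have "P ((D ^^ n) f)" for n
    by (induction n) (use assms(1) D in auto)
  then have "derivs_on S f (\<lambda>n. (D ^^ n) f)"
    using D by (simp add: derivs_on_def)
  then show ?thesis unfolding Csmooth_def by blast
qed

lemma CsmoothE:
  assumes "Csmooth S f"
  obtains f' where "Csmooth S f'" "\<And>x. x \<in> S \<Longrightarrow> (f has_vector_derivative f' x) (at x)"
proof -
  obtain F where "derivs_on S f F"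
    using assms by (auto simp: Csmooth_def)
  then have "derivs_on S (F 1) (\<lambda>n. F (Suc n))" "\<And>x. x \<in> S \<Longrightarrow> (f has_vector_derivative F 1 x) (at x)"
    by (auto simp: derivs_on_def)
  then show ?thesis
    using that unfolding Csmooth_def by blast
qed

lemma Csmooth_continuous_on:
  assumes "Csmooth S f"
  shows "continuous_on S f"
proof -
  obtain f' where "\<And>x. x \<in> S \<Longrightarrow> (f has_vector_derivative f' x) (at x)"
    using CsmoothE[OF assms] by metis
  then show ?thesis
    by (intro continuous_at_imp_continuous_on ballI has_vector_derivative_continuous)
qed

lemma Csmooth_imp_smooth:
  assumes "Csmooth UNIV f"
  shows "smooth f"
proof -
  obtain F where F: "F 0 = f" "\<And>n x. (F n has_vector_derivative F (Suc n) x) (at x)"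
    using assms by (auto simp: Csmooth_def derivs_on_def)
  have "((\<lambda>g y. vector_derivative g (at y)) ^^ n) f = F n" for n
    by (induction n) (auto simp: F(1) vector_derivative_at[OF F(2)])
  then show ?thesis
    unfolding smooth_def using differentiableI_vector[OF F(2)] by simp
qed

lemma Csmooth_const: "Csmooth S (\<lambda>_. c)"
proof (rule Csmooth_coinduct[where P = "\<lambda>f. \<exists>c. f = (\<lambda>_. c)"])
  fix g :: "real \<Rightarrow> complex" assume "\<exists>c. g = (\<lambda>_. c)"
  then show "\<exists>g'. (\<exists>c. g' = (\<lambda>_. c)) \<and> (\<forall>x\<in>S. (g has_vector_derivative g' x) (at x))"
    by (intro exI[of _ "\<lambda>_. 0"]) auto
qed blast

text \<open>Products of smooth functions are not visibly closed under differentiation; finite sums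
  of such products are, by the product rule.\<close>

inductive smult_closure :: "real set \<Rightarrow> (real \<Rightarrow> complex) \<Rightarrow> bool" for S where
  "Csmooth S f \<Longrightarrow> Csmooth S g \<Longrightarrow> smult_closure S (\<lambda>x. f x * g x)"
| "smult_closure S f \<Longrightarrow> smult_closure S g \<Longrightarrow> smult_closure S (\<lambda>x. f x + g x)"

lemma smult_closure_Csmooth:
  assumes "smult_closure S h"
  shows "Csmooth S h"
proof (rule Csmooth_coinduct[where P = "smult_closure S", OF assms])
  fix h assume "smult_closure S h"
  then show "\<exists>h'. smult_closure S h' \<and> (\<forall>x\<in>S. (h has_vector_derivative h' x) (at x))"
  proof induction
    case (1 f g)
    obtain f' g' where "Csmooth S f'" "Csmooth S g'" "\<And>x. x \<in> S \<Longrightarrow> (f has_vector_derivative f' x) (at x)"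
      "\<And>x. x \<in> S \<Longrightarrow> (g has_vector_derivative g' x) (at x)"
      using CsmoothE[OF 1(1)] CsmoothE[OF 1(2)] by metis
    with 1 show ?case
      by (intro exI[of _ "\<lambda>x. f x * g' x + f' x * g x"] conjI smult_closure.intros)
         (auto intro: has_vector_derivative_mult)
  next
    case (2 f g)
    then obtain f' g' where "smult_closure S f'" "smult_closure S g'"
      "\<And>x. x \<in> S \<Longrightarrow> (f has_vector_derivative f' x) (at x)"
      "\<And>x. x \<in> S \<Longrightarrow> (g has_vector_derivative g' x) (at x)"
      by blast
    then show ?case
      by (intro exI[of _ "\<lambda>x. f' x + g' x"] conjI smult_closure.intros)
         (auto intro: has_vector_derivative_add)
  qed
qed

lemma Csmooth_mult: "Csmooth S f \<Longrightarrow> Csmooth S g \<Longrightarrow> Csmooth S (\<lambda>x. f x * g x)"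
  by (rule smult_closure_Csmooth[OF smult_closure.intros(1)])

lemma Csmooth_add:
  assumes "Csmooth S f" "Csmooth S g"
  shows "Csmooth S (\<lambda>x. f x + g x)"
proof -
  have "smult_closure S (\<lambda>x. f x * 1 + g x * 1)"
    by (intro smult_closure.intros assms Csmooth_const)
  then show ?thesis using smult_closure_Csmooth by fastforce
qed

text \<open>The extra factor \<open>g\<close> absorbs the inner derivative h' produced by the chain
  rule, which closes the class under differentiation.\<close>

inductive scomp_closure :: "real set \<Rightarrow> real set \<Rightarrow> (real \<Rightarrow> real) \<Rightarrow> (real \<Rightarrow> complex) \<Rightarrow> bool" for S T h where
  "Csmooth T f \<Longrightarrow> Csmooth S g \<Longrightarrow> scomp_closure S T h (\<lambda>x. f (h x) * g x)"
| "scomp_closure S T h f \<Longrightarrow> scomp_closure S T h g \<Longrightarrow> scomp_closure S T h (\<lambda>x. f x + g x)"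

lemma scomp_closure_Csmooth:
  assumes "scomp_closure S T h k"
    and h: "\<And>x. x \<in> S \<Longrightarrow> h x \<in> T" "\<And>x. x \<in> S \<Longrightarrow> (h has_real_derivative h' x) (at x)"
      "Csmooth S (\<lambda>x. of_real (h' x))"
  shows "Csmooth S k"
proof (rule Csmooth_coinduct[where P = "scomp_closure S T h", OF assms(1)])
  fix k assume "scomp_closure S T h k"
  then show "\<exists>k'. scomp_closure S T h k' \<and> (\<forall>x\<in>S. (k has_vector_derivative k' x) (at x))"
  proof induction
    case (1 f g)
    obtain f' g' where fg: "Csmooth T f'" "Csmooth S g'" "\<And>x. x \<in> T \<Longrightarrow> (f has_vector_derivative f' x) (at x)"
      "\<And>x. x \<in> S \<Longrightarrow> (g has_vector_derivative g' x) (at x)"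
      using CsmoothE[OF 1(1)] CsmoothE[OF 1(2)] by metis
    show ?case
    proof (intro exI conjI ballI)
      show "scomp_closure S T h (\<lambda>x. f (h x) * g' x + f' (h x) * (of_real (h' x) * g x))"
        by (intro scomp_closure.intros fg 1 Csmooth_mult h)
      fix x assume x: "x \<in> S"
      have "((f \<circ> h) has_vector_derivative h' x *\<^sub>R f' (h x)) (at x)"
        using h(2)[OF x] fg(3)[OF h(1)[OF x]]
        by (intro vector_diff_chain_at) (auto simp: has_real_derivative_iff_has_vector_derivative)
      then have "((\<lambda>x. f (h x)) has_vector_derivative f' (h x) * of_real (h' x)) (at x)"
        by (simp add: o_def scaleR_conv_of_real mult.commute)
      from has_vector_derivative_mult[OF this fg(4)[OF x]]
      show "((\<lambda>x. f (h x) * g x) has_vector_derivative f (h x) * g' x + f' (h x) * (of_real (h' x) * g x)) (at x)"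
        by (simp add: mult.assoc)
    qed
  next
    case (2 f g)
    then obtain f' g' where "scomp_closure S T h f'" "scomp_closure S T h g'"
      "\<And>x. x \<in> S \<Longrightarrow> (f has_vector_derivative f' x) (at x)"
      "\<And>x. x \<in> S \<Longrightarrow> (g has_vector_derivative g' x) (at x)"
      by blast
    then show ?case
      by (intro exI[of _ "\<lambda>x. f' x + g' x"] conjI scomp_closure.intros)
         (auto intro: has_vector_derivative_add)
  qed
qed

lemma Csmooth_compose:
  assumes "Csmooth T f" "\<And>x. x \<in> S \<Longrightarrow> h x \<in> T" "\<And>x. x \<in> S \<Longrightarrow> (h has_real_derivative h' x) (at x)"
      "Csmooth S (\<lambda>x. of_real (h' x))"
  shows "Csmooth S (\<lambda>x. f (h x))"
proof -
  have "scomp_closure S T h (\<lambda>x. f (h x) * 1)"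
    by (intro scomp_closure.intros assms Csmooth_const)
  from scomp_closure_Csmooth[OF this assms(2-4)] show ?thesis by simp
qed

lemma Csmooth_inverse_power: "Csmooth {0<..} (\<lambda>x. c * of_real (inverse x ^ n))"
proof (rule Csmooth_coinduct[where P = "\<lambda>f. \<exists>c n. f = (\<lambda>x. c * of_real (inverse x ^ n))"])
  fix g assume "\<exists>c n. g = (\<lambda>x. c * complex_of_real (inverse x ^ n))"
  then obtain c n where g: "g = (\<lambda>x. c * complex_of_real (inverse x ^ n))" by blast
  have "(g has_vector_derivative (- (of_nat n * c)) * complex_of_real (inverse x ^ (Suc n))) (at x)"
    if "x \<in> {0<..}" for x
  proof -
    have "((\<lambda>x. inverse x ^ n) has_real_derivative - (real n * inverse x ^ Suc n)) (at x)"
      using DERIV_power[OF DERIV_inverse[of x UNIV], of n] that by (cases n) (simp_all add: mult_ac)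
    from has_vector_derivative_mult_right[OF has_vector_derivative_of_real[OF this], of c]
    show ?thesis by (simp add: g mult_ac)
  qed
  then show "\<exists>g'. (\<exists>c n. g' = (\<lambda>x. c * complex_of_real (inverse x ^ n)))
      \<and> (\<forall>x\<in>{0<..}. (g has_vector_derivative g' x) (at x))"
    by (intro exI[of _ "\<lambda>x. (- (of_nat n * c)) * complex_of_real (inverse x ^ (Suc n))"]) blast
qed blast

lemma has_vector_derivative_zero_on_open:
  assumes "(f has_vector_derivative f') (at x)" "open U" "x \<in> U" "\<And>y. y \<in> U \<Longrightarrow> f y = 0"
  shows "f' = 0"
proof -
  have "((\<lambda>_. 0) has_vector_derivative f') (at x)"
    by (rule has_vector_derivative_transform_within_open[OF assms])
  then show ?thesis
    using vector_derivative_unique_at has_vector_derivative_const by blast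
qed

text \<open>Supplies the vanishing boundary terms in repeated integration by parts.\<close>

lemma derivs_on_zero:
  assumes "derivs_on S f F" "open U" "U \<subseteq> S" "\<And>x. x \<in> U \<Longrightarrow> f x = 0" "x \<in> U"
  shows "F n x = 0"
  using assms(5)
proof (induction n arbitrary: x)
  case 0
  then show ?case using assms by (simp add: derivs_on_def)
next
  case (Suc n)
  have "(F n has_vector_derivative F (Suc n) x) (at x)"
    using assms Suc by (auto simp: derivs_on_def)
  then show ?case
    by (rule has_vector_derivative_zero_on_open[OF _ assms(2) Suc.prems Suc.IH])
qed

section \<open>Smooth bumps of compact support\<close>

definition exp_poly_inv :: "real poly \<Rightarrow> real \<Rightarrow> real" where
  "exp_poly_inv p x = (if x > 0 then poly p (1 / x) * exp (- (1 / x)) else 0)"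

lemma poly_div_exp_tendsto_0: "((\<lambda>x::real. x ^ k * poly p x / exp x) \<longlongrightarrow> 0) at_top"
proof (induction p arbitrary: k)
  case 0
  then show ?case by simp
next
  case (pCons a p)
  have "((\<lambda>x::real. a * (x ^ k / exp x) + x ^ Suc k * poly p x / exp x) \<longlongrightarrow> a * 0 + 0) at_top"
    by (intro tendsto_intros tendsto_power_div_exp_0 pCons)
  then show ?case by (simp add: algebra_simps add_divide_distrib)
qed

text \<open>The polynomial factor makes the family of exp(-1/x) closed under differentiation: the
  derivative of p(1/x) exp(-1/x) is (1/x)^2 (p - p')(1/x) exp(-1/x).\<close>

lemma exp_poly_inv_has_derivative:
  "(exp_poly_inv p has_real_derivative exp_poly_inv ([:0, 0, 1:] * (p - pderiv p)) x) (at x)"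
proof -
  consider "x > 0" | "x < 0" | "x = 0" by linarith
  then show ?thesis
  proof cases
    case 1
    have "((\<lambda>x. poly p (1 / x) * exp (- (1 / x))) has_real_derivative
             poly ([:0, 0, 1:] * (p - pderiv p)) (1 / x) * exp (- (1 / x))) (at x)"
    proof -
      have d: "((\<lambda>x. 1 / x) has_real_derivative - (1 / x * (1 / x))) (at x)"
        using 1 by (auto intro!: derivative_eq_intros simp: field_simps)
      show ?thesis
        using DERIV_mult[OF DERIV_chain2[OF poly_DERIV d] DERIV_fun_exp[OF DERIV_minus[OF d]], of p]
        by (simp add: algebra_simps)
    qed
    then have "((\<lambda>x. poly p (1 / x) * exp (- (1 / x))) has_real_derivative
             exp_poly_inv ([:0, 0, 1:] * (p - pderiv p)) x) (at x)"
      using 1 by (simp only: exp_poly_inv_def if_True)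
    then show ?thesis
      by (rule has_field_derivative_transform_within_open[of _ _ _ "{0<..}"])
         (use 1 in \<open>auto simp: exp_poly_inv_def\<close>)
  next
    case 2
    then have "((\<lambda>_. 0) has_real_derivative exp_poly_inv ([:0, 0, 1:] * (p - pderiv p)) x) (at x)"
      by (simp add: exp_poly_inv_def)
    then show ?thesis
      by (rule has_field_derivative_transform_within_open[of _ _ _ "{..<0}"])
         (use 2 in \<open>auto simp: exp_poly_inv_def\<close>)
  next
    case 3
    \<comment> \<open>With x = 1/h the difference quotient at 0 becomes x p(x) / exp x as x tends to
      infinity.\<close>
    have r: "((\<lambda>h. exp_poly_inv p h / h) \<longlongrightarrow> 0) (at_right 0)"
    proof (rule Lim_transform_eventually)
      show "((\<lambda>h. inverse h ^ 1 * poly p (inverse h) / exp (inverse h)) \<longlongrightarrow> 0) (at_right (0::real))"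
        by (rule filterlim_compose[OF poly_div_exp_tendsto_0 filterlim_inverse_at_top_right])
      show "\<forall>\<^sub>F h in at_right (0::real). inverse h ^ 1 * poly p (inverse h) / exp (inverse h) = exp_poly_inv p h / h"
        unfolding eventually_at_right_field
        by (intro exI[of _ 1]) (auto simp: exp_poly_inv_def exp_minus field_simps)
    qed
    have l: "((\<lambda>h. exp_poly_inv p h / h) \<longlongrightarrow> 0) (at_left 0)"
    proof (rule Lim_transform_eventually[OF tendsto_const])
      show "\<forall>\<^sub>F h in at_left (0::real). 0 = exp_poly_inv p h / h"
        unfolding eventually_at_left_field by (intro exI[of _ "-1"]) (auto simp: exp_poly_inv_def)
    qed
    have "((\<lambda>h. exp_poly_inv p h / h) \<longlongrightarrow> 0) (at 0)"
      using l r by (rule filterlim_split_at)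
    then show ?thesis
      using 3 by (simp add: DERIV_def exp_poly_inv_def[of _ 0])
  qed
qed

lemma Csmooth_exp_poly_inv: "Csmooth S (\<lambda>x. of_real (exp_poly_inv p x))"
proof (rule Csmooth_coinduct[where P = "\<lambda>f. \<exists>p. f = (\<lambda>x. of_real (exp_poly_inv p x))"])
  fix g assume "\<exists>p. g = (\<lambda>x. complex_of_real (exp_poly_inv p x))"
  then obtain p where g: "g = (\<lambda>x. complex_of_real (exp_poly_inv p x))" by blast
  show "\<exists>g'. (\<exists>p. g' = (\<lambda>x. complex_of_real (exp_poly_inv p x)))
      \<and> (\<forall>x\<in>S. (g has_vector_derivative g' x) (at x))"
    unfolding g
    by (intro exI[of _ "\<lambda>x. of_real (exp_poly_inv ([:0, 0, 1:] * (p - pderiv p)) x)"] conjI ballI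
        has_vector_derivative_of_real exp_poly_inv_has_derivative) blast
qed blast

definition bump :: "real \<Rightarrow> real \<Rightarrow> real \<Rightarrow> real" where
  "bump r c x = exp_poly_inv 1 (r + (x - c)) * exp_poly_inv 1 (r - (x - c))"

lemma bump_pos: "\<bar>x - c\<bar> < r \<Longrightarrow> bump r c x > 0"
  and bump_nonneg: "bump r c x \<ge> 0"
  and bump_zero: "r \<le> \<bar>x - c\<bar> \<Longrightarrow> bump r c x = 0"
  by (auto simp: bump_def exp_poly_inv_def)

lemma Csmooth_bump: "Csmooth S (\<lambda>x. of_real (bump r c x))"
  unfolding bump_def of_real_mult
proof (intro Csmooth_mult)
  show "Csmooth S (\<lambda>x. of_real (exp_poly_inv 1 (r + (x - c))))"
    by (rule Csmooth_compose[OF Csmooth_exp_poly_inv, where T = UNIV and h' = "\<lambda>_. 1"])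
       (auto intro!: derivative_eq_intros Csmooth_const)
  show "Csmooth S (\<lambda>x. of_real (exp_poly_inv 1 (r - (x - c))))"
    by (rule Csmooth_compose[OF Csmooth_exp_poly_inv, where T = UNIV and h' = "\<lambda>_. -1"])
       (auto intro!: derivative_eq_intros Csmooth_const)
qed

lemma compactly_supportedI:
  assumes "\<And>x. x \<notin> {a..b} \<Longrightarrow> f x = 0"
  shows "compactly_supported f"
proof -
  have "support_on UNIV f \<subseteq> {a..b}"
    unfolding support_on_def using assms by blast
  then have "bounded (support_on UNIV f)"
    using bounded_closed_interval bounded_subset by blast
  then show ?thesis
    by (simp add: compactly_supported_def)
qed

lemma integral_by_parts_vanishing:
  fixes f e :: "real \<Rightarrow> complex"
  assumes "a \<le> b" "f a = 0" "f b = 0"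
    and f: "\<And>x. x \<in> {a..b} \<Longrightarrow> (f has_vector_derivative f' x) (at x)" "continuous_on {a..b} f'"
    and e: "\<And>x. x \<in> {a..b} \<Longrightarrow> (e has_vector_derivative e' x) (at x)" "continuous_on {a..b} e'"
  shows "integral {a..b} (\<lambda>x. f x * e' x) = - integral {a..b} (\<lambda>x. f' x * e x)"
proof -
  have cf: "continuous_on {a..b} f" and ce: "continuous_on {a..b} e"
    using f e by (meson continuous_at_imp_continuous_on has_vector_derivative_continuous)+
  have "((\<lambda>x. f x * e' x + f' x * e x) has_integral f b * e b - f a * e a) {a..b}"
  proof (rule fundamental_theorem_of_calculus[OF assms(1)])
    fix x assume x: "x \<in> {a..b}"
    show "((\<lambda>x. f x * e x) has_vector_derivative f x * e' x + f' x * e x) (at x within {a..b})"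
      by (rule has_vector_derivative_mult[OF has_vector_derivative_at_within[OF f(1)[OF x]]
            has_vector_derivative_at_within[OF e(1)[OF x]]])
  qed
  from has_integral_unique[OF _ this]
  have *: "I = 0" if "((\<lambda>x. f x * e' x + f' x * e x) has_integral I) {a..b}" for I
    using that assms(2,3) by simp
  have "integral {a..b} (\<lambda>x. f x * e' x) + integral {a..b} (\<lambda>x. f' x * e x) = 0"
    by (rule *, intro has_integral_add integrable_integral integrable_continuous_real continuous_on_mult f(2) e(2) cf ce)
  then show ?thesis by (simp add: eq_neg_iff_add_eq_0)
qed

section \<open>Fourier series at a point\<close>

lemma borel_measurable_cnj [measurable]: "cnj \<in> borel_measurable borel"
  by (intro borel_measurable_continuous_onI continuous_intros)

text \<open>The remainder \<open>D\<close> after projection is orthogonal to every e(i) with i in F,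
  so its square norm is that of \<open>q\<close> minus the sum of the squared coefficients; and a
  square norm is nonnegative.\<close>

lemma bessel_inequality:
  fixes q :: "'a \<Rightarrow> complex" and e :: "'i \<Rightarrow> 'a \<Rightarrow> complex"
  assumes "finite_measure M" and q [measurable]: "q \<in> borel_measurable M" and qB: "\<And>x. norm (q x) \<le> B"
    and e [measurable]: "\<And>i. e i \<in> borel_measurable M" and eB: "\<And>i x. norm (e i x) \<le> 1"
    and orth: "\<And>i j. (LINT x|M. e i x * cnj (e j x)) = (if i = j then 1 else 0)"
    and F: "finite F"
  shows "(\<Sum>i\<in>F. norm (LINT x|M. q x * cnj (e i x)) ^ 2) \<le> (LINT x|M. norm (q x) ^ 2)"
proof -
  interpret finite_measure M by fact
  define c where "c = (\<lambda>i. LINT x|M. q x * cnj (e i x))"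
  define D where "D = (\<lambda>x. q x - (\<Sum>i\<in>F. c i * e i x))"
  have D [measurable]: "D \<in> borel_measurable M"
    unfolding D_def by measurable
  define B' where "B' = B + (\<Sum>i\<in>F. norm (c i))"
  have DB: "norm (D x) \<le> B'" for x
    unfolding D_def B'_def
    by (rule order_trans[OF norm_triangle_ineq4])
       (intro add_mono qB sum_norm_le, simp add: norm_mult mult_left_le eB)
  have I: "integrable M (\<lambda>x. f x * cnj (g x))"
    if [measurable]: "f \<in> borel_measurable M" "g \<in> borel_measurable M"
      and "\<And>x. norm (f x) \<le> b" "\<And>x. norm (g x) \<le> b'" for f g :: "'a \<Rightarrow> complex" and b b'
  proof (rule integrable_const_bound[where B = "b * b'"])
    have "norm (f x * cnj (g x)) \<le> b * b'" for x
      using that(3)[of x] that(4)[of x] by (simp add: norm_mult) (meson mult_mono norm_ge_zero order_trans)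
    then show "AE x in M. norm (f x * cnj (g x)) \<le> b * b'" by simp
  qed measurable
  have S: "(LINT x|M. f x - (\<Sum>i\<in>F. a i * h i x)) = (LINT x|M. f x) - (\<Sum>i\<in>F. a i * (LINT x|M. h i x))"
    if "integrable M f" "\<And>i. integrable M (h i)" for f :: "'a \<Rightarrow> complex" and h :: "'i \<Rightarrow> 'a \<Rightarrow> complex" and a
    using that by (simp add: Bochner_Integration.integral_sum)
  have De: "(LINT x|M. D x * cnj (e j x)) = 0" if "j \<in> F" for j
  proof -
    have "(LINT x|M. D x * cnj (e j x)) = (LINT x|M. q x * cnj (e j x) - (\<Sum>i\<in>F. c i * (e i x * cnj (e j x))))"
      by (simp add: D_def algebra_simps sum_distrib_left)
    also have "\<dots> = c j - (\<Sum>i\<in>F. c i * (LINT x|M. e i x * cnj (e j x)))"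
      unfolding c_def
      by (intro S I[OF _ _ qB eB] I[OF _ _ eB eB] q e)
    also have "\<dots> = 0"
      using that F by (simp add: orth if_distrib cong: if_cong)
    finally show ?thesis .
  qed
  have eD: "(LINT x|M. e j x * cnj (q x)) = cnj (c j)" for j
  proof -
    have "cnj (c j) = (LINT x|M. cnj (q x * cnj (e j x)))"
      unfolding c_def by (rule Bochner_Integration.integral_cnj[symmetric])
    then show ?thesis by (simp add: mult.commute)
  qed
  have cD: "cnj (D x) = cnj (q x) - (\<Sum>i\<in>F. cnj (c i) * cnj (e i x))" for x
    by (simp add: D_def)
  have "(LINT x|M. D x * cnj (D x)) = (LINT x|M. D x * cnj (q x) - (\<Sum>i\<in>F. cnj (c i) * (D x * cnj (e i x))))"
    by (simp only: cD right_diff_distrib sum_distrib_left mult.left_commute[of "D _"])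
  also have "\<dots> = (LINT x|M. D x * cnj (q x)) - (\<Sum>i\<in>F. cnj (c i) * (LINT x|M. D x * cnj (e i x)))"
    by (intro S I[OF _ _ DB eB] I[OF _ _ DB qB] q e D)
  also have "\<dots> = (LINT x|M. D x * cnj (q x))"
    by (simp add: De)
  also have "\<dots> = (LINT x|M. q x * cnj (q x) - (\<Sum>i\<in>F. c i * (e i x * cnj (q x))))"
    by (simp only: D_def left_diff_distrib sum_distrib_right mult.assoc)
  also have "\<dots> = (LINT x|M. q x * cnj (q x)) - (\<Sum>i\<in>F. c i * (LINT x|M. e i x * cnj (q x)))"
    by (intro S I[OF _ _ qB qB] I[OF _ _ eB qB] q e)
  also have "\<dots> = of_real (LINT x|M. norm (q x) ^ 2) - of_real (\<Sum>i\<in>F. norm (c i) ^ 2)"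
    by (simp add: eD complex_norm_square[symmetric] del: of_real_power)
  finally have "of_real (LINT x|M. norm (D x) ^ 2) = complex_of_real ((LINT x|M. norm (q x) ^ 2) - (\<Sum>i\<in>F. norm (c i) ^ 2))"
    by (simp add: complex_norm_square[symmetric] del: of_real_power)
  then have "(LINT x|M. norm (D x) ^ 2) = (LINT x|M. norm (q x) ^ 2) - (\<Sum>i\<in>F. norm (c i) ^ 2)"
    by (simp only: of_real_eq_iff)
  moreover have "(LINT x|M. norm (D x) ^ 2) \<ge> 0" by simp
  ultimately show ?thesis by (simp add: c_def)
qed


section \<open>Characters of the circle and pointwise convergence\<close>

definition fchar :: "int \<Rightarrow> real \<Rightarrow> complex" where
  "fchar k y = exp (2 * \<i> * pi * of_int k * y)"

lemma fchar_eq_exp_i: "fchar k y = exp (\<i> * of_real (2 * pi * of_int k * y))"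
  by (simp add: fchar_def mult_ac)

lemma norm_fchar [simp]: "norm (fchar k y) = 1"
  unfolding fchar_eq_exp_i by (rule norm_exp_i_times)

lemma fchar_add: "fchar (j + k) y = fchar j y * fchar k y"
  by (simp add: fchar_def algebra_simps flip: exp_add)

lemma fchar_0 [simp]: "fchar 0 y = 1"
  by (simp add: fchar_def)

lemma cnj_fchar: "cnj (fchar k y) = fchar (- k) y"
  unfolding fchar_def exp_cnj by simp

lemma fchar_int [simp]: "fchar k (of_int m) = 1"
proof -
  have "fchar k (of_int m) = exp (2 * of_int (k * m) * pi * \<i>)"
    by (simp add: fchar_def mult_ac)
  then show ?thesis by (simp only: exp_integer_2pi Ints_of_int)
qed

lemma fchar_add_right: "fchar k (x + y) = fchar k x * fchar k y"
  by (simp add: fchar_def algebra_simps flip: exp_add)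

lemma continuous_on_fchar [continuous_intros]: "continuous_on A (fchar k)"
  unfolding fchar_def by (intro continuous_intros)

lemma fchar_measurable [measurable]: "fchar k \<in> borel_measurable borel"
  by (intro borel_measurable_continuous_onI continuous_intros)

lemma fchar_has_vector_derivative:
  "(fchar k has_vector_derivative (2 * \<i> * pi * of_int k) * fchar k y) (at y within A)"
proof -
  have "((\<lambda>z. exp (2 * \<i> * pi * of_int k * z)) has_field_derivative
          exp (2 * \<i> * pi * of_int k * of_real y) * (2 * \<i> * pi * of_int k)) (at (of_real y))"
    by (auto intro!: derivative_eq_intros)
  from has_vector_derivative_real_field[OF this, of A] show ?thesis
    by (simp add: fchar_def[abs_def] mult_ac)
qed

lemma integral_fchar: "integral {a..a+1} (fchar k) = (if k = 0 then 1 else 0)"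
proof (cases "k = 0")
  case True
  then have "fchar k = (\<lambda>_. 1)" by auto
  then show ?thesis using True by simp
next
  case False
  define c where "c = 2 * \<i> * pi * of_int k"
  have c: "c \<noteq> 0" using False by (simp add: c_def)
  have "((\<lambda>y. c * fchar k y) has_integral fchar k (a + 1) - fchar k a) {a..a+1}"
    unfolding c_def by (intro fundamental_theorem_of_calculus fchar_has_vector_derivative) auto
  moreover have "fchar k (a + 1) = fchar k a"
    using fchar_add_right[of k a 1] fchar_int[of k 1] by simp
  ultimately have "((\<lambda>y. c * fchar k y) has_integral 0) {a..a+1}"
    by simp
  from has_integral_mult_right[OF this, of "inverse c"] c
  have "(fchar k has_integral 0) {a..a+1}"
    by (simp flip: mult.assoc)
  then show ?thesis using False by (simp add: integral_unique)
qed

lemma lint_restrict_eq_integral: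
  fixes f :: "real \<Rightarrow> complex"
  assumes "continuous_on {a..b} f"
  shows "(LINT y|restrict_space lborel {a..b}. f y) = integral {a..b} f"
  using set_borel_integral_eq_integral[OF borel_integrable_atLeastAtMost'[OF assms]]
  by (simp add: integral_restrict_space set_lebesgue_integral_def)

text \<open>Riemann-Lebesgue by way of Bessel: squared coefficients along distinct frequencies are
  summable, hence tend to 0. A general injective \<open>\<kappa>\<close> covers frequencies going to
  either infinity.\<close>

lemma fourier_coeff_tendsto_0:
  fixes q :: "real \<Rightarrow> complex" and \<kappa> :: "nat \<Rightarrow> int"
  assumes [measurable]: "q \<in> borel_measurable borel" and "\<And>y. norm (q y) \<le> B" "inj \<kappa>"
  shows "(\<lambda>n. LINT y|restrict_space lborel {a..a+1}. q y * fchar (\<kappa> n) y) \<longlonglongrightarrow> 0"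
proof -
  let ?M = "restrict_space lborel {a..a+1}"
  have fin: "finite_measure ?M"
    by (rule finite_measureI) (simp add: emeasure_restrict_space space_restrict_space)
  have [measurable]: "fchar k \<in> borel_measurable ?M" "q \<in> borel_measurable ?M" for k
    by (auto intro!: measurable_restrict_space1)
  have B: "(\<Sum>i\<in>F. norm (LINT y|?M. q y * cnj (fchar i y)) ^ 2) \<le> (LINT y|?M. norm (q y) ^ 2)" if "finite F" for F
  proof (rule bessel_inequality[OF fin _ assms(2)])
    fix i j
    have "(LINT y|?M. fchar i y * cnj (fchar j y)) = (LINT y|?M. fchar (i - j) y)"
      by (simp add: cnj_fchar diff_conv_add_uminus fchar_add del: add_uminus_conv_diff)
    also have "\<dots> = (if i = j then 1 else 0)"
      by (simp add: lint_restrict_eq_integral[OF continuous_on_fchar] integral_fchar)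
    finally show "(LINT y|?M. fchar i y * cnj (fchar j y)) = (if i = j then 1 else 0)" .
  qed (use that in auto)
  have "summable (\<lambda>n. norm (LINT y|?M. q y * fchar (\<kappa> n) y) ^ 2)"
  proof (rule bounded_imp_summable)
    fix n
    have inj: "inj_on (\<lambda>n. - \<kappa> n) {..n}"
      using assms(3) by (auto simp: inj_on_def)
    have "(\<Sum>k\<le>n. norm (LINT y|?M. q y * fchar (\<kappa> k) y) ^ 2)
        = (\<Sum>i\<in>(\<lambda>n. - \<kappa> n) ` {..n}. norm (LINT y|?M. q y * cnj (fchar i y)) ^ 2)"
      by (subst sum.reindex[OF inj]) (simp add: cnj_fchar)
    also have "\<dots> \<le> (LINT y|?M. norm (q y) ^ 2)"
      by (rule B) auto
    finally show "(\<Sum>k\<le>n. norm (LINT y|?M. q y * fchar (\<kappa> k) y) ^ 2) \<le> (LINT y|?M. norm (q y) ^ 2)" .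
  qed auto
  then have "(\<lambda>n. norm (LINT y|?M. q y * fchar (\<kappa> n) y) ^ 2) \<longlonglongrightarrow> 0"
    by (rule summable_LIMSEQ_zero)
  then have "(\<lambda>n. sqrt (norm (LINT y|?M. q y * fchar (\<kappa> n) y) ^ 2)) \<longlonglongrightarrow> sqrt 0"
    by (rule tendsto_real_sqrt)
  then have "(\<lambda>n. norm (LINT y|?M. q y * fchar (\<kappa> n) y)) \<longlonglongrightarrow> 0"
    by simp
  then show ?thesis
    by (rule tendsto_norm_zero_cancel)
qed

text \<open>The range 3/4 stays away from the next zeros of \<open>fchar 1 x - 1\<close>, at x = 1
  and x = -1. The norm is 2 |sin(\<pi> x)|; writing sin z = 2 sin(z/2) cos(z/2) confines the half
  angle to [0, 3\<pi>/8], where the cosine is at least \<open>\<kappa>\<close>.\<close>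

lemma norm_fchar_minus_1_lower:
  obtains c where "c > 0" "\<And>x. \<bar>x\<bar> \<le> 3 / 4 \<Longrightarrow> norm (fchar 1 x - 1) \<ge> c * \<bar>x\<bar>"
proof
  define \<kappa> where "\<kappa> = cos (3 * pi / 8)"
  have \<kappa>: "\<kappa> > 0"
    unfolding \<kappa>_def by (intro cos_gt_zero_pi) auto
  then show "2 * pi * \<kappa> ^ 2 > 0" by simp
  have lower: "sin z \<ge> \<kappa> ^ 2 * z" if z: "0 < z" "z \<le> 3 * pi / 4" for z
  proof -
    have ck: "cos x \<ge> \<kappa>" if "0 \<le> x" "x \<le> z / 2" for x
      unfolding \<kappa>_def using that z by (intro cos_monotone_0_pi_le) auto
    obtain x where x: "0 < x" "x < z / 2" "sin (z / 2) - sin 0 = (z / 2 - 0) * cos x"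
      using MVT2[of 0 "z / 2" sin cos] z by (auto intro: DERIV_sin)
    have "0 \<le> (z / 2) * cos x"
      using ck[of x] x z \<kappa> by (intro mult_nonneg_nonneg) auto
    then have s0: "0 \<le> sin (z / 2)" using x(3) by simp
    have "\<kappa> ^ 2 * z = 2 * ((z / 2) * \<kappa>) * \<kappa>"
      by (simp add: power2_eq_square)
    also have "\<dots> \<le> 2 * sin (z / 2) * cos (z / 2)"
      using x z \<kappa> ck[of x] ck[of "z / 2"] s0 by (intro mult_mono) auto
    also have "\<dots> = sin z"
      using sin_double[of "z / 2"] by simp
    finally show ?thesis .
  qed
  show "norm (fchar 1 x - 1) \<ge> 2 * pi * \<kappa> ^ 2 * \<bar>x\<bar>" if x: "\<bar>x\<bar> \<le> 3 / 4" for x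
  proof (cases "x = 0")
    case False
    have "norm (fchar 1 x - 1) = 2 * \<bar>sin (pi * x)\<bar>"
      unfolding fchar_eq_exp_i dist_exp_i_1 by simp
    also have "\<bar>sin (pi * x)\<bar> = \<bar>sin (pi * \<bar>x\<bar>)\<bar>"
      by (cases "x \<ge> 0") auto
    finally have "norm (fchar 1 x - 1) = 2 * \<bar>sin (pi * \<bar>x\<bar>)\<bar>" .
    moreover have "\<kappa> ^ 2 * (pi * \<bar>x\<bar>) \<le> sin (pi * \<bar>x\<bar>)"
      by (rule lower) (use x False in auto)
    ultimately show ?thesis
      using abs_ge_self[of "sin (pi * \<bar>x\<bar>)"] unfolding mult.assoc by (simp add: mult.left_commute)
  qed simp
qed

text \<open>
  With \<open>q = (G - G(m)) / (fchar 1 - 1)\<close> the Dirichlet kernel telescopes, and the error of the partial sum is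
  a difference of two Fourier coefficients of the bounded function \<open>q\<close>.
\<close>
lemma fourier_sums_tendsto:
  fixes G :: "real \<Rightarrow> complex" and m :: int
  assumes G: "continuous_on {a..a+1} G" and a: "of_int m - 3 / 4 \<le> a" "a + 1 \<le> of_int m + 3 / 4"
    and lip: "\<And>y. y \<in> {a..a+1} \<Longrightarrow> norm (G y - G (of_int m)) \<le> L * \<bar>y - of_int m\<bar>"
  shows "(\<lambda>N. \<Sum>k\<in>{- int N..int N}. integral {a..a+1} (\<lambda>y. G y * fchar k y)) \<longlonglongrightarrow> G (of_int m)"
proof -
  let ?I = "{a..a+1}" and ?m = "real_of_int m"
  let ?M = "restrict_space lborel ?I"
  obtain c where c: "c > 0" "\<And>x. \<bar>x\<bar> \<le> 3 / 4 \<Longrightarrow> norm (fchar 1 x - 1) \<ge> c * \<bar>x\<bar>"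
    using norm_fchar_minus_1_lower by blast
  have ee1: "norm (fchar 1 y - 1) \<ge> c * \<bar>y - ?m\<bar>" if "y \<in> ?I" for y
  proof -
    have "fchar 1 y = fchar 1 (y - ?m)"
      using fchar_add_right[of 1 "y - ?m" ?m] by simp
    then show ?thesis using c(2)[of "y - ?m"] that a by (auto simp: abs_if)
  qed
  \<comment> \<open>At y = m the quotient is 0 / 0 = 0, which keeps \<open>q\<close> bounded
    everywhere.\<close>
  define q where "q = (\<lambda>y. (indicator ?I y *\<^sub>R (G y - G ?m)) / (fchar 1 y - 1))"
  have qm [measurable]: "q \<in> borel_measurable borel"
    unfolding q_def
    by (intro borel_measurable_divide borel_measurable_continuous_on_indicator borel_measurable_diff
        fchar_measurable borel_measurable_const continuous_intros G) auto
  \<comment> \<open>The sign of L follows from the Lipschitz bound at an endpoint of the interval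
    different from m.\<close>
  have L: "L \<ge> 0"
  proof (rule ccontr)
    assume "\<not> L \<ge> 0"
    moreover have "\<bar>(if a = ?m then a + 1 else a) - ?m\<bar> > 0" by auto
    moreover have "0 \<le> L * \<bar>(if a = ?m then a + 1 else a) - ?m\<bar>"
      by (rule order_trans[OF norm_ge_zero lip]) auto
    ultimately show False by (simp add: zero_le_mult_iff split: if_splits)
  qed
  have qB: "norm (q y) \<le> L / c" for y
  proof (cases "y \<in> ?I \<and> y \<noteq> ?m")
    case True
    then have pos: "c * \<bar>y - ?m\<bar> > 0" using c by auto
    have "norm (q y) = norm (G y - G ?m) / norm (fchar 1 y - 1)"
      using True by (simp add: q_def norm_divide)
    also have "\<dots> \<le> (L * \<bar>y - ?m\<bar>) / (c * \<bar>y - ?m\<bar>)"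
      using True pos lip[of y] ee1[of y] L by (intro frac_le mult_nonneg_nonneg) auto
    also have "\<dots> = L / c" using True by simp
    finally show ?thesis .
  next
    case False
    then have "q y = 0" by (auto simp: q_def)
    then show ?thesis using L c by simp
  qed
  have tele: "(fchar 1 y - 1) * (\<Sum>k\<in>{- int N..int N}. fchar k y) = fchar (int N + 1) y - fchar (- int N) y" for N y
  proof (induction N)
    case 0
    then show ?case by simp
  next
    case (Suc N)
    have "{- int (Suc N)..int (Suc N)} = insert (- int (Suc N)) (insert (int (Suc N)) {- int N..int N})"
      by auto
    then have "(\<Sum>k\<in>{- int (Suc N)..int (Suc N)}. fchar k y)
        = fchar (- int (Suc N)) y + (fchar (int (Suc N)) y + (\<Sum>k\<in>{- int N..int N}. fchar k y))"
      by simp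
    then have "(fchar 1 y - 1) * (\<Sum>k\<in>{- int (Suc N)..int (Suc N)}. fchar k y)
       = (fchar 1 y - 1) * fchar (- int (Suc N)) y + (fchar 1 y - 1) * fchar (int (Suc N)) y + (fchar (int N + 1) y - fchar (- int N) y)"
      by (simp add: distrib_left Suc)
    also have "\<dots> = fchar (int (Suc N) + 1) y - fchar (- int (Suc N)) y"
      using fchar_add[of 1 "- int (Suc N)" y] fchar_add[of 1 "int (Suc N)" y] by (simp add: algebra_simps)
    finally show ?case .
  qed
  have I: "integrable ?M (\<lambda>y. q y * fchar k y)" for k
  proof -
    interpret finite_measure ?M
      by (rule finite_measureI) (simp add: emeasure_restrict_space space_restrict_space)
    have [measurable]: "fchar k \<in> borel_measurable ?M" "q \<in> borel_measurable ?M" for k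
      by (auto intro!: measurable_restrict_space1)
    show ?thesis
      by (rule integrable_const_bound[of _ "L / c"]) (use qB in \<open>auto simp: norm_mult\<close>)
  qed
  have sum_eq: "(\<Sum>k\<in>{- int N..int N}. integral ?I (\<lambda>y. G y * fchar k y))
      = G ?m + ((LINT y|?M. q y * fchar (int N + 1) y) - (LINT y|?M. q y * fchar (- int N) y))" for N
  proof -
    let ?K = "{- int N..int N}"
    have "(\<Sum>k\<in>?K. integral ?I (\<lambda>y. G y * fchar k y))
       = (\<Sum>k\<in>?K. integral ?I (\<lambda>y. (G y - G ?m) * fchar k y) + G ?m * integral ?I (fchar k))"
    proof (rule sum.cong[OF refl])
      fix k
      have "integral ?I (\<lambda>y. (G y - G ?m) * fchar k y) + integral ?I (\<lambda>y. G ?m * fchar k y)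
          = integral ?I (\<lambda>y. (G y - G ?m) * fchar k y + G ?m * fchar k y)"
        by (intro Henstock_Kurzweil_Integration.integral_add[symmetric] integrable_continuous_real continuous_intros G)
      then show "integral ?I (\<lambda>y. G y * fchar k y) = integral ?I (\<lambda>y. (G y - G ?m) * fchar k y) + G ?m * integral ?I (fchar k)"
        by (simp add: algebra_simps)
    qed
    also have "\<dots> = (\<Sum>k\<in>?K. integral ?I (\<lambda>y. (G y - G ?m) * fchar k y)) + G ?m"
      by (simp add: sum.distrib integral_fchar sum_distrib_left[symmetric])
    also have "(\<Sum>k\<in>?K. integral ?I (\<lambda>y. (G y - G ?m) * fchar k y))
        = integral ?I (\<lambda>y. \<Sum>k\<in>?K. (G y - G ?m) * fchar k y)"
      by (intro integral_sum[symmetric] integrable_continuous_real continuous_intros G) auto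
    also have "\<dots> = (LINT y|?M. (\<Sum>k\<in>?K. (G y - G ?m) * fchar k y))"
      by (intro lint_restrict_eq_integral[symmetric] continuous_intros G)
    also have "\<dots> = (LINT y|?M. q y * fchar (int N + 1) y - q y * fchar (- int N) y)"
    proof (rule Bochner_Integration.integral_cong[OF refl])
      fix y assume "y \<in> space ?M"
      then have y: "y \<in> ?I" by (simp add: space_restrict_space)
      show "(\<Sum>k\<in>?K. (G y - G ?m) * fchar k y) = q y * fchar (int N + 1) y - q y * fchar (- int N) y"
      proof (cases "y = ?m")
        case True
        then show ?thesis by (simp add: q_def)
      next
        case False
        then have nz: "fchar 1 y - 1 \<noteq> 0"
          using ee1[OF y] c(1) by (auto simp: mult_le_0_iff)
        have "q y * fchar (int N + 1) y - q y * fchar (- int N) y = q y * (fchar 1 y - 1) * (\<Sum>k\<in>?K. fchar k y)"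
          using tele[of y N] by (simp add: mult.assoc right_diff_distrib[symmetric])
        also have "q y * (fchar 1 y - 1) = G y - G ?m"
          using nz y by (simp add: q_def)
        finally show ?thesis by (simp add: sum_distrib_left)
      qed
    qed
    also have "\<dots> = (LINT y|?M. q y * fchar (int N + 1) y) - (LINT y|?M. q y * fchar (- int N) y)"
      by (intro Bochner_Integration.integral_diff I)
    finally show ?thesis by simp
  qed
  have "(\<lambda>N. G ?m + ((LINT y|?M. q y * fchar (int N + 1) y) - (LINT y|?M. q y * fchar (- int N) y))) \<longlonglongrightarrow> G ?m + (0 - 0)"
    by (intro tendsto_intros fourier_coeff_tendsto_0[OF qm qB]) (auto simp: inj_def)
  then show ?thesis
    unfolding sum_eq by simp
qed

section \<open>The Eisenstein pairing for a pair of bumps\<close>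

lemma lborel_integral_eq_integral:
  fixes f :: "real \<Rightarrow> complex"
  assumes "continuous_on {a..b} f" "\<And>x. x \<notin> {a..b} \<Longrightarrow> f x = 0"
  shows "(LINT x|lborel. f x) = integral {a..b} f"
proof -
  have "(LINT x|lborel. f x) = (LINT x:{a..b}|lborel. f x)"
    unfolding set_lebesgue_integral_def
    by (rule Bochner_Integration.integral_cong) (use assms(2) in \<open>auto simp: indicator_def\<close>)
  then show ?thesis
    using set_borel_integral_eq_integral(2)[OF borel_integrable_atLeastAtMost'[OF assms(1)]] by simp
qed

lemma Lipschitz_of_C1:
  fixes f :: "real \<Rightarrow> complex"
  assumes "\<And>x. (f has_vector_derivative f' x) (at x)" "continuous_on {a..b} f'" "m \<in> {a..b}"
  obtains L where "\<And>y. y \<in> {a..b} \<Longrightarrow> norm (f y - f m) \<le> L * \<bar>y - m\<bar>"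
proof -
  have "bounded (f' ` {a..b})"
    by (intro compact_imp_bounded compact_continuous_image assms) auto
  then obtain L where "\<forall>z\<in>f' ` {a..b}. norm z \<le> L"
    unfolding bounded_iff by blast
  then have L: "norm (f' x) \<le> L" if "x \<in> {a..b}" for x
    using that by blast
  show ?thesis
  proof (rule that[of L])
    fix y assume y: "y \<in> {a..b}"
    have "norm (f y - f m) \<le> L * norm (y - m)"
    proof (rule differentiable_bound[of "{a..b}" f "\<lambda>x h. h *\<^sub>R f' x"])
      fix x assume x: "x \<in> {a..b}"
      show "(f has_derivative (\<lambda>h. h *\<^sub>R f' x)) (at x within {a..b})"
        using has_vector_derivative_at_within[OF assms(1)] by (simp add: has_vector_derivative_def)
      show "onorm (\<lambda>h. h *\<^sub>R f' x) \<le> L"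
        by (rule onorm_le) (use mult_left_mono[OF L[OF x] abs_ge_zero] in \<open>simp add: mult.commute\<close>)
    qed (use y assms(3) in auto)
    then show "norm (f y - f m) \<le> L * \<bar>y - m\<bar>" by simp
  qed
qed

lemma has_vector_derivative_affine:
  assumes "(f has_vector_derivative f') (at (a + c * y))"
  shows "((\<lambda>y. f (a + c * y)) has_vector_derivative c *\<^sub>R f') (at (y::real))"
proof -
  have "((\<lambda>y. a + c * y) has_real_derivative c) (at y)"
    by (auto intro!: derivative_eq_intros)
  then have "((\<lambda>y. a + c * y) has_vector_derivative c) (at y)"
    by (simp add: has_real_derivative_iff_has_vector_derivative)
  from vector_diff_chain_at[OF this assms] show ?thesis by (simp add: o_def)
qed

lemma summable_on_int_powr:
  assumes "r > 1"
  shows "(\<lambda>k::int. (1 + real_of_int \<bar>k\<bar>) powr (- r)) summable_on UNIV"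
proof -
  let ?f = "\<lambda>k::int. (1 + real_of_int \<bar>k\<bar>) powr (- r)"
  have s: "summable (\<lambda>n. (real n + 1) powr (- r))"
    by (rule summable_Suc_powr[OF assms])
  have p: "?f summable_on range int"
  proof (subst summable_on_reindex)
    show "?f \<circ> int summable_on UNIV"
      using s by (intro norm_summable_imp_summable_on) (simp add: o_def add_ac)
  qed auto
  have n: "?f summable_on range (\<lambda>n. - int (Suc n))"
  proof (subst summable_on_reindex)
    have "summable (\<lambda>n. (real (Suc n) + 1) powr (- r))"
      using s by (subst summable_Suc_iff)
    then show "?f \<circ> (\<lambda>n. - int (Suc n)) summable_on UNIV"
      by (intro norm_summable_imp_summable_on) (simp add: o_def add_ac)
  qed (auto simp: inj_on_def)
  have "range int \<union> range (\<lambda>n. - int (Suc n)) = UNIV"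
  proof (intro equalityI subsetI UNIV_I)
    fix k :: int
    show "k \<in> range int \<union> range (\<lambda>n. - int (Suc n))"
      by (cases k rule: int_cases) auto
  qed
  moreover have "range int \<inter> range (\<lambda>n. - int (Suc n)) = {}"
    by auto
  ultimately show ?thesis
    using summable_on_Un_disjoint[OF p n] by simp
qed

lemma filterlim_symmetric_intervals:
  "filterlim (\<lambda>N. {- int N..int N}) (finite_subsets_at_top UNIV) sequentially"
  unfolding filterlim_finite_subsets_at_top
proof (intro allI impI)
  fix X :: "int set" assume X: "finite X \<and> X \<subseteq> UNIV"
  then obtain B where B: "\<And>x. x \<in> X \<Longrightarrow> \<bar>x\<bar> \<le> B"
    using finite_abs_int_segment by (metis finite_imageI Max_ge image_eqI)
  show "\<forall>\<^sub>F N in sequentially. finite {- int N..int N} \<and> X \<subseteq> {- int N..int N} \<and> {- int N..int N} \<subseteq> UNIV"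
    using eventually_ge_at_top[of "nat B"]
  proof eventually_elim
    case (elim N)
    have "x \<in> {- int N..int N}" if "x \<in> X" for x
      using B[OF that] elim by auto
    then show ?case by auto
  qed
qed

text \<open>Poisson summation evaluates limits of symmetric partial sums, whereas the Eisenstein
  series is an unordered sum; this connects the two.\<close>

lemma sums_symmetric_intervals:
  fixes f :: "int \<Rightarrow> complex"
  assumes "f summable_on UNIV"
  shows "(\<lambda>N. \<Sum>k\<in>{- int N..int N}. f k) \<longlonglongrightarrow> infsum f UNIV"
  using has_sum_infsum[OF assms] filterlim_symmetric_intervals
  unfolding has_sum_def by (rule filterlim_compose)

section \<open>Wigner functions of a bump pair and Poisson summation\<close>

locale bump_pair =
  fixes V U :: "real \<Rightarrow> real"
  assumes Vs: "Csmooth UNIV (\<lambda>x. of_real (V x))" and Us: "Csmooth UNIV (\<lambda>x. of_real (U x))"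
    and V0: "\<And>x. x \<notin> {19/8<..<21/8} \<Longrightarrow> V x = 0"
    and U0: "\<And>x. x \<notin> {11/8<..<13/8} \<Longrightarrow> U x = 0"
begin

definition v :: "real \<Rightarrow> complex" where "v x = of_real (V x)"
definition u :: "real \<Rightarrow> complex" where "u x = of_real (U x)"

lemma v_cont: "continuous_on A v" and u_cont: "continuous_on A u"
  using Csmooth_continuous_on[OF Vs] Csmooth_continuous_on[OF Us]
  by (auto simp: v_def[abs_def] u_def[abs_def] intro: continuous_on_subset)

lemma v_measurable [measurable]: "v \<in> borel_measurable borel"
  and u_measurable [measurable]: "u \<in> borel_measurable borel"
  using v_cont[of UNIV] u_cont[of UNIV] by (auto intro: borel_measurable_continuous_onI)

definition g :: "real \<Rightarrow> real \<Rightarrow> complex" where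
  "g x \<tau> = v (x + \<tau>) * u (x - \<tau>)"

text \<open>x and \<open>\<tau>\<close> are half the sum and half the difference of the arguments of
  v and u, which lie within 1/8 of 5/2 and 3/2. Hence x is within 1/8 of 2 and \<open>\<tau>\<close>
  within 1/8 of 1/2.\<close>

lemma g_nonzero:
  assumes "g x \<tau> \<noteq> 0"
  shows "x \<in> {15/8<..<17/8}" "\<tau> \<in> {3/8<..<5/8}"
proof -
  have "V (x + \<tau>) \<noteq> 0" "U (x - \<tau>) \<noteq> 0"
    using assms by (auto simp: g_def v_def u_def)
  then have "x + \<tau> \<in> {19/8<..<21/8}" "x - \<tau> \<in> {11/8<..<13/8}"
    using V0 U0 by blast+
  then show "x \<in> {15/8<..<17/8}" "\<tau> \<in> {3/8<..<5/8}"
    unfolding greaterThanLessThan_iff by linarith+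
qed

lemma g_cont: "continuous_on A (g x)"
  unfolding g_def
  by (intro continuous_intros continuous_on_compose2[OF v_cont[of UNIV]] continuous_on_compose2[OF u_cont[of UNIV]]) auto

lemma Wig_eq_lint: "Wig v u x \<xi> = (LINT \<tau>|lborel. g x \<tau> * exp (2 * \<i> * pi * \<xi> * \<tau>))"
  by (simp add: Wig_def g_def v_def)

lemma Wig_eq_integral: "Wig v u x \<xi> = integral {1/4..3/4} (\<lambda>\<tau>. g x \<tau> * exp (2 * \<i> * pi * \<xi> * \<tau>))"
  unfolding Wig_eq_lint
proof (rule lborel_integral_eq_integral)
  fix \<tau> :: real assume "\<tau> \<notin> {1/4..3/4}"
  then have "g x \<tau> = 0"
    using g_nonzero(2)[of x \<tau>] by fastforce
  then show "g x \<tau> * exp (2 * \<i> * pi * \<xi> * \<tau>) = 0" by simp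
qed (intro continuous_intros g_cont)

lemma Wig_zero:
  assumes "x \<notin> {15/8<..<17/8}"
  shows "Wig v u x \<xi> = 0"
proof -
  have "g x \<tau> = 0" for \<tau>
    using g_nonzero(1)[of x \<tau>] assms by blast
  then show ?thesis by (simp add: Wig_eq_lint)
qed

text \<open>Two integrations by parts in \<open>\<tau>\<close> give decay like \<xi>^(-2), uniformly
  in x; this is what makes the sum over k converge absolutely.\<close>

lemma Wig_bound:
  obtains C where "C \<ge> 0" "\<And>x \<xi>. norm (Wig v u x \<xi>) \<le> C / (1 + \<xi>\<^sup>2)"
proof -
  obtain v' where v': "Csmooth UNIV v'" "\<And>x. (v has_vector_derivative v' x) (at x)"
    using CsmoothE[OF Vs] unfolding v_def[abs_def] by (metis UNIV_I)
  obtain v'' where v'': "Csmooth UNIV v''" "\<And>x. (v' has_vector_derivative v'' x) (at x)"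
    using CsmoothE[OF v'(1)] by (metis UNIV_I)
  obtain u' where u': "Csmooth UNIV u'" "\<And>x. (u has_vector_derivative u' x) (at x)"
    using CsmoothE[OF Us] unfolding u_def[abs_def] by (metis UNIV_I)
  obtain u'' where u'': "Csmooth UNIV u''" "\<And>x. (u' has_vector_derivative u'' x) (at x)"
    using CsmoothE[OF u'(1)] by (metis UNIV_I)
  have cont: "continuous_on A v'" "continuous_on A v''" "continuous_on A u'" "continuous_on A u''" for A
    using v' v'' u' u'' by (auto intro: continuous_on_subset[OF Csmooth_continuous_on])
  \<comment> \<open>[0, 4] contains x + \<tau> and x - \<tau> for all x in (15/8, 17/8) and \<tau>
    in [1/4, 3/4].\<close>
  have bd: "\<exists>B\<ge>0. \<forall>x\<in>{0..4}. norm (f x) \<le> B" if "continuous_on {0..4} f" for f :: "real \<Rightarrow> complex"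
  proof -
    have "bounded (f ` {0..4})"
      by (intro compact_imp_bounded compact_continuous_image that) auto
    then obtain B where "B > 0" "\<forall>z\<in>f ` {0..4}. norm z \<le> B"
      unfolding bounded_pos by blast
    then show ?thesis by (intro exI[of _ B]) auto
  qed
  obtain B0 where B0: "B0 \<ge> 0" "\<And>x. x \<in> {0..4} \<Longrightarrow> norm (v x) \<le> B0"
    using bd[OF v_cont] by blast
  obtain B1 where B1: "B1 \<ge> 0" "\<And>x. x \<in> {0..4} \<Longrightarrow> norm (v' x) \<le> B1"
    using bd[OF cont(1)] by blast
  obtain B2 where B2: "B2 \<ge> 0" "\<And>x. x \<in> {0..4} \<Longrightarrow> norm (v'' x) \<le> B2"
    using bd[OF cont(2)] by blast
  obtain C0 where C0: "C0 \<ge> 0" "\<And>x. x \<in> {0..4} \<Longrightarrow> norm (u x) \<le> C0"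
    using bd[OF u_cont] by blast
  obtain C1 where C1: "C1 \<ge> 0" "\<And>x. x \<in> {0..4} \<Longrightarrow> norm (u' x) \<le> C1"
    using bd[OF cont(3)] by blast
  obtain C2 where C2: "C2 \<ge> 0" "\<And>x. x \<in> {0..4} \<Longrightarrow> norm (u'' x) \<le> C2"
    using bd[OF cont(4)] by blast
  note BC = B0(2) B1(2) B2(2) C0(2) C1(2) C2(2)
  note nn = B0(1) B1(1) B2(1) C0(1) C1(1) C2(1)
  \<comment> \<open>B0 * C0 bounds |Wig| directly; the bracket bounds \<xi>^2 |Wig| through the
    second derivative of the product \<open>g x\<close>.\<close>
  define C where "C = B0 * C0 + (B2 * C0 + 2 * (B1 * C1) + B0 * C2)"
  have C: "C \<ge> 0" unfolding C_def using nn by auto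
  show ?thesis
  proof (rule that[OF C])
    fix x \<xi> :: real
    show "norm (Wig v u x \<xi>) \<le> C / (1 + \<xi>\<^sup>2)"
    proof (cases "x \<in> {15/8<..<17/8}")
      case False
      then show ?thesis using C by (simp add: Wig_zero)
    next
      case True
      then have xr: "15 / 8 < x" "x < 17 / 8" by auto
      let ?I = "{1/4..3/4::real}"
      define c where "c = 2 * \<i> * pi * \<xi>"
      let ?e = "\<lambda>\<tau>::real. exp (c * \<tau>)"
      have W: "Wig v u x \<xi> = integral ?I (\<lambda>\<tau>. g x \<tau> * ?e \<tau>)"
        by (simp add: Wig_eq_integral c_def)
      define D1 where "D1 = (\<lambda>\<tau>. v' (x + \<tau>) * u (x - \<tau>) - v (x + \<tau>) * u' (x - \<tau>))"
      define D2 where "D2 = (\<lambda>\<tau>. v'' (x + \<tau>) * u (x - \<tau>) - 2 * (v' (x + \<tau>) * u' (x - \<tau>)) + v (x + \<tau>) * u'' (x - \<tau>))"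
      have shp: "((\<lambda>\<tau>. f (x + \<tau>)) has_vector_derivative f' (x + \<tau>)) (at \<tau>)"
        if "\<And>y. (f has_vector_derivative f' y) (at y)" for f f' :: "real \<Rightarrow> complex" and \<tau>
        using has_vector_derivative_affine[of f "f' (x + \<tau>)" x 1 \<tau>] that by simp
      have shm: "((\<lambda>\<tau>. f (x - \<tau>)) has_vector_derivative - f' (x - \<tau>)) (at \<tau>)"
        if "\<And>y. (f has_vector_derivative f' y) (at y)" for f f' :: "real \<Rightarrow> complex" and \<tau>
        using has_vector_derivative_affine[of f "f' (x - \<tau>)" x "-1" \<tau>] that by simp
      have d1: "(g x has_vector_derivative D1 \<tau>) (at \<tau>)" for \<tau>
        using has_vector_derivative_mult[OF shp[OF v'(2)] shm[OF u'(2)], of \<tau>]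
        by (simp add: g_def[abs_def] D1_def algebra_simps)
      have d2: "(D1 has_vector_derivative D2 \<tau>) (at \<tau>)" for \<tau>
        using has_vector_derivative_diff[OF has_vector_derivative_mult[OF shp[OF v''(2)] shm[OF u'(2)]]
            has_vector_derivative_mult[OF shp[OF v'(2)] shm[OF u''(2)]], of \<tau>]
        by (simp add: D1_def[abs_def] D2_def algebra_simps)
      have cD: "continuous_on A D1" "continuous_on A D2" for A
        unfolding D1_def D2_def
        by (intro continuous_intros continuous_on_compose2[OF v_cont[of UNIV]] continuous_on_compose2[OF u_cont[of UNIV]]
          continuous_on_compose2[OF cont(1)[of UNIV]] continuous_on_compose2[OF cont(2)[of UNIV]]
          continuous_on_compose2[OF cont(3)[of UNIV]] continuous_on_compose2[OF cont(4)[of UNIV]]; simp)+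
      have de: "(?e has_vector_derivative c * ?e \<tau>) (at \<tau>)" for \<tau>
      proof -
        have "((\<lambda>z. exp (c * z)) has_field_derivative c * exp (c * of_real \<tau>)) (at (of_real \<tau>))"
          by (auto intro!: derivative_eq_intros)
        from has_vector_derivative_real_field[OF this] show ?thesis .
      qed
      have z: "g x (1/4) = 0" "g x (3/4) = 0"
        using g_nonzero(2)[of x "1/4"] g_nonzero(2)[of x "3/4"] by auto
      \<comment> \<open>The endpoints 1/4 and 3/4 lie in an open set on which \<open>g x\<close>
        vanishes identically, so its derivative vanishes there too.\<close>
      have D1z: "D1 \<tau> = 0" if "\<tau> \<in> {..<3/8} \<union> {5/8<..}" for \<tau>
      proof (rule has_vector_derivative_zero_on_open[OF d1 _ that])
        fix y :: real assume "y \<in> {..<3/8} \<union> {5/8<..}"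
        then show "g x y = 0" using g_nonzero(2)[of x y] by fastforce
      qed auto
      have "c * Wig v u x \<xi> = integral ?I (\<lambda>\<tau>. g x \<tau> * (c * ?e \<tau>))"
        unfolding W by (subst integral_mult_right[symmetric]) (simp add: mult_ac)
      also have "\<dots> = - integral ?I (\<lambda>\<tau>. D1 \<tau> * ?e \<tau>)"
        by (rule integral_by_parts_vanishing[OF _ z d1 cD(1) de]) (auto intro!: continuous_intros)
      finally have "c * (c * Wig v u x \<xi>) = - (c * integral ?I (\<lambda>\<tau>. D1 \<tau> * ?e \<tau>))"
        by simp
      also have "c * integral ?I (\<lambda>\<tau>. D1 \<tau> * ?e \<tau>) = integral ?I (\<lambda>\<tau>. D1 \<tau> * (c * ?e \<tau>))"
        by (subst integral_mult_right[symmetric]) (simp add: mult_ac)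
      also have "\<dots> = - integral ?I (\<lambda>\<tau>. D2 \<tau> * ?e \<tau>)"
        by (rule integral_by_parts_vanishing[OF _ D1z D1z d2 cD(2) de]) (auto intro!: continuous_intros)
      finally have cc: "c * (c * Wig v u x \<xi>) = integral ?I (\<lambda>\<tau>. D2 \<tau> * ?e \<tau>)"
        by simp
      have ne: "norm (?e \<tau>) = 1" for \<tau>
      proof -
        have "c * of_real \<tau> = \<i> * of_real (2 * pi * \<xi> * \<tau>)"
          by (simp add: c_def)
        then show ?thesis by (simp only: norm_exp_i_times)
      qed
      have r: "x + \<tau> \<in> {0..4}" "x - \<tau> \<in> {0..4}" if "\<tau> \<in> ?I" for \<tau>
        using xr that by auto
      have "norm (integral ?I (\<lambda>\<tau>. D2 \<tau> * ?e \<tau>)) \<le> (B2 * C0 + 2 * (B1 * C1) + B0 * C2) * (3/4 - 1/4)"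
      proof (rule integral_bound)
        show "norm (D2 \<tau> * ?e \<tau>) \<le> B2 * C0 + 2 * (B1 * C1) + B0 * C2" if \<tau>: "\<tau> \<in> ?I" for \<tau>
        proof -
          have "norm (D2 \<tau>) \<le> norm (v'' (x + \<tau>) * u (x - \<tau>)) + norm (2 * (v' (x + \<tau>) * u' (x - \<tau>))) + norm (v (x + \<tau>) * u'' (x - \<tau>))"
            unfolding D2_def by (intro order_trans[OF norm_triangle_ineq] add_right_mono norm_triangle_ineq4)
          also have "\<dots> \<le> B2 * C0 + 2 * (B1 * C1) + B0 * C2"
            unfolding norm_mult using BC r[OF \<tau>] nn by (intro add_mono mult_mono) auto
          finally show ?thesis unfolding norm_mult ne by simp
        qed
      qed (auto intro!: continuous_intros cD)
      also have "\<dots> \<le> B2 * C0 + 2 * (B1 * C1) + B0 * C2"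
        using nn by (simp add: field_simps)
      finally have b2: "norm c ^ 2 * norm (Wig v u x \<xi>) \<le> B2 * C0 + 2 * (B1 * C1) + B0 * C2"
        unfolding cc[symmetric] by (simp add: norm_mult power2_eq_square)
      have "norm (Wig v u x \<xi>) \<le> (B0 * C0) * (3/4 - 1/4)"
        unfolding W
      proof (rule integral_bound)
        show "norm (g x \<tau> * ?e \<tau>) \<le> B0 * C0" if \<tau>: "\<tau> \<in> ?I" for \<tau>
          unfolding norm_mult ne g_def using BC r[OF \<tau>] nn by (simp add: mult_mono)
      qed (auto intro!: continuous_intros g_cont)
      also have "\<dots> \<le> B0 * C0" using nn by simp
      finally have b0: "norm (Wig v u x \<xi>) \<le> B0 * C0" .
      have "\<xi>\<^sup>2 \<le> norm c ^ 2"
      proof -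
        have "1 * \<bar>\<xi>\<bar> \<le> (2 * pi) * \<bar>\<xi>\<bar>"
          using pi_gt3 by (intro mult_right_mono) auto
        then have "\<bar>\<xi>\<bar> \<le> norm c" by (simp add: c_def norm_mult)
        then have "\<bar>\<xi>\<bar> ^ 2 \<le> norm c ^ 2" by (intro power_mono) auto
        then show ?thesis by simp
      qed
      then have "\<xi>\<^sup>2 * norm (Wig v u x \<xi>) \<le> norm c ^ 2 * norm (Wig v u x \<xi>)"
        by (intro mult_right_mono) auto
      with b0 b2 have "(1 + \<xi>\<^sup>2) * norm (Wig v u x \<xi>) \<le> C"
        unfolding C_def distrib_right by simp
      moreover have "1 + \<xi>\<^sup>2 > 0" by (simp add: add_pos_nonneg)
      ultimately show ?thesis by (simp add: field_simps)
    qed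
  qed
qed

text \<open>Equal to \<open>g t (1 / t)\<close>: the one contribution that survives Poisson
  summation, up to the factor 1/t.\<close>

definition \<phi> :: "real \<Rightarrow> complex" where
  "\<phi> t = v (t + 1 / t) * u (t - 1 / t)"

text \<open>The substitution y = t \<tau> turns values at the frequencies k t into Fourier
  coefficients on a unit interval that contains the rescaled support.\<close>

lemma Wig_scaled:
  assumes "t > 0" and supp: "\<And>\<tau>. \<tau> \<in> {3/8<..<5/8} \<Longrightarrow> t * \<tau> \<in> {a..a+1}"
  shows "Wig v u x (real_of_int k * t) = of_real (1 / t) * integral {a..a+1} (\<lambda>y. g x (y / t) * fchar k y)"
proof -
  have "(LINT y|lborel. g x (y / t) * fchar k y) = \<bar>t\<bar> *\<^sub>R (LINT \<tau>|lborel. g x ((0 + t * \<tau>) / t) * fchar k (0 + t * \<tau>))"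
    by (rule lborel_integral_real_affine) (use assms in auto)
  also have "\<dots> = of_real t * Wig v u x (real_of_int k * t)"
    using assms by (simp add: Wig_eq_lint fchar_def mult_ac scaleR_conv_of_real)
  finally have "of_real t * Wig v u x (real_of_int k * t) = (LINT y|lborel. g x (y / t) * fchar k y)" by simp
  also have "\<dots> = integral {a..a+1} (\<lambda>y. g x (y / t) * fchar k y)"
  proof (rule lborel_integral_eq_integral)
    show "continuous_on {a..a+1} (\<lambda>y. g x (y / t) * fchar k y)"
      using assms by (intro continuous_intros continuous_on_compose2[OF g_cont[of UNIV]]) auto
    fix y assume y: "y \<notin> {a..a+1}"
    have "g x (y / t) = 0"
      using g_nonzero(2)[of x "y / t"] supp[of "y / t"] y assms(1) by auto
    then show "g x (y / t) * fchar k y = 0" by simp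
  qed
  finally show ?thesis using assms by (simp add: field_simps)
qed

text \<open>
  Poisson summation for \<open>y \<mapsto> g x (y / t)\<close>, whose support contains at most the integer \<open>m\<close>.
\<close>
lemma Wig_sums_tendsto_aux:
  assumes "t > 0" and supp: "\<And>\<tau>. \<tau> \<in> {3/8<..<5/8} \<Longrightarrow> t * \<tau> \<in> {a..a+1}"
    and a: "of_int m - 3 / 4 \<le> a" "a + 1 \<le> of_int m + 3 / 4" "of_int m \<in> {a..a+1}"
  shows "(\<lambda>N. \<Sum>k\<in>{- int N..int N}. Wig v u x (of_int k * t)) \<longlonglongrightarrow> of_real (1 / t) * g x (of_int m / t)"
proof -
  obtain v' where v': "Csmooth UNIV v'" "\<And>x. (v has_vector_derivative v' x) (at x)"
    using CsmoothE[OF Vs] unfolding v_def[abs_def] by (metis UNIV_I)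
  obtain u' where u': "Csmooth UNIV u'" "\<And>x. (u has_vector_derivative u' x) (at x)"
    using CsmoothE[OF Us] unfolding u_def[abs_def] by (metis UNIV_I)
  let ?G = "\<lambda>y. g x (y / t)"
  define D where "D = (\<lambda>y. v (x + y / t) * (- (1 / t) *\<^sub>R u' (x - y / t)) + ((1 / t) *\<^sub>R v' (x + y / t)) * u (x - y / t))"
  have dG: "(?G has_vector_derivative D y) (at y)" for y
  proof -
    have "((\<lambda>y. v (x + y / t)) has_vector_derivative (1 / t) *\<^sub>R v' (x + y / t)) (at y)"
      using has_vector_derivative_affine[of v "v' (x + y / t)" x "1 / t" y] v'(2) by simp
    moreover have "((\<lambda>y. u (x - y / t)) has_vector_derivative (- (1 / t)) *\<^sub>R u' (x - y / t)) (at y)"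
      using has_vector_derivative_affine[of u "u' (x - y / t)" x "- (1 / t)" y] u'(2) by simp
    ultimately show ?thesis
      unfolding g_def D_def by (rule has_vector_derivative_mult)
  qed
  have cD: "continuous_on {a..a+1} D"
    unfolding D_def using assms(1)
    by (intro continuous_intros continuous_on_compose2[OF v_cont[of UNIV]] continuous_on_compose2[OF u_cont[of UNIV]]
          continuous_on_compose2[OF Csmooth_continuous_on[OF v'(1)]] continuous_on_compose2[OF Csmooth_continuous_on[OF u'(1)]]; simp)+
  obtain L where L: "\<And>y. y \<in> {a..a+1} \<Longrightarrow> norm (?G y - ?G (of_int m)) \<le> L * \<bar>y - of_int m\<bar>"
    using Lipschitz_of_C1[OF dG cD a(3)] by metis
  have "(\<lambda>N. \<Sum>k\<in>{- int N..int N}. integral {a..a+1} (\<lambda>y. ?G y * fchar k y)) \<longlonglongrightarrow> ?G (of_int m)"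
  proof (rule fourier_sums_tendsto[OF _ a(1,2) L])
    show "continuous_on {a..a+1} ?G"
      using dG by (meson continuous_at_imp_continuous_on has_vector_derivative_continuous)
  qed
  moreover have "Wig v u x (of_int k * t) = of_real (1 / t) * integral {a..a+1} (\<lambda>y. ?G y * fchar k y)" for k
    by (rule Wig_scaled[OF assms(1) supp])
  ultimately show ?thesis
    using tendsto_mult_left[of _ "?G (of_int m)" sequentially "complex_of_real (1 / t)"]
    by (simp only: sum_distrib_left[symmetric])
qed

text \<open>Nonzero terms force j t into (15/8, 17/8). If j = 1, then t \<tau> lies in [1/2, 3/2],
  and the integer 1 is picked up. If j \<ge> 2, then t \<le> 17/16, so t \<tau> < 3/4 and the only
  candidate is the integer 0, where \<open>g\<close> vanishes.\<close>

lemma Wig_sums_tendsto: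
  assumes "t > 0" "j \<ge> (1::int)"
  shows "(\<lambda>N. \<Sum>k\<in>{- int N..int N}. Wig v u (of_int j * t) (of_int k * t)) \<longlonglongrightarrow> (if j = 1 then of_real (1 / t) * \<phi> t else 0)"
proof (cases "real_of_int j * t \<in> {15/8<..<17/8}")
  case False
  note W = Wig_zero[OF False]
  have "\<phi> t = 0" if "j = 1"
  proof -
    have "\<phi> t = g t (1 / t)" by (simp add: \<phi>_def g_def)
    then show ?thesis using g_nonzero(1)[of t "1 / t"] False that by auto
  qed
  then show ?thesis by (simp add: W)
next
  case True
  then have jt: "15 / 8 < real_of_int j * t" "real_of_int j * t < 17 / 8" by auto
  show ?thesis
  proof (cases "j = 1")
    case True
    have "(\<lambda>N. \<Sum>k\<in>{- int N..int N}. Wig v u t (of_int k * t)) \<longlonglongrightarrow> of_real (1 / t) * g t (of_int 1 / t)"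
    proof (rule Wig_sums_tendsto_aux[OF assms(1), where a = "1/2" and m = 1])
      fix \<tau> :: real assume "\<tau> \<in> {3/8<..<5/8}"
      then have "3 / 8 < \<tau>" "\<tau> < 5 / 8" by auto
      then have "15 / 8 * (3 / 8) \<le> t * \<tau>" "t * \<tau> \<le> 17 / 8 * (5 / 8)"
        using jt True by (intro mult_mono; simp)+
      then show "t * \<tau> \<in> {1/2..1/2 + 1}" by simp
    qed auto
    then show ?thesis using True by (simp add: \<phi>_def g_def)
  next
    case False
    then have j2: "real_of_int j \<ge> 2" using assms(2) by simp
    have "2 * t \<le> real_of_int j * t" using j2 assms(1) by (intro mult_right_mono) auto
    then have t: "t \<le> 17 / 16" using jt by simp
    have "(\<lambda>N. \<Sum>k\<in>{- int N..int N}. Wig v u (real_of_int j * t) (of_int k * t)) \<longlonglongrightarrow> of_real (1 / t) * g (real_of_int j * t) (of_int 0 / t)"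
    \<comment> \<open>The interval [-1/4, 3/4] reaches exactly the distance 3/4 from m = 0 that the
      lower bound for \<open>fchar 1 - 1\<close> allows.\<close>
    proof (rule Wig_sums_tendsto_aux[OF assms(1), where a = "-1/4" and m = 0])
      fix \<tau> :: real assume "\<tau> \<in> {3/8<..<5/8}"
      then have "3 / 8 < \<tau>" "\<tau> < 5 / 8" by auto
      then have "0 \<le> t * \<tau>" using assms(1) by simp
      moreover have "t * \<tau> \<le> 17 / 16 * (5 / 8)"
        using t assms(1) \<open>3 / 8 < \<tau>\<close> \<open>\<tau> < 5 / 8\<close> by (intro mult_mono) auto
      ultimately have "0 \<le> t * \<tau>" "t * \<tau> \<le> 17 / 16 * (5 / 8)" .
      then show "t * \<tau> \<in> {-1/4..-1/4 + 1}" by simp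
    qed auto
    moreover have "g (real_of_int j * t) (of_int 0 / t) = 0"
      using g_nonzero(2)[of "real_of_int j * t" 0] by auto
    ultimately show ?thesis using False by simp
  qed
qed

end

section \<open>The Mellin transform of \<open>\<phi>\<close>\<close>

context bump_pair
begin

lemma \<phi>_nonzero:
  assumes "\<phi> t \<noteq> 0" "t > 0"
  shows "t \<in> {15/8<..<17/8}"
  using g_nonzero(1)[of t "1 / t"] assms by (simp add: \<phi>_def g_def)

lemma Csmooth_\<phi>: "Csmooth {0<..} \<phi>"
proof -
  have 1: "Csmooth {0<..} (\<lambda>t. of_real (1 + c * inverse t ^ 2))" for c :: real
    using Csmooth_add[OF Csmooth_const[of _ 1] Csmooth_inverse_power[of "of_real c" 2]] by simp
  have "Csmooth {0<..} (\<lambda>t. v (t + 1 / t) * u (t - 1 / t))"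
  proof (rule Csmooth_mult)
    show "Csmooth {0<..} (\<lambda>t. v (t + 1 / t))"
      by (rule Csmooth_compose[of UNIV v _ _ "\<lambda>t. 1 + (-1) * inverse t ^ 2"])
         (use Vs 1[of "-1"] in \<open>auto simp: v_def[abs_def] power2_eq_square field_simps intro!: derivative_eq_intros\<close>)
    show "Csmooth {0<..} (\<lambda>t. u (t - 1 / t))"
      by (rule Csmooth_compose[of UNIV u _ _ "\<lambda>t. 1 + 1 * inverse t ^ 2"])
         (use Us 1[of 1] in \<open>auto simp: u_def[abs_def] power2_eq_square field_simps intro!: derivative_eq_intros\<close>)
  qed
  then show ?thesis by (simp add: \<phi>_def[abs_def])
qed

lemma \<phi>_cont: "A \<subseteq> {0<..} \<Longrightarrow> continuous_on A \<phi>"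
  using Csmooth_continuous_on[OF Csmooth_\<phi>] continuous_on_subset by blast

text \<open>The Mellin transform of \<open>\<phi>\<close>; [1, 3] contains the support (15/8, 17/8)
  and stays away from 0, so every power of t is harmless.\<close>

definition mellin :: "complex \<Rightarrow> complex" where
  "mellin \<nu> = integral {1..3} (\<lambda>t. of_real t powr (\<nu> - 1) * \<phi> t)"

lemma mellin_holomorphic: "mellin holomorphic_on UNIV"
proof -
  have "(\<lambda>\<nu>. integral (cbox 1 3) (\<lambda>t. of_real t powr (\<nu> - 1) * \<phi> t)) holomorphic_on UNIV"
  proof (rule leibniz_rule_holomorphic)
    fix \<nu> :: complex and t :: real
    assume t: "t \<in> cbox 1 3"
    show "((\<lambda>\<nu>. of_real t powr (\<nu> - 1) * \<phi> t) has_field_derivative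
            Ln (of_real t) * of_real t powr (\<nu> - 1) * \<phi> t) (at \<nu> within UNIV)"
      using t by (auto intro!: derivative_eq_intros simp: powr_def)
  next
    fix \<nu> :: complex
    show "(\<lambda>t. of_real t powr (\<nu> - 1) * \<phi> t) integrable_on cbox 1 3"
      by (auto intro!: integrable_continuous_real continuous_intros \<phi>_cont simp: complex_nonpos_Reals_iff)
  next
    have c: "continuous_on (UNIV \<times> {1..3}) (\<lambda>z::complex\<times>real. \<phi> (snd z))"
      by (rule continuous_on_compose2[OF \<phi>_cont[of "{1..3}"]]) (auto intro: continuous_intros)
    show "continuous_on (UNIV \<times> cbox 1 3) (\<lambda>(\<nu>, t). Ln (of_real t) * of_real t powr (\<nu> - 1) * \<phi> t)"
      unfolding split_beta using c
      by (auto intro!: continuous_intros simp: complex_nonpos_Reals_iff)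
  qed auto
  then show ?thesis by (simp add: mellin_def[abs_def])
qed

text \<open>Each integration by parts gains a factor 1/\<nu>, but it replaces F(n) by F(n + 1) and
  \<nu> by \<nu> + 1. Hence the induction runs over all n and over all right edges R of the
  strip.\<close>

lemma mellin_decay_aux:
  assumes F: "derivs_on {0<..} \<phi> F"
  shows "\<exists>C. \<forall>\<nu>. 1 \<le> Re \<nu> \<and> Re \<nu> \<le> R \<longrightarrow>
     norm (integral {1..3} (\<lambda>t. of_real t powr (\<nu> - 1) * F n t)) \<le> C / norm \<nu> ^ N"
proof (induction N arbitrary: n R)
  case 0
  have F': "(F n has_vector_derivative F (Suc n) x) (at x)" if "x > 0" for n x
    using F that by (auto simp: derivs_on_def)
  then have cF: "continuous_on {1..3} (F n)" for n
    by (intro continuous_at_imp_continuous_on ballI has_vector_derivative_continuous[OF F']) auto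
  have "bounded (F n ` {1..3})"
    by (intro compact_imp_bounded compact_continuous_image cF) auto
  then obtain B where B: "B > 0" "\<forall>z\<in>F n ` {1..3}. norm z \<le> B"
    unfolding bounded_pos by blast
  have "norm (integral {1..3} (\<lambda>t. of_real t powr (\<nu> - 1) * F n t)) \<le> (3 powr \<bar>R\<bar> * B) * (3 - 1)"
    if \<nu>: "1 \<le> Re \<nu>" "Re \<nu> \<le> R" for \<nu> :: complex
  proof (rule integral_bound)
    show "continuous_on {1..3} (\<lambda>t. of_real t powr (\<nu> - 1) * F n t)"
      by (auto intro!: continuous_intros cF simp: complex_nonpos_Reals_iff)
    fix t :: real assume t: "t \<in> {1..3}"
    have "norm (complex_of_real t powr (\<nu> - 1)) = t powr (Re \<nu> - 1)"
      using t by (simp add: norm_powr_real_powr)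
    also have "\<dots> \<le> 3 powr (Re \<nu> - 1)"
      using t \<nu> by (intro powr_mono2) auto
    also have "\<dots> \<le> 3 powr \<bar>R\<bar>"
      using \<nu> by (intro powr_mono) auto
    finally show "norm (of_real t powr (\<nu> - 1) * F n t) \<le> 3 powr \<bar>R\<bar> * B"
      using B t by (auto simp: norm_mult intro!: mult_mono)
  qed auto
  then show ?case
    by (intro exI[of _ "(3 powr \<bar>R\<bar> * B) * (3 - 1)"]) auto
next
  case (Suc N)
  have F': "(F n has_vector_derivative F (Suc n) x) (at x)" if "x > 0" for n x
    using F that by (auto simp: derivs_on_def)
  then have cF: "continuous_on {1..3} (F n)" for n
    by (intro continuous_at_imp_continuous_on ballI has_vector_derivative_continuous[OF F']) auto
  \<comment> \<open>The shift \<nu> + 1 has real part up to R + 1.\<close>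
  obtain C where C: "\<And>\<nu>. 1 \<le> Re \<nu> \<Longrightarrow> Re \<nu> \<le> R + 1 \<Longrightarrow>
      norm (integral {1..3} (\<lambda>t. of_real t powr (\<nu> - 1) * F (Suc n) t)) \<le> C / norm \<nu> ^ N"
    using Suc.IH[of "R + 1" "Suc n"] by blast
  have Fz: "F n x = 0" if "x \<in> {0<..<15/8} \<union> {17/8<..}" for x
    by (rule derivs_on_zero[OF F _ _ _ that]) (use \<phi>_nonzero in force)+
  show ?case
  proof (intro exI[of _ C] allI impI)
    fix \<nu> :: complex assume \<nu>: "1 \<le> Re \<nu> \<and> Re \<nu> \<le> R"
    then have \<nu>0: "\<nu> \<noteq> 0" by auto
    have "integral {1..3} (\<lambda>t. F n t * (\<nu> * of_real t powr (\<nu> - 1))) = - integral {1..3} (\<lambda>t. F (Suc n) t * of_real t powr \<nu>)"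
    proof (rule integral_by_parts_vanishing)
      fix t :: real assume t: "t \<in> {1..3}"
      have "((\<lambda>z. z powr \<nu>) has_field_derivative \<nu> * of_real t powr (\<nu> - 1)) (at (of_real t))"
        using t by (intro has_field_derivative_powr) (auto simp: complex_nonpos_Reals_iff)
      from has_vector_derivative_real_field[OF this]
      show "((\<lambda>t. of_real t powr \<nu>) has_vector_derivative \<nu> * of_real t powr (\<nu> - 1)) (at t)" .
      show "(F n has_vector_derivative F (Suc n) t) (at t)" using F' t by simp
    qed (auto intro!: Fz cF continuous_intros simp: complex_nonpos_Reals_iff)
    then have "integral {1..3} (\<lambda>t. \<nu> * (of_real t powr (\<nu> - 1) * F n t))
        = - integral {1..3} (\<lambda>t. of_real t powr (\<nu> + 1 - 1) * F (Suc n) t)"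
      by (simp add: mult_ac)
    then have "\<nu> * integral {1..3} (\<lambda>t. of_real t powr (\<nu> - 1) * F n t)
        = - integral {1..3} (\<lambda>t. of_real t powr (\<nu> + 1 - 1) * F (Suc n) t)"
      by simp
    then have "norm \<nu> * norm (integral {1..3} (\<lambda>t. of_real t powr (\<nu> - 1) * F n t))
        = norm (integral {1..3} (\<lambda>t. of_real t powr (\<nu> + 1 - 1) * F (Suc n) t))"
      by (metis norm_minus_cancel norm_mult)
    also have b: "\<dots> \<le> C / norm (\<nu> + 1) ^ N"
      by (rule C) (use \<nu> in auto)
    also have "\<dots> \<le> C / norm \<nu> ^ N"
    proof (rule divide_left_mono)
      \<comment> \<open>Moving right by 1 increases the modulus since Re \<nu> \<ge> 1, so the bound
        at \<nu> + 1 transfers to \<nu>.\<close>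
      have "norm \<nu> ^ 2 \<le> norm (\<nu> + 1) ^ 2"
        using \<nu> unfolding cmod_power2 by (simp add: power2_eq_square algebra_simps)
      then have "norm \<nu> \<le> norm (\<nu> + 1)"
        by (rule power2_le_imp_le) simp
      then show "norm \<nu> ^ N \<le> norm (\<nu> + 1) ^ N" by (intro power_mono) auto
      have n1: "norm (\<nu> + 1) > 0"
        using \<nu> by (auto simp: complex_eq_iff)
      \<comment> \<open>C carries no sign assumption; it is nonnegative because this quotient bounds
        a norm.\<close>
      have "0 \<le> C / norm (\<nu> + 1) ^ N"
        using b norm_ge_zero order_trans by blast
      moreover have "0 < norm (\<nu> + 1) ^ N" using n1 by simp
      ultimately show "0 \<le> C" unfolding zero_le_divide_iff by linarith
      show "0 < norm (\<nu> + 1) ^ N * norm \<nu> ^ N"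
        using \<nu>0 n1 by simp
    qed
    finally show "norm (integral {1..3} (\<lambda>t. of_real t powr (\<nu> - 1) * F n t)) \<le> C / norm \<nu> ^ Suc N"
      using \<nu>0 by (simp add: field_simps)
  qed
qed

lemma mellin_decay:
  obtains C where "\<And>\<nu>. 1 \<le> Re \<nu> \<Longrightarrow> Re \<nu> \<le> R \<Longrightarrow> norm (mellin \<nu>) \<le> C / norm \<nu> ^ N"
proof -
  obtain F where F: "derivs_on {0<..} \<phi> F"
    using Csmooth_\<phi> by (auto simp: Csmooth_def)
  then have "F 0 = \<phi>" by (simp add: derivs_on_def)
  with mellin_decay_aux[OF F, of R 0 N] that show ?thesis
    by (auto simp: mellin_def)
qed

section \<open>Summation of the Eisenstein series\<close>

definition eis_term :: "complex \<Rightarrow> int \<Rightarrow> int \<Rightarrow> complex" where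
  "eis_term \<nu> j k = (LINT t:{0<..}|lborel. of_real t powr \<nu> * Wig v u (of_int j * t) (of_int k * t))"

lemma Wig_measurable [measurable]:
  "(\<lambda>t. Wig v u (of_int j * t) (of_int k * t)) \<in> borel_measurable borel"
proof -
  have "(\<lambda>t. LINT \<tau>|lborel. g (of_int j * t) \<tau> * exp (2 * \<i> * pi * of_real (of_int k * t) * \<tau>)) \<in> borel_measurable borel"
    unfolding g_def by measurable
  then show ?thesis by (simp add: Wig_eq_lint)
qed

definition integrand :: "complex \<Rightarrow> int \<Rightarrow> int \<Rightarrow> real \<Rightarrow> complex" where
  "integrand \<nu> j k t = indicator {0<..} t *\<^sub>R (of_real t powr \<nu> * Wig v u (of_int j * t) (of_int k * t))"

lemma eis_term_eq: "eis_term \<nu> j k = (LINT t|lborel. integrand \<nu> j k t)"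
  by (simp add: eis_term_def integrand_def set_lebesgue_integral_def)

lemma integrand_zero:
  assumes "t > 0" "t \<notin> {15 / 8 / real_of_int j..17 / 8 / real_of_int j} \<or> j < 1"
  shows "Wig v u (of_int j * t) \<xi> = 0"
proof (rule Wig_zero)
  show "real_of_int j * t \<notin> {15/8<..<17/8}"
  proof (cases "j < 1")
    case True
    then have "real_of_int j * t \<le> 0" using assms(1) by (simp add: mult_nonpos_nonneg)
    then show ?thesis by auto
  next
    case False
    then show ?thesis using assms by (auto simp: field_simps)
  qed
qed

text \<open>\<open>Wig v u\<close> lives on positive x, so only the rows j \<ge> 1 remain; in
  particular the excluded index (0, 0) can be put back.\<close>

lemma eis_term_zero: "j < 1 \<Longrightarrow> eis_term \<nu> j k = 0"
  unfolding eis_term_def set_lebesgue_integral_def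
  by (rule integral_eq_zero_AE) (auto simp: integrand_zero indicator_def)

definition Wig_const :: real where
  "Wig_const = (SOME C. C \<ge> 0 \<and> (\<forall>x \<xi>. norm (Wig v u x \<xi>) \<le> C / (1 + \<xi>\<^sup>2)))"

lemma Wig_const: "Wig_const \<ge> 0" "norm (Wig v u x \<xi>) \<le> Wig_const / (1 + \<xi>\<^sup>2)"
proof -
  have "Wig_const \<ge> 0 \<and> (\<forall>x \<xi>. norm (Wig v u x \<xi>) \<le> Wig_const / (1 + \<xi>\<^sup>2))"
    unfolding Wig_const_def by (rule someI_ex, rule Wig_bound) blast
  then show "Wig_const \<ge> 0" "norm (Wig v u x \<xi>) \<le> Wig_const / (1 + \<xi>\<^sup>2)" by auto
qed

text \<open>On the support t is of size 1/j: there t \<le> 3/j bounds the power of t, and t \<ge>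
  1/j bounds |k t| below by |k|/j in the decay of \<open>Wig\<close>.\<close>

definition majorant :: "complex \<Rightarrow> int \<Rightarrow> int \<Rightarrow> real \<Rightarrow> real" where
  "majorant \<nu> j k t = indicator {15 / 8 / real_of_int j..17 / 8 / real_of_int j} t
     * ((3 / real_of_int j) powr Re \<nu> * (Wig_const / (1 + (real_of_int k / real_of_int j)\<^sup>2)))"

lemma majorant_integrable: "integrable lborel (majorant \<nu> j k)"
  unfolding majorant_def
  by (intro integrable_mult_left integrable_real_indicator) (auto simp: emeasure_lborel_Icc_eq)

lemma integrand_bound:
  assumes j: "j \<ge> 1" and \<nu>: "Re \<nu> > 0"
  shows "norm (integrand \<nu> j k t) \<le> majorant \<nu> j k t"
proof (cases "t > 0 \<and> t \<in> {15 / 8 / real_of_int j..17 / 8 / real_of_int j}")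
  case False
  then show ?thesis
    using integrand_zero[of t j] Wig_const(1) by (auto simp: integrand_def majorant_def indicator_def)
next
  case True
  then have t: "t > 0" "15 / 8 / real_of_int j \<le> t" "t \<le> 17 / 8 / real_of_int j" by auto
  have j': "real_of_int j \<ge> 1" using j by simp
  have "1 / real_of_int j \<le> 15 / 8 / real_of_int j" "17 / 8 / real_of_int j \<le> 3 / real_of_int j"
    by (rule divide_right_mono; use j' in simp)+
  then have t': "1 / real_of_int j \<le> t" "t \<le> 3 / real_of_int j"
    using t by linarith+
  have "norm (complex_of_real t powr \<nu>) = t powr Re \<nu>"
    using t by (simp add: norm_powr_real_powr)
  also have "\<dots> \<le> (3 / real_of_int j) powr Re \<nu>"
    using t t' \<nu> by (intro powr_mono2) auto
  finally have 1: "norm (complex_of_real t powr \<nu>) \<le> (3 / real_of_int j) powr Re \<nu>" .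
  have "\<bar>real_of_int k / real_of_int j\<bar> \<le> \<bar>real_of_int k * t\<bar>"
    using mult_left_mono[OF t'(1), of "\<bar>real_of_int k\<bar>"] j' t by (simp add: abs_mult)
  then have "(real_of_int k / real_of_int j)\<^sup>2 \<le> (real_of_int k * t)\<^sup>2"
    by (simp only: abs_le_square_iff)
  then have "Wig_const / (1 + (real_of_int k * t)\<^sup>2) \<le> Wig_const / (1 + (real_of_int k / real_of_int j)\<^sup>2)"
    using Wig_const(1) by (intro divide_left_mono) (auto simp: add_pos_nonneg)
  then have W: "norm (Wig v u (of_int j * t) (of_int k * t)) \<le> Wig_const / (1 + (real_of_int k / real_of_int j)\<^sup>2)"
    using Wig_const(2) order_trans by blast
  then show ?thesis
    using True mult_mono[OF 1 W] by (simp add: integrand_def majorant_def norm_mult)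
qed

lemma integrand_integrable:
  assumes "j \<ge> 1" "Re \<nu> > 0"
  shows "integrable lborel (integrand \<nu> j k)"
proof (rule Bochner_Integration.integrable_bound[OF majorant_integrable])
  show "integrand \<nu> j k \<in> borel_measurable lborel"
    unfolding integrand_def by measurable
  show "AE t in lborel. norm (integrand \<nu> j k t) \<le> norm (majorant \<nu> j k t)"
    using order_trans[OF integrand_bound[OF assms] abs_ge_self] by simp
qed

lemma one_plus_square_le: "(1 + x :: real)\<^sup>2 \<le> 2 * (1 + x\<^sup>2)"
  using sum_squares_bound[of 1 x] by (simp add: power2_eq_square algebra_simps)

lemma inverse_le_of_le_double: "0 < q \<Longrightarrow> 0 < x \<Longrightarrow> q \<le> 2 * x \<Longrightarrow> 1 / x \<le> 2 / (q :: real)"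
  by (simp add: field_simps)

text \<open>Integration over a length of order 1/j leaves j^(-\<sigma>-1) / (1 + (k/j)^2). Giving up
  part of the quadratic decay in k, as j^r (1 + |k|)^(-r), balances the two indices and yields a
  product of two convergent series.\<close>

lemma eis_term_bound:
  assumes "Re \<nu> > 1"
  obtains K r where "r > 1" "\<And>j k. norm (eis_term \<nu> j k) \<le> K * ((1 + real_of_int \<bar>j\<bar>) powr (- r) * (1 + real_of_int \<bar>k\<bar>) powr (- r))" "K \<ge> 0"
proof -
  define \<sigma> where "\<sigma> = Re \<nu>"
  \<comment> \<open>r \<le> 2 is the decay available in k, 2r \<le> \<sigma> + 1 leaves the exponent
    r - \<sigma> - 1 \<le> -r in j, and both allow r > 1 since \<sigma> > 1.\<close>
  define r where "r = min 2 ((1 + \<sigma>) / 2)"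
  have r: "r > 1" "r \<le> 2" "r \<le> \<sigma> + 1 - r" using assms by (auto simp: r_def \<sigma>_def min_def field_simps)
  define C where "C = Wig_const"
  have C0: "C \<ge> 0" using Wig_const(1) by (simp add: C_def)
  define K where "K = 3 powr \<sigma> * (C * 2 * 2 powr r)"
  have K: "K \<ge> 0" using C0 by (simp add: K_def)
  show ?thesis
  proof (rule that[OF r(1) _ K])
    fix j k :: int
    show "norm (eis_term \<nu> j k) \<le> K * ((1 + real_of_int \<bar>j\<bar>) powr (- r) * (1 + real_of_int \<bar>k\<bar>) powr (- r))"
    proof (cases "j < 1")
      case True
      then show ?thesis using K by (simp add: eis_term_zero)
    next
      case False
      define a b where "a = real_of_int j" and "b = real_of_int \<bar>k\<bar>"
      have a: "a \<ge> 1" using False by (simp add: a_def)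
      have b: "b \<ge> 0" by (simp add: b_def)
      let ?I = "{15 / 8 / a..17 / 8 / a}"
      let ?c = "(3 / a) powr \<sigma> * (C / (1 + (b / a)\<^sup>2))"
      have "norm (eis_term \<nu> j k) \<le> (LINT t|lborel. norm (integrand \<nu> j k t))"
        unfolding eis_term_eq by (rule integral_norm_bound)
      also have "\<dots> \<le> (LINT t|lborel. majorant \<nu> j k t)"
        using False assms
        by (intro integral_mono integrable_norm integrand_integrable majorant_integrable integrand_bound) auto
      also have "\<dots> = (LINT t|lborel. indicator ?I t * ?c)"
        by (simp add: majorant_def a_def b_def C_def \<sigma>_def power_divide)
      also have "\<dots> = (1 / 4 / a) * ?c"
        using a by (simp add: field_simps)
      also have "\<dots> \<le> (1 / a) * ((3 / a) powr \<sigma> * (C * (2 * (a powr r * (1 + b) powr (- r)))))"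
      proof (intro mult_mono order_refl)
        have "((1 + b) / a) powr r \<le> (1 + b / a) powr r"
          using a b r by (intro powr_mono2) (auto simp: field_simps)
        also have "\<dots> \<le> (1 + b / a) powr 2"
          using a b r by (intro powr_mono) auto
        also have "\<dots> = (1 + b / a)\<^sup>2"
          using a b by (simp add: powr_numeral add_nonneg_nonneg)
        also have "\<dots> \<le> 2 * (1 + (b / a)\<^sup>2)"
          by (rule one_plus_square_le)
        finally have "((1 + b) / a) powr r \<le> 2 * (1 + (b / a)\<^sup>2)" .
        moreover have "((1 + b) / a) powr r > 0" using a b by auto
        ultimately have "1 / (1 + (b / a)\<^sup>2) \<le> 2 / ((1 + b) / a) powr r"
          by (intro inverse_le_of_le_double) (auto simp: add_pos_nonneg)
        also have "\<dots> = 2 * (a powr r * (1 + b) powr (- r))"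
          using a b by (subst powr_divide) (auto simp: powr_minus_divide)
        finally have "1 / (1 + (b / a)\<^sup>2) \<le> 2 * (a powr r * (1 + b) powr (- r))" .
        from mult_left_mono[OF this C0]
        show "C / (1 + (b / a)\<^sup>2) \<le> C * (2 * (a powr r * (1 + b) powr (- r)))"
          by simp
        show "1 / 4 / a \<le> 1 / a"
          by (rule divide_right_mono) (use a in auto)
      qed (use a b C0 in auto)
      also have "\<dots> = 3 powr \<sigma> * (C * 2) * (a powr (- 1) * (a powr (- \<sigma>) * a powr r)) * (1 + b) powr (- r)"
      proof -
        have "1 / a = a powr (- 1)" "(3 / a) powr \<sigma> = 3 powr \<sigma> * a powr (- \<sigma>)"
          using a powr_divide[of 3 a \<sigma>] by (simp_all add: powr_minus_divide)
        then show ?thesis by (simp only: mult.assoc mult.left_commute mult.commute)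
      qed
      also have "a powr (- 1) * (a powr (- \<sigma>) * a powr r) = a powr (r - \<sigma> - 1)"
        by (subst powr_add[symmetric])+ (simp add: algebra_simps)
      also have "3 powr \<sigma> * (C * 2) * a powr (r - \<sigma> - 1) * (1 + b) powr (- r)
          \<le> 3 powr \<sigma> * (C * 2) * (2 powr r * (1 + a) powr (- r)) * (1 + b) powr (- r)"
      proof (intro mult_right_mono mult_left_mono)
        have "a powr (r - \<sigma> - 1) \<le> a powr (- r)"
          using a r by (intro powr_mono) auto
        \<comment> \<open>Prepares the comparison 1 + a \<le> 2 a, valid because a \<ge> 1.\<close>
        also have "\<dots> = 2 powr r * (2 * a) powr (- r)"
          using a by (simp add: powr_mult powr_minus)
        also have "\<dots> \<le> 2 powr r * (1 + a) powr (- r)"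
          using a r by (intro mult_left_mono powr_mono2') auto
        finally show "a powr (r - \<sigma> - 1) \<le> 2 powr r * (1 + a) powr (- r)" .
      qed (use C0 in auto)
      finally show ?thesis
        using a by (simp add: K_def a_def b_def mult_ac)
    qed
  qed
qed

lemma eis_term_abs_summable:
  assumes "Re \<nu> > 1"
  shows "(\<lambda>(j, k). eis_term \<nu> j k) summable_on UNIV"
proof -
  obtain K r where Kr: "r > 1" "\<And>j k. norm (eis_term \<nu> j k) \<le> K * ((1 + real_of_int \<bar>j\<bar>) powr (- r) * (1 + real_of_int \<bar>k\<bar>) powr (- r))" "K \<ge> 0"
    by (rule eis_term_bound[OF assms]) (rule that)
  let ?f = "\<lambda>k::int. (1 + real_of_int \<bar>k\<bar>) powr (- r)"
  have "(\<lambda>x. norm ((\<lambda>(j, k). ?f j * ?f k) x)) summable_on UNIV \<times> UNIV"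
  proof (subst Infinite_Sum.abs_summable_on_Sigma_iff, intro conjI ballI)
    fix j :: int
    show "(\<lambda>k. norm ((\<lambda>(j, k). ?f j * ?f k) (j, k))) summable_on UNIV"
      using summable_on_cmult_right[OF summable_on_int_powr[OF Kr(1)], of "?f j"] by simp
  next
    show "(\<lambda>j. norm (\<Sum>\<^sub>\<infinity>k. norm ((\<lambda>(j, k). ?f j * ?f k) (j, k)))) summable_on UNIV"
      using summable_on_cmult_left[OF summable_on_int_powr[OF Kr(1)], of "\<bar>infsum ?f UNIV\<bar>"]
      by (simp add: infsum_cmult_right' abs_mult)
  qed
  then have "(\<lambda>(j, k). K * (?f j * ?f k)) summable_on UNIV"
    using summable_on_cmult_right[of "\<lambda>(j, k). ?f j * ?f k" UNIV K] by (simp add: case_prod_unfold)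
  then have "(\<lambda>x. norm ((\<lambda>(j, k). eis_term \<nu> j k) x)) summable_on UNIV"
    by (rule summable_on_comparison_test) (use Kr in auto)
  then show ?thesis by (rule abs_summable_summable)
qed

text \<open>Dominated convergence exchanges the sum over k with the integral over t: for fixed j the
  partial sums are bounded by a constant on a fixed interval, and the pointwise limit is given by
  Poisson summation.\<close>

lemma eis_term_row_sum:
  assumes \<nu>: "Re \<nu> > 1" and j: "j \<ge> 1"
  shows "(\<lambda>N. \<Sum>k\<in>{- int N..int N}. eis_term \<nu> j k) \<longlonglongrightarrow> (if j = 1 then mellin \<nu> else 0)"
proof -
  define C where "C = Wig_const"
  have C0: "C \<ge> 0" using Wig_const(1) by (simp add: C_def)
  let ?h = "integrand \<nu> j"
  let ?I = "{15 / 8 / real_of_int j..17 / 8 / real_of_int j}"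
  let ?q = "\<lambda>k::int. C / (1 + (real_of_int k / real_of_int j)\<^sup>2)"
  have qs: "?q summable_on UNIV"
  proof (rule summable_on_comparison_test)
    show "(\<lambda>k. (C * 2 * (real_of_int j)\<^sup>2) * (1 + real_of_int \<bar>k\<bar>) powr (- 2)) summable_on UNIV"
      by (intro summable_on_cmult_right summable_on_int_powr) simp
    fix k :: int
    define a b where "a = real_of_int j" and "b = real_of_int \<bar>k\<bar>"
    have a: "a \<ge> 1" and b: "b \<ge> 0" using j by (auto simp: a_def b_def)
    have "(1 + b)\<^sup>2 \<le> 2 * (1\<^sup>2 + b\<^sup>2)"
      using sum_squares_bound[of 1 b] by (simp add: power2_eq_square algebra_simps)
    also have "\<dots> \<le> 2 * (a\<^sup>2 + b\<^sup>2)"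
      using power_mono[OF a, of 2] by simp
    also have "\<dots> = 2 * a\<^sup>2 * (1 + (b / a)\<^sup>2)"
      using a by (simp add: power_divide field_simps)
    finally have *: "(1 + b)\<^sup>2 \<le> 2 * a\<^sup>2 * (1 + (b / a)\<^sup>2)" .
    have "1 / (1 + (b / a)\<^sup>2) \<le> 2 * a\<^sup>2 / (1 + b)\<^sup>2"
      using * b by (simp add: divide_le_eq le_divide_eq add_pos_nonneg mult_ac)
    from mult_left_mono[OF this C0]
    show "?q k \<le> (C * 2 * (real_of_int j)\<^sup>2) * (1 + real_of_int \<bar>k\<bar>) powr (- 2)"
      using b by (simp add: a_def b_def power_divide powr_minus_divide powr_numeral mult_ac)
    show "0 \<le> ?q k" using C0 by (simp add: add_nonneg_nonneg)
  qed
  have fin: "(\<Sum>k\<in>F. ?q k) \<le> infsum ?q UNIV" if "finite F" for F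
    by (rule finite_sum_le_infsum[OF qs that]) (use C0 in \<open>auto simp: add_nonneg_nonneg\<close>)
  let ?D = "(3 / real_of_int j) powr Re \<nu> * infsum ?q UNIV"
  let ?lim = "\<lambda>t. indicator {0<..} t *\<^sub>R (of_real t powr \<nu> * (if j = 1 then of_real (1 / t) * \<phi> t else 0))"
  have "(\<lambda>N. LINT t|lborel. (\<Sum>k\<in>{- int N..int N}. ?h k t)) \<longlonglongrightarrow> (LINT t|lborel. ?lim t)"
  proof (rule integral_dominated_convergence)
    show "?lim \<in> borel_measurable lborel"
      unfolding \<phi>_def by measurable
    show "(\<lambda>t. \<Sum>k\<in>{- int N..int N}. ?h k t) \<in> borel_measurable lborel" for N
      unfolding integrand_def by measurable
    show "integrable lborel (\<lambda>t. indicator ?I t * ?D :: real)"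
      by (intro integrable_mult_left integrable_real_indicator) (auto simp: emeasure_lborel_Icc_eq)
    show "AE t in lborel. (\<lambda>N. \<Sum>k\<in>{- int N..int N}. ?h k t) \<longlonglongrightarrow> ?lim t"
    proof (intro always_eventually allI)
      fix t :: real
      show "(\<lambda>N. \<Sum>k\<in>{- int N..int N}. ?h k t) \<longlonglongrightarrow> ?lim t"
      proof (cases "t > 0")
        case True
        from tendsto_mult_left[OF Wig_sums_tendsto[OF this j], of "of_real t powr \<nu>"] True show ?thesis
          by (simp add: integrand_def sum_distrib_left)
      qed (simp add: integrand_def)
    qed
    show "AE t in lborel. norm (\<Sum>k\<in>{- int N..int N}. ?h k t) \<le> indicator ?I t * ?D" for N
    proof (intro always_eventually allI)
      fix t :: real
      have "norm (\<Sum>k\<in>{- int N..int N}. ?h k t) \<le> (\<Sum>k\<in>{- int N..int N}. indicator ?I t * ((3 / real_of_int j) powr Re \<nu> * ?q k))"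
        by (rule sum_norm_le, rule order_trans[OF integrand_bound]) (use j \<nu> in \<open>auto simp: majorant_def C_def\<close>)
      also have "\<dots> = indicator ?I t * ((3 / real_of_int j) powr Re \<nu> * (\<Sum>k\<in>{- int N..int N}. ?q k))"
        by (simp only: sum_distrib_left)
      also have "\<dots> \<le> indicator ?I t * ?D"
        by (intro mult_left_mono fin) auto
      finally show "norm (\<Sum>k\<in>{- int N..int N}. ?h k t) \<le> indicator ?I t * ?D" .
    qed
  qed
  moreover have "(LINT t|lborel. (\<Sum>k\<in>{- int N..int N}. ?h k t)) = (\<Sum>k\<in>{- int N..int N}. eis_term \<nu> j k)" for N
    unfolding eis_term_eq
    by (rule Bochner_Integration.integral_sum) (use integrand_integrable j \<nu> in auto)
  moreover have "(LINT t|lborel. ?lim t) = (if j = 1 then mellin \<nu> else 0)"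
  proof (cases "j = 1")
    case True
    have "(LINT t|lborel. ?lim t) = integral {1..3} ?lim"
    proof (rule lborel_integral_eq_integral)
      have "continuous_on {1..3} (\<lambda>t. of_real t powr \<nu> * (of_real (1 / t) * \<phi> t))"
        by (auto intro!: continuous_intros \<phi>_cont simp: complex_nonpos_Reals_iff)
      then show "continuous_on {1..3} ?lim"
        by (rule continuous_on_eq) (use True in auto)
      fix t :: real assume "t \<notin> {1..3}"
      then have "t > 0 \<Longrightarrow> \<phi> t = 0"
        using \<phi>_nonzero[of t] by fastforce
      then show "?lim t = 0" by (auto simp: indicator_def)
    qed
    also have "\<dots> = integral {1..3} (\<lambda>t. of_real t powr (\<nu> - 1) * \<phi> t)"
      by (rule Henstock_Kurzweil_Integration.integral_cong) (use True in \<open>auto simp: powr_diff\<close>)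
    finally show ?thesis using True by (simp add: mellin_def)
  qed auto
  ultimately show ?thesis by simp
qed

text \<open>Absolute summability permits summation row by row, and only the row j = 1 is
  nonzero.\<close>

lemma eisenstein_series_eq_mellin:
  assumes "Re \<nu> > 1"
  shows "eisenstein_series \<nu> (Wig v u) = mellin \<nu>"
proof -
  note s = eis_term_abs_summable[OF assms]
  have row: "(\<Sum>\<^sub>\<infinity>k. eis_term \<nu> j k) = (if j = 1 then mellin \<nu> else 0)" for j
  proof (cases "j \<ge> 1")
    case True
    have "(\<lambda>k. eis_term \<nu> j k) summable_on UNIV"
      using summable_on_SigmaD1[of "\<lambda>j k. eis_term \<nu> j k" UNIV "\<lambda>_. UNIV" j] s by simp
    from LIMSEQ_unique[OF sums_symmetric_intervals[OF this] eis_term_row_sum[OF assms True]]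
    show ?thesis .
  next
    case False
    then show ?thesis by (simp add: eis_term_zero)
  qed
  have "eisenstein_series \<nu> (Wig v u) = infsum (\<lambda>(j, k). eis_term \<nu> j k) (UNIV - {(0, 0)})"
    unfolding eisenstein_series_def eis_term_def ..
  also have "\<dots> = infsum (\<lambda>(j, k). eis_term \<nu> j k) (UNIV \<times> UNIV)"
    by (rule infsum_cong_neutral) (auto simp: eis_term_zero)
  also have "\<dots> = (\<Sum>\<^sub>\<infinity>j. \<Sum>\<^sub>\<infinity>k. eis_term \<nu> j k)"
    by (rule infsum_Sigma'_banach[symmetric]) (use s in simp)
  also have "\<dots> = (\<Sum>\<^sub>\<infinity>j::int. if j = 1 then mellin \<nu> else 0)"
    by (simp add: row)
  also have "\<dots> = (\<Sum>\<^sub>\<infinity>j\<in>{1::int}. mellin \<nu>)"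
    by (rule infsum_cong_neutral) auto
  finally show ?thesis by simp
qed

text \<open>The Mellin transform is entire and continues the series, so it is the continuation; for
  a bump pair the pairing thus has removable singularities at 1 and -1.\<close>

lemma eisenstein_eq_mellin:
  assumes "\<nu> \<noteq> 1" "\<nu> \<noteq> -1"
  shows "eisenstein \<nu> (Wig v u) = mellin \<nu>"
  by (rule eisenstein_eqI)
     (use assms eisenstein_series_eq_mellin in \<open>auto intro: holomorphic_on_subset[OF mellin_holomorphic]\<close>)

end

section \<open>Integrals over vertical lines\<close>

lemma integrable_Cauchy_kernel: "integrable lborel (\<lambda>y::real. 1 / (1 + y\<^sup>2))"
  using integrable_inverse_1_plus_square
  by (simp add: set_integrable_def einterval_def inverse_eq_divide)

text \<open>The mass of 1/(1 + y^2) outside [-n, n]. It depends on no integrand, so it controls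
  truncation errors uniformly in a parameter.\<close>

definition Cauchy_tail :: "nat \<Rightarrow> real" where
  "Cauchy_tail n = (LINT y|lborel. (1 - indicator {- real n..real n} y) * (1 / (1 + y\<^sup>2)))"

lemma
  fixes f :: "real \<Rightarrow> complex"
  assumes f: "continuous_on UNIV f" and B: "\<And>y. norm (f y) \<le> B / (1 + y\<^sup>2)"
  shows integrable_of_decay: "integrable lborel f"
    and integral_tail_bound: "norm ((LINT y|lborel. f y) - integral {- real n..real n} f)
      \<le> B * Cauchy_tail n"
proof -
  have m [measurable]: "f \<in> borel_measurable borel"
    using f by (rule borel_measurable_continuous_onI)
  have iB: "integrable lborel (\<lambda>y. B * (1 / (1 + y\<^sup>2)))"
    by (intro integrable_mult_right integrable_Cauchy_kernel)
  show i: "integrable lborel f"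
  proof (rule Bochner_Integration.integrable_bound[OF iB])
    show "AE y in lborel. norm (f y) \<le> norm (B * (1 / (1 + y\<^sup>2)))"
      using order_trans[OF B abs_ge_self] by (intro always_eventually allI) simp
  qed simp
  let ?I = "{- real n..real n}"
  have c: "continuous_on ?I f" using f continuous_on_subset by blast
  have 1: "integral ?I f = (LINT y|lborel. indicator ?I y *\<^sub>R f y)"
    using set_borel_integral_eq_integral(2)[OF borel_integrable_atLeastAtMost'[OF c]]
    by (simp add: set_lebesgue_integral_def)
  have i2: "integrable lborel (\<lambda>y. indicator ?I y *\<^sub>R f y)"
    using borel_integrable_atLeastAtMost'[OF c] by (simp add: set_integrable_def)
  have i3: "integrable lborel (\<lambda>y. (1 - indicator ?I y) *\<^sub>R f y)"
    using Bochner_Integration.integrable_diff[OF i i2] by (simp add: algebra_simps)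
  have "(LINT y|lborel. f y) - integral ?I f = (LINT y|lborel. (1 - indicator ?I y) *\<^sub>R f y)"
    unfolding 1 by (subst Bochner_Integration.integral_diff[OF i i2, symmetric]) (simp add: algebra_simps)
  also have "norm \<dots> \<le> (LINT y|lborel. norm ((1 - indicator ?I y) *\<^sub>R f y))"
    by (rule integral_norm_bound)
  also have "\<dots> \<le> (LINT y|lborel. B * ((1 - indicator ?I y) * (1 / (1 + y\<^sup>2))))"
  proof (rule integral_mono)
    show "integrable lborel (\<lambda>y. norm ((1 - indicator ?I y) *\<^sub>R f y))"
      by (intro integrable_norm i3)
    have "integrable lborel (\<lambda>y. indicator ?I y *\<^sub>R (1 / (1 + y\<^sup>2)) :: real)"
      by (rule integrable_mult_indicator[OF _ integrable_Cauchy_kernel]) simp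
    from Bochner_Integration.integrable_diff[OF integrable_Cauchy_kernel this]
    have "integrable lborel (\<lambda>y. (1 - indicator ?I y) * (1 / (1 + y\<^sup>2)) :: real)"
      by (simp add: algebra_simps diff_divide_distrib)
    then show "integrable lborel (\<lambda>y. B * ((1 - indicator ?I y) * (1 / (1 + y\<^sup>2))))"
      by (rule integrable_mult_right)
    show "norm ((1 - indicator ?I y) *\<^sub>R f y) \<le> B * ((1 - indicator ?I y) * (1 / (1 + y\<^sup>2)))" for y
      using B[of y] by (auto simp: indicator_def)
  qed
  also have "\<dots> = B * Cauchy_tail n"
    unfolding Cauchy_tail_def by (rule integral_mult_right_zero)
  finally show "norm ((LINT y|lborel. f y) - integral ?I f)
      \<le> B * Cauchy_tail n" .
qed

lemma Cauchy_tail_tendsto: "Cauchy_tail \<longlonglongrightarrow> 0"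
proof -
  have "(\<lambda>n. LINT y|lborel. (1 - indicator {- real n..real n} y) * (1 / (1 + y\<^sup>2))) \<longlonglongrightarrow> (LINT y::real|lborel. 0)"
  proof (rule integral_dominated_convergence[OF _ _ integrable_Cauchy_kernel])
    show "AE y in lborel. (\<lambda>n. (1 - indicator {- real n..real n} y) * (1 / (1 + y\<^sup>2))) \<longlonglongrightarrow> 0"
    proof (intro always_eventually allI)
      fix y :: real
      have "\<forall>\<^sub>F n in sequentially. 0 = (1 - indicator {- real n..real n} y) * (1 / (1 + y\<^sup>2))"
        using eventually_ge_at_top[of "nat \<lceil>\<bar>y\<bar>\<rceil>"]
      proof eventually_elim
        case (elim n)
        then have "y \<in> {- real n..real n}" by (auto simp: abs_if split: if_splits)
        then show ?case by simp
      qed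
      then show "(\<lambda>n. (1 - indicator {- real n..real n} y) * (1 / (1 + y\<^sup>2))) \<longlonglongrightarrow> 0"
        by (rule Lim_transform_eventually[OF tendsto_const])
    qed
    show "AE y in lborel. norm ((1 - indicator {- real n..real n} y) * (1 / (1 + y\<^sup>2))) \<le> 1 / (1 + y\<^sup>2)" for n
      by (intro always_eventually allI) (auto simp: indicator_def add_nonneg_nonneg)
  qed auto
  then show ?thesis by (simp add: Cauchy_tail_def[abs_def])
qed

lemma integral_symmetric_tendsto:
  fixes f :: "real \<Rightarrow> complex"
  assumes "continuous_on UNIV f" "\<And>y. norm (f y) \<le> B / (1 + y\<^sup>2)"
  shows "(\<lambda>n. integral {- real n..real n} f) \<longlonglongrightarrow> (LINT y|lborel. f y)"
proof -
  have "(\<lambda>n. (LINT y|lborel. f y) - integral {- real n..real n} f) \<longlonglongrightarrow> 0"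
  proof (rule tendsto_norm_zero_cancel, rule tendsto_sandwich[OF _ _ tendsto_const])
    show "(\<lambda>n. B * Cauchy_tail n) \<longlonglongrightarrow> 0"
      using tendsto_mult_left[OF Cauchy_tail_tendsto, of B] by simp
  qed (use integral_tail_bound[OF assms] in auto)
  from tendsto_diff[OF tendsto_const this, of "LINT y|lborel. f y"] show ?thesis
    by simp
qed

text \<open>Integrals over [-n, n] are holomorphic in s, and the common majorant makes their
  convergence uniform on U.\<close>

lemma line_convolution_holomorphic:
  fixes A :: "complex \<Rightarrow> complex" and N :: "real \<Rightarrow> complex"
  assumes A: "A holomorphic_on \<Omega>" "open \<Omega>" and N: "continuous_on UNIV N"
    and U: "open U" "convex U" and mem: "\<And>s y. s \<in> U \<Longrightarrow> s - Complex c y \<in> \<Omega>"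
    and bound: "\<And>s y. s \<in> U \<Longrightarrow> norm (A (s - Complex c y) * N y) \<le> B / (1 + y\<^sup>2)"
  shows "(\<lambda>s. LINT y|lborel. A (s - Complex c y) * N y) holomorphic_on U"
proof (rule holomorphic_uniform_sequence[OF U(1)])
  let ?F = "\<lambda>s y. A (s - Complex c y) * N y"
  have cA: "continuous_on \<Omega> A" and cA': "continuous_on \<Omega> (deriv A)"
    using A by (auto intro: holomorphic_on_imp_continuous_on holomorphic_deriv)
  have cC: "continuous_on S (\<lambda>x. Complex c (h x))" if "continuous_on S h" for S :: "'a::topological_space set" and h
    unfolding Complex_eq using that by (intro continuous_intros)
  have cont: "continuous_on UNIV (?F s)" if "s \<in> U" for s
    by (intro continuous_intros N continuous_on_compose2[OF cA] cC) (use mem that in auto)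
  show "(\<lambda>s. integral {- real n..real n} (?F s)) holomorphic_on U" for n
  proof -
    have "(\<lambda>s. integral (cbox (- real n) (real n)) (?F s)) holomorphic_on U"
    proof (rule leibniz_rule_holomorphic[OF _ _ _ U(2)])
      fix s t assume s: "s \<in> U"
      have "(A has_field_derivative deriv A (s - Complex c t)) (at (s - Complex c t))"
        using holomorphic_derivI[OF A mem[OF s]] by simp
      moreover have "((\<lambda>s. s - Complex c t) has_field_derivative 1) (at s within U)"
        by (auto intro!: derivative_eq_intros)
      ultimately have "((\<lambda>s. A (s - Complex c t)) has_field_derivative deriv A (s - Complex c t) * 1) (at s within U)"
        by (rule DERIV_chain2)
      from DERIV_cmult_right[OF this, of "N t"]
      show "((\<lambda>s. ?F s t) has_field_derivative deriv A (s - Complex c t) * N t) (at s within U)"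
        by simp
    next
      fix s assume "s \<in> U"
      then show "?F s integrable_on cbox (- real n) (real n)"
        by (intro integrable_continuous continuous_on_subset[OF cont]) auto
    next
      show "continuous_on (U \<times> cbox (- real n) (real n)) (\<lambda>(s, t). deriv A (s - Complex c t) * N t)"
        unfolding split_beta
        by (intro continuous_intros continuous_on_compose2[OF N] continuous_on_compose2[OF cA'] cC)
           (use mem in auto)
    qed
    then show ?thesis by simp
  qed
  fix s assume "s \<in> U"
  then obtain d where d: "d > 0" "cball s d \<subseteq> U"
    using U(1) open_contains_cball by blast
  have "uniform_limit (cball s d) (\<lambda>n s. integral {- real n..real n} (?F s)) (\<lambda>s. LINT y|lborel. ?F s y) sequentially"
  proof (rule uniform_limitI)
    fix e :: real assume "e > 0"
    have "(\<lambda>n. B * Cauchy_tail n) \<longlonglongrightarrow> 0"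
      using tendsto_mult_left[OF Cauchy_tail_tendsto, of B] by simp
    then have "\<forall>\<^sub>F n in sequentially. B * Cauchy_tail n < e"
      using \<open>e > 0\<close> by (rule order_tendstoD)
    then show "\<forall>\<^sub>F n in sequentially. \<forall>x\<in>cball s d. dist (integral {- real n..real n} (?F x)) (LINT y|lborel. ?F x y) < e"
    proof eventually_elim
      case (elim n)
      show ?case
      proof
        fix x assume "x \<in> cball s d"
        then have x: "x \<in> U" using d by auto
        show "dist (integral {- real n..real n} (?F x)) (LINT y|lborel. ?F x y) < e"
          using integral_tail_bound[OF cont[OF x] bound[OF x], of n] elim
          by (simp add: dist_norm norm_minus_commute)
      qed
    qed
  qed
  with d show "\<exists>d. 0 < d \<and> cball s d \<subseteq> U \<and>
      uniform_limit (cball s d) (\<lambda>n s. integral {- real n..real n} (?F s)) (\<lambda>s. LINT y|lborel. ?F s y) sequentially"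
    by blast
qed

lemma contour_integral_vertical_tendsto:
  assumes "continuous_on UNIV (\<lambda>y. f (Complex c y))" "\<And>y. norm (f (Complex c y)) \<le> B / (1 + y\<^sup>2)"
  shows "(\<lambda>n. contour_integral (linepath (Complex c (- real n)) (Complex c (real n))) f)
           \<longlonglongrightarrow> \<i> * (LINT y|lborel. f (Complex c y))"
proof (rule Lim_transform_eventually)
  show "(\<lambda>n. \<i> * integral {- real n..real n} (\<lambda>y. f (Complex c y))) \<longlonglongrightarrow> \<i> * (LINT y|lborel. f (Complex c y))"
    by (intro tendsto_intros integral_symmetric_tendsto[OF assms])
  show "\<forall>\<^sub>F n in sequentially. \<i> * integral {- real n..real n} (\<lambda>y. f (Complex c y)) =
      contour_integral (linepath (Complex c (- real n)) (Complex c (real n))) f"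
    using eventually_gt_at_top[of 0]
  proof eventually_elim
    case (elim n)
    then show ?case by (subst contour_integral_linepath_same_Re[where c = c and a = "- real n" and b = "real n"]) auto
  qed
qed

text \<open>Cauchy's formula on rectangles of growing height; the horizontal sides disappear through
  the decay of H. Holomorphy is asked on the closed strip only, because in the application the left
  side is Re \<nu> = 1, to the left of which zeros of \<zeta> are not excluded.\<close>

lemma Cauchy_integral_formula_strip:
  fixes H :: "complex \<Rightarrow> complex"
  assumes H: "H holomorphic_on {\<nu>. a \<le> Re \<nu> \<and> Re \<nu> \<le> b}" and z: "a < Re z" "Re z < b"
    and B: "\<And>\<nu>. a \<le> Re \<nu> \<Longrightarrow> Re \<nu> \<le> b \<Longrightarrow> norm (H \<nu>) \<le> B / (1 + (Im \<nu>)\<^sup>2)"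
  shows "2 * pi * \<i> * H z = \<i> * (LINT y|lborel. H (Complex b y) / (Complex b y - z))
            - \<i> * (LINT y|lborel. H (Complex a y) / (Complex a y - z))"
proof -
  define S where "S = {\<nu>. a \<le> Re \<nu> \<and> Re \<nu> \<le> b}"
  let ?f = "\<lambda>\<nu>. H \<nu> / (\<nu> - z)"
  have B0: "B \<ge> 0"
    using order_trans[OF norm_ge_zero B[of z]] z by (auto simp: zero_le_divide_iff add_nonneg_nonneg)
      (smt (verit) zero_le_power2)
  have cH: "continuous_on S H" using H unfolding S_def by (rule holomorphic_on_imp_continuous_on)
  have cvx: "convex S"
    unfolding S_def using convex_Int[OF convex_halfspace_Re_ge convex_halfspace_Re_le]
    by (simp add: Int_def)
  have vert: "(\<lambda>n. contour_integral (linepath (Complex c (- real n)) (Complex c (real n))) ?f)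
           \<longlonglongrightarrow> \<i> * (LINT y|lborel. ?f (Complex c y))" if c: "c = a \<or> c = b" for c
  proof (rule contour_integral_vertical_tendsto[where B = "B / \<bar>c - Re z\<bar>"])
    have nz: "Complex c y - z \<noteq> 0" for y using c z by (auto simp: complex_eq_iff)
    have d: "\<bar>c - Re z\<bar> > 0" using c z by auto
    show "continuous_on UNIV (\<lambda>y. ?f (Complex c y))"
      unfolding Complex_eq
      by (intro continuous_intros continuous_on_compose2[OF cH])
         (use nz c z in \<open>auto simp: S_def simp flip: Complex_eq\<close>)
    fix y
    have "\<bar>c - Re z\<bar> \<le> norm (Complex c y - z)"
      using abs_Re_le_cmod[of "Complex c y - z"] by simp
    moreover have "norm (H (Complex c y)) \<le> B / (1 + y\<^sup>2)"
      using B[of "Complex c y"] c z by auto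
    ultimately have "norm (H (Complex c y)) / norm (Complex c y - z) \<le> (B / (1 + y\<^sup>2)) / \<bar>c - Re z\<bar>"
      using d B0 by (intro frac_le divide_nonneg_nonneg) (auto simp: add_nonneg_nonneg)
    then show "norm (?f (Complex c y)) \<le> B / \<bar>c - Re z\<bar> / (1 + y\<^sup>2)"
      by (simp add: norm_divide mult.commute)
  qed
  have horiz: "(\<lambda>n. contour_integral (linepath (Complex a (\<sigma> * real n)) (Complex b (\<sigma> * real n))) ?f) \<longlonglongrightarrow> 0"
    if \<sigma>: "\<sigma> = 1 \<or> \<sigma> = -1" for \<sigma> :: real
  proof (rule Lim_null_comparison)
    show "(\<lambda>n. B / (1 + (real n)\<^sup>2) * (b - a)) \<longlonglongrightarrow> 0"
      by real_asymp
    show "\<forall>\<^sub>F n in sequentially. norm (contour_integral (linepath (Complex a (\<sigma> * real n)) (Complex b (\<sigma> * real n))) ?f)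
        \<le> B / (1 + (real n)\<^sup>2) * (b - a)"
      using eventually_gt_at_top[of "nat \<lceil>\<bar>Im z\<bar> + 1\<rceil>"]
    proof eventually_elim
      case (elim n)
      have n: "real n > \<bar>Im z\<bar> + 1" using elim by linarith
      have seg: "Im \<nu> = \<sigma> * real n \<and> \<nu> \<in> S" if "\<nu> \<in> closed_segment (Complex a (\<sigma> * real n)) (Complex b (\<sigma> * real n))" for \<nu>
      proof -
        from that have "\<nu> \<in> S"
          using closed_segment_subset[OF _ _ cvx] z by (force simp: S_def)
        moreover from that have "Im \<nu> = \<sigma> * real n"
          by (simp add: closed_segment_same_Im)
        ultimately show ?thesis by simp
      qed
      have dist: "norm (\<nu> - z) \<ge> 1" if "\<nu> \<in> closed_segment (Complex a (\<sigma> * real n)) (Complex b (\<sigma> * real n))" for \<nu>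
      proof -
        have "1 \<le> \<bar>Im \<nu> - Im z\<bar>" using seg[OF that] n \<sigma> by auto
        also have "\<dots> \<le> norm (\<nu> - z)" using abs_Im_le_cmod[of "\<nu> - z"] by simp
        finally show ?thesis .
      qed
      have "norm (contour_integral (linepath (Complex a (\<sigma> * real n)) (Complex b (\<sigma> * real n))) ?f)
          \<le> B / (1 + (real n)\<^sup>2) * norm (Complex b (\<sigma> * real n) - Complex a (\<sigma> * real n))"
      proof (rule contour_integral_bound_linepath)
        show "?f contour_integrable_on linepath (Complex a (\<sigma> * real n)) (Complex b (\<sigma> * real n))"
          using seg dist by (intro contour_integrable_continuous_linepath continuous_intros continuous_on_subset[OF cH]) fastforce+
        show "0 \<le> B / (1 + (real n)\<^sup>2)" using B0 by (simp add: add_nonneg_nonneg)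
        fix \<nu> assume \<nu>: "\<nu> \<in> closed_segment (Complex a (\<sigma> * real n)) (Complex b (\<sigma> * real n))"
        have "norm (?f \<nu>) \<le> (B / (1 + (Im \<nu>)\<^sup>2)) / 1"
          unfolding norm_divide using B[of \<nu>] seg[OF \<nu>] dist[OF \<nu>] B0 by (intro frac_le) (auto simp: S_def add_nonneg_nonneg)
        then show "norm (?f \<nu>) \<le> B / (1 + (real n)\<^sup>2)"
          using seg[OF \<nu>] \<sigma> by auto
      qed
      also have "norm (Complex b (\<sigma> * real n) - Complex a (\<sigma> * real n)) = b - a"
        using z by (simp add: cmod_def)
      finally show ?case .
    qed
  qed
  let ?P = "\<lambda>n. contour_integral (linepath (Complex a (- real n)) (Complex b (- real n))) ?f
      + contour_integral (linepath (Complex b (- real n)) (Complex b (real n))) ?f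
      - contour_integral (linepath (Complex a (real n)) (Complex b (real n))) ?f
      - contour_integral (linepath (Complex a (- real n)) (Complex a (real n))) ?f"
  have "?P \<longlonglongrightarrow> 0 + \<i> * (LINT y|lborel. ?f (Complex b y)) - 0 - \<i> * (LINT y|lborel. ?f (Complex a y))"
    using horiz[of 1] horiz[of "-1"] by (intro tendsto_intros vert) auto
  moreover have "?P \<longlonglongrightarrow> 2 * pi * \<i> * H z"
  proof (rule Lim_transform_eventually[OF tendsto_const])
    show "\<forall>\<^sub>F n in sequentially. 2 * pi * \<i> * H z = ?P n"
      using eventually_gt_at_top[of "nat \<lceil>\<bar>Im z\<bar>\<rceil>"]
    proof eventually_elim
      case (elim n)
      have n: "real n > \<bar>Im z\<bar>" using elim by linarith
      let ?p = "Complex a (- real n)" and ?q = "Complex b (real n)"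
      have box: "z \<in> box ?p ?q"
        using n z by (auto simp: in_box_complex_iff)
      have cb: "cbox ?p ?q \<subseteq> S" by (auto simp: in_cbox_complex_iff S_def)
      have pim: "path_image (rectpath ?p ?q) = cbox ?p ?q - box ?p ?q"
        by (rule path_image_rectpath_cbox_minus_box) (use z n in auto)
      have "(?f has_contour_integral (2 * pi * \<i> * winding_number (rectpath ?p ?q) z * H z)) (rectpath ?p ?q)"
      proof (rule Cauchy_integral_formula_convex_simple[OF cvx H[folded S_def]])
        show "z \<in> interior S"
          by (rule subsetD[OF interior_mono[OF cb]]) (use box in \<open>simp add: interior_cbox\<close>)
        show "path_image (rectpath ?p ?q) \<subseteq> S - {z}"
          using cb box unfolding pim by auto
      qed auto
      then have R: "contour_integral (rectpath ?p ?q) ?f = 2 * pi * \<i> * H z"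
        by (simp add: winding_number_rectpath[OF box] contour_integral_unique)
      have cf: "continuous_on (path_image (rectpath ?p ?q)) ?f"
        unfolding pim using cb box by (intro continuous_intros continuous_on_subset[OF cH]) auto
      let ?a2 = "Complex b (- real n)" and ?a4 = "Complex a (real n)"
      have sub: "closed_segment ?p ?a2 \<subseteq> path_image (rectpath ?p ?q)" "closed_segment ?a2 ?q \<subseteq> path_image (rectpath ?p ?q)"
        "closed_segment ?q ?a4 \<subseteq> path_image (rectpath ?p ?q)" "closed_segment ?a4 ?p \<subseteq> path_image (rectpath ?p ?q)"
        by (auto simp: rectpath_def Let_def path_image_join)
      note ci = contour_integrable_continuous_linepath[OF continuous_on_subset[OF cf]]
      have "contour_integral (rectpath ?p ?q) ?f = contour_integral (linepath ?p ?a2) ?f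
         + (contour_integral (linepath ?a2 ?q) ?f + (contour_integral (linepath ?q ?a4) ?f + contour_integral (linepath ?a4 ?p) ?f))"
        unfolding rectpath_def Let_def
        using ci[OF sub(1)] ci[OF sub(2)] ci[OF sub(3)] ci[OF sub(4)]
        by (simp add: contour_integral_join contour_integrable_join)
      also have "contour_integral (linepath ?q ?a4) ?f = - contour_integral (linepath ?a4 ?q) ?f"
        using contour_integral_reversepath[of "linepath ?q ?a4" ?f] by simp
      also have "contour_integral (linepath ?a4 ?p) ?f = - contour_integral (linepath ?p ?a4) ?f"
        using contour_integral_reversepath[of "linepath ?a4 ?p" ?f] by simp
      finally show ?case using R by simp
    qed
  qed
  ultimately show ?thesis
    using LIMSEQ_unique by fastforce
qed

section \<open>Moving the line of integration\<close>

lemma zeta_nonzero: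
  assumes "Re s > 1"
  shows "zeta s \<noteq> 0"
proof -
  have "s \<noteq> 1" using assms by auto
  then show ?thesis using Zf_nonzero[of s] assms by (auto simp: Zf_eq)
qed

lemma zeta_holomorphic: "zeta holomorphic_on - {1}"
proof -
  have "(\<lambda>s. Zf s / (s - 1)) holomorphic_on - {1}"
    by (intro holomorphic_intros holomorphic_on_subset[OF Zf_holomorphic]) auto
  then show ?thesis
    by (rule holomorphic_transform) (simp add: Zf_eq)
qed

lemma norm_two_powr: "norm (2 powr (w :: complex)) = 2 powr Re w"
  by (simp add: norm_powr_real_powr)

text \<open>
  Apart from the pole factor \<open>w - 1\<close>, the part of the integrand that depends on \<open>w = s - \<nu>\<close>.
\<close>
definition zeta_factor :: "complex \<Rightarrow> complex" where
  "zeta_factor w = Zf w / (zeta (2 * w) * (1 + 2 powr (- w)))"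

lemma norm_one_plus_two_powr:
  assumes "Re w \<ge> 1 / 2"
  shows "norm (1 + 2 powr (- w)) \<ge> 1 - 2 powr (- 1 / 2)"
proof -
  have "norm (2 powr (- w)) \<le> 2 powr (- 1 / 2)"
    unfolding norm_two_powr using assms by (intro powr_mono) auto
  then show ?thesis
    using norm_diff_ineq[of 1 "2 powr (- w)"] by simp
qed

lemma two_powr_half_less_1: "2 powr (- 1 / 2) < (1 :: real)"
  using powr_less_mono[of "- 1 / 2" 0 "2 :: real"] by simp

text \<open>Re w > 1/2 is what puts 2w into the half-plane where \<zeta> has neither zeros nor its
  pole; it also keeps |2^(-w)| below 1.\<close>

lemma zeta_factor_holomorphic: "zeta_factor holomorphic_on {w. Re w > 1 / 2}"
proof -
  have z: "(\<lambda>w. zeta (2 * w)) holomorphic_on {w. Re w > 1 / 2}"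
  proof -
    have "2 * w \<noteq> 1" if "Re w > 1 / 2" for w :: complex
    proof
      assume "2 * w = 1"
      then have "Re (2 * w) = 1" by simp
      with that show False by simp
    qed
    then have "zeta \<circ> (\<lambda>w. 2 * w) holomorphic_on {w. Re w > 1 / 2}"
      by (intro holomorphic_on_compose_gen[OF _ zeta_holomorphic] holomorphic_intros) auto
    then show ?thesis by (simp add: o_def)
  qed
  have "zeta (2 * w) * (1 + 2 powr (- w)) \<noteq> 0" if "Re w > 1 / 2" for w
    using norm_one_plus_two_powr[of w] two_powr_half_less_1 zeta_nonzero[of "2 * w"] that by auto
  then show ?thesis
    unfolding zeta_factor_def by (intro holomorphic_intros z holomorphic_on_subset[OF Zf_holomorphic]) auto
qed

lemma zeta_factor_bound:
  assumes "\<delta> > 0"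
  obtains C where "C \<ge> 0" "\<And>w. Re w \<ge> 1 / 2 + \<delta> \<Longrightarrow> norm (zeta_factor w) \<le> C * (1 + norm w) ^ 2"
proof -
  obtain C where C: "\<And>s. Re s \<ge> 1 / 2 \<Longrightarrow> norm (Zf s) \<le> C * (1 + norm s) ^ 2" "C \<ge> 1"
    using Zf_bound by blast
  have "2 * \<delta> > 0" using assms by simp
  then obtain K where K: "K > 0" "\<And>s. Re s \<ge> 1 + 2 * \<delta> \<Longrightarrow> norm (zeta s) \<ge> K"
    using zeta_lower_bound by metis
  define k where "k = (1 :: real) - 2 powr (- 1 / 2)"
  have k: "k > 0" using two_powr_half_less_1 by (simp add: k_def)
  show ?thesis
  proof (rule that[of "C / (K * k)"])
    fix w assume w: "Re w \<ge> 1 / 2 + \<delta>"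
    have "norm (zeta_factor w) = norm (Zf w) / (norm (zeta (2 * w)) * norm (1 + 2 powr (- w)))"
      by (simp add: zeta_factor_def norm_divide norm_mult)
    also have "\<dots> \<le> (C * (1 + norm w) ^ 2) / (K * k)"
    proof (rule frac_le)
      show "K * k \<le> norm (zeta (2 * w)) * norm (1 + 2 powr (- w))"
        unfolding k_def using w assms K norm_one_plus_two_powr[of w] k[unfolded k_def]
        by (intro mult_mono) auto
    qed (use C w assms K k in auto)
    finally show "norm (zeta_factor w) \<le> C / (K * k) * (1 + norm w) ^ 2" by simp
  qed (use C K k in auto)
qed

text \<open>The constant in the residue at \<nu> = s - 1, that is, at w = 1.\<close>

lemma zeta_factor_1: "zeta_factor 1 \<noteq> 0"
  using zeta_nonzero[of 2] by (simp add: zeta_factor_def powr_minus)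

section \<open>The integrand of \<open>F0\<close> for a bump pair and the residue term\<close>

context bump_pair
begin

text \<open>The part of the integrand that depends on \<nu> alone. Writing 1/\<zeta>(\<nu>) as
  (\<nu> - 1)/\<open>Zf \<nu>\<close> makes it regular at \<nu> = 1.\<close>

definition mellin_factor :: "complex \<Rightarrow> complex" where
  "mellin_factor \<nu> = (\<nu> - 1) * mellin \<nu> / (Zf \<nu> * (1 - 2 powr (- \<nu>)))"

lemma norm_one_minus_two_powr:
  assumes "Re \<nu> \<ge> 1"
  shows "norm (1 - 2 powr (- \<nu>)) \<ge> 1 / 2"
proof -
  have "norm (2 powr (- \<nu>)) \<le> 2 powr (- 1)"
    unfolding norm_two_powr using assms by (intro powr_mono) auto
  then show ?thesis
    using norm_triangle_ineq2[of 1 "2 powr (- \<nu>)"] by (simp add: powr_minus)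
qed

lemma mellin_factor_holomorphic: "mellin_factor holomorphic_on {\<nu>. Re \<nu> \<ge> 1}"
proof -
  have "Zf \<nu> * (1 - 2 powr (- \<nu>)) \<noteq> 0" if "Re \<nu> \<ge> 1" for \<nu>
    using Zf_nonzero[OF that] norm_one_minus_two_powr[OF that] by auto
  then show ?thesis
    unfolding mellin_factor_def
    by (intro holomorphic_intros holomorphic_on_subset[OF Zf_holomorphic] holomorphic_on_subset[OF mellin_holomorphic]) auto
qed

lemma mellin_factor_bound:
  obtains C where "C \<ge> 0" "\<And>\<nu>. 1 \<le> Re \<nu> \<Longrightarrow> Re \<nu> \<le> 2 \<Longrightarrow> norm (mellin_factor \<nu>) \<le> C / norm \<nu> ^ 4"
proof -
  obtain \<kappa> where \<kappa>: "0 < \<kappa>" "\<And>s. 1 \<le> Re s \<Longrightarrow> Re s \<le> 2 \<Longrightarrow> norm (Zf s) \<ge> \<kappa> / (1 + \<bar>Im s\<bar>) ^ 10"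
    using Zf_lower_bound by blast
  \<comment> \<open>15 = 1 + 10 + 4: the factor \<nu> - 1 costs one power and 1/\<open>Zf\<close>
    costs ten. Of the remaining four, two pay for the growth of \<open>zeta_factor\<close> and two
    are left for integrability.\<close>
  obtain C where C: "\<And>\<nu>. 1 \<le> Re \<nu> \<Longrightarrow> Re \<nu> \<le> 2 \<Longrightarrow> norm (mellin \<nu>) \<le> C / norm \<nu> ^ 15"
    using mellin_decay[of 2 15] by blast
  have C0: "C \<ge> 0"
    using order_trans[OF norm_ge_zero C[of 1]] by simp
  show ?thesis
  proof (rule that[of "C * 2 ^ 11 / \<kappa>"])
    fix \<nu> :: complex assume \<nu>: "1 \<le> Re \<nu>" "Re \<nu> \<le> 2"
    define n where "n = norm \<nu>"
    have n1: "n \<ge> 1" using \<nu> complex_Re_le_cmod[of \<nu>] by (simp add: n_def)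
    have im: "1 + \<bar>Im \<nu>\<bar> \<le> 2 * n" using n1 abs_Im_le_cmod[of \<nu>] by (simp add: n_def)
    have "norm (\<nu> - 1) ^ 2 \<le> n ^ 2"
      unfolding n_def cmod_power2 using \<nu> by (simp add: power2_eq_square algebra_simps)
    then have m1: "norm (\<nu> - 1) \<le> n"
      by (rule power2_le_imp_le) (use n1 in simp)
    have Z: "norm (Zf \<nu>) \<ge> \<kappa> / (2 * n) ^ 10"
    proof -
      have "\<kappa> / (2 * n) ^ 10 \<le> \<kappa> / (1 + \<bar>Im \<nu>\<bar>) ^ 10"
        using \<kappa>(1) im n1 by (intro divide_left_mono power_mono mult_pos_pos zero_less_power) auto
      then show ?thesis using \<kappa>(2)[OF \<nu>] by linarith
    qed
    have "norm (mellin_factor \<nu>) = norm (\<nu> - 1) * norm (mellin \<nu>) / (norm (Zf \<nu>) * norm (1 - 2 powr (- \<nu>)))"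
      by (simp add: mellin_factor_def norm_divide norm_mult)
    also have "\<dots> \<le> (n * (C / n ^ 15)) / (\<kappa> / (2 * n) ^ 10 * (1 / 2))"
    proof (rule frac_le)
      show "norm (\<nu> - 1) * norm (mellin \<nu>) \<le> n * (C / n ^ 15)"
        using m1 C[OF \<nu>] n1 by (intro mult_mono) (auto simp: n_def)
      show "\<kappa> / (2 * n) ^ 10 * (1 / 2) \<le> norm (Zf \<nu>) * norm (1 - 2 powr (- \<nu>))"
        using Z norm_one_minus_two_powr[OF \<nu>(1)] by (intro mult_mono) auto
      show "0 \<le> n * (C / n ^ 15)" using n1 C0 by simp
      show "0 < \<kappa> / (2 * n) ^ 10 * (1 / 2)" using \<kappa>(1) n1 by simp
    qed
    also have "\<dots> = C * 2 ^ 11 / \<kappa> / n ^ 4"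
      using n1 \<kappa>(1) by (simp add: field_simps eval_nat_numeral)
    finally show "norm (mellin_factor \<nu>) \<le> C * 2 ^ 11 / \<kappa> / norm \<nu> ^ 4" by (simp add: n_def)
  qed (use C0 \<kappa> in auto)
qed

text \<open>Quadratic growth of the first factor, uniform in |s| \<le> R, against decay of order 4
  of the second. Since Re \<nu> \<ge> 1, |\<nu>|^2 dominates 1 + (Im \<nu>)^2.\<close>

lemma zeta_mellin_factor_bound:
  assumes "\<delta> > 0" "R \<ge> 0"
  obtains B where "B \<ge> 0" "\<And>s \<nu>. norm s \<le> R \<Longrightarrow> Re s - Re \<nu> \<ge> 1 / 2 + \<delta> \<Longrightarrow> 1 \<le> Re \<nu> \<Longrightarrow> Re \<nu> \<le> 2 \<Longrightarrow>
     norm (zeta_factor (s - \<nu>) * mellin_factor \<nu>) \<le> B / (1 + (Im \<nu>)\<^sup>2)"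
proof -
  obtain C where C: "C \<ge> 0" "\<And>w. Re w \<ge> 1 / 2 + \<delta> \<Longrightarrow> norm (zeta_factor w) \<le> C * (1 + norm w) ^ 2"
    using zeta_factor_bound[OF assms(1)] by metis
  obtain D where D: "D \<ge> 0" "\<And>\<nu>. 1 \<le> Re \<nu> \<Longrightarrow> Re \<nu> \<le> 2 \<Longrightarrow> norm (mellin_factor \<nu>) \<le> D / norm \<nu> ^ 4"
    using mellin_factor_bound by metis
  show ?thesis
  proof (rule that[of "C * (2 + R) ^ 2 * D"])
    fix s \<nu> :: complex assume s: "norm s \<le> R" "Re s - Re \<nu> \<ge> 1 / 2 + \<delta>" and \<nu>: "1 \<le> Re \<nu>" "Re \<nu> \<le> 2"
    define n where "n = norm \<nu>"
    have n1: "n \<ge> 1" using \<nu> complex_Re_le_cmod[of \<nu>] by (simp add: n_def)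
    have "1 + norm (s - \<nu>) \<le> 1 + R + n"
      using norm_triangle_ineq4[of s \<nu>] s by (simp add: n_def)
    also have "\<dots> \<le> (2 + R) * n"
    proof -
      have "(1 + R) * 1 \<le> (1 + R) * n" using n1 assms by (intro mult_left_mono) auto
      then show ?thesis by (simp add: algebra_simps)
    qed
    finally have "(1 + norm (s - \<nu>)) ^ 2 \<le> ((2 + R) * n) ^ 2" by (intro power_mono) auto
    then have "norm (zeta_factor (s - \<nu>)) \<le> C * ((2 + R) * n) ^ 2"
      using C(2)[of "s - \<nu>"] s(2) C(1) by (meson mult_left_mono order_trans minus_complex.simps(1) | simp)+
    then have "norm (zeta_factor (s - \<nu>)) * norm (mellin_factor \<nu>) \<le> (C * ((2 + R) * n) ^ 2) * (D / n ^ 4)"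
      using D(2)[OF \<nu>] C(1) by (intro mult_mono) (auto simp: n_def)
    also have "\<dots> = C * (2 + R) ^ 2 * D / n ^ 2"
      using n1 by (simp add: power_mult_distrib field_simps eval_nat_numeral)
    also have "\<dots> \<le> C * (2 + R) ^ 2 * D / (1 + (Im \<nu>)\<^sup>2)"
    proof (rule divide_left_mono)
      have "1 \<le> (Re \<nu>)\<^sup>2" using \<nu> by (simp add: one_le_power)
      then show "1 + (Im \<nu>)\<^sup>2 \<le> n ^ 2" unfolding n_def cmod_power2 by simp
      show "0 \<le> C * (2 + R)\<^sup>2 * D" using C(1) D(1) by simp
      show "0 < n\<^sup>2 * (1 + (Im \<nu>)\<^sup>2)" using n1 by (intro mult_pos_pos) (auto simp: add_pos_nonneg)
    qed
    finally show "norm (zeta_factor (s - \<nu>) * mellin_factor \<nu>) \<le> C * (2 + R) ^ 2 * D / (1 + (Im \<nu>)\<^sup>2)"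
      by (simp add: norm_mult)
  qed (use C D in auto)
qed

text \<open>Isolates the simple pole at \<nu> = s - 1. The sign arises because the pole of
  \<zeta>(w) at w = 1 is written with \<nu> - (s - 1) = -(w - 1).\<close>

lemma F0_integrand_eq:
  assumes "Re s > 2" "Re \<nu> = 1" "\<nu> \<noteq> 1"
  shows "F0_integrand v u s \<nu> = - (zeta_factor (s - \<nu>) * mellin_factor \<nu> / (\<nu> - (s - 1)))"
proof -
  have 1: "s - \<nu> \<noteq> 1" using assms by (auto simp: complex_eq_iff)
  have "\<nu> \<noteq> -1" using assms by auto
  then have E: "eisenstein \<nu> (Wig v u) = mellin \<nu>"
    using assms by (intro eisenstein_eq_mellin)
  define w D where "w = s - \<nu>" and "D = w - 1"
  have z: "zeta w = Zf w / D" "zeta \<nu> = Zf \<nu> / (\<nu> - 1)"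
    using 1 assms(3) by (simp_all add: Zf_eq w_def D_def)
  have e: "- s + \<nu> = - w" "\<nu> - (s - 1) = - D" by (simp_all add: w_def D_def)
  show ?thesis
    unfolding F0_integrand_def E zeta_factor_def mellin_factor_def e w_def[symmetric] z
    by (simp add: divide_inverse mult_ac)
qed

text \<open>The value prescribed at \<nu> = 1 concerns only y = 0, a null set, so the limit need not
  be computed. The factor \<i> from d\<nu> cancels the one in 1/(2\<i>\<pi>).\<close>

lemma F0_eq:
  assumes "Re s > 2" and cont: "continuous_on UNIV (\<lambda>y. zeta_factor (s - Complex 1 y) * mellin_factor (Complex 1 y) / (Complex 1 y - (s - 1)))"
  shows "F0 v u s = - (1 / (2 * pi) * (LINT y|lborel. zeta_factor (s - Complex 1 y) * mellin_factor (Complex 1 y) / (Complex 1 y - (s - 1))))"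
proof -
  let ?k = "\<lambda>y. zeta_factor (s - Complex 1 y) * mellin_factor (Complex 1 y) / (Complex 1 y - (s - 1))"
  let ?f = "\<lambda>y. ((F0_integrand v u s)(1 := Lim (at 1) (F0_integrand v u s))) (Complex 1 y) * \<i>"
  have [measurable]: "?k \<in> borel_measurable borel"
    by (rule borel_measurable_continuous_onI[OF cont])
  have f: "?f y = (if y = 0 then Lim (at 1) (F0_integrand v u s) * \<i> else - \<i> * ?k y)" for y
  proof -
    have "Complex 1 y = 1 \<longleftrightarrow> y = 0" by (auto simp: complex_eq_iff)
    then show ?thesis
      using F0_integrand_eq[OF assms(1), of "Complex 1 y"] by (cases "y = 0") simp_all
  qed
  have "(LINT y|lborel. ?f y) = (LINT y|lborel. - \<i> * ?k y)"
  proof (rule integral_cong_AE)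
    show "?f \<in> borel_measurable lborel" by (subst f) measurable
    show "(\<lambda>y. - \<i> * ?k y) \<in> borel_measurable lborel" by measurable
    show "AE y in lborel. ?f y = - \<i> * ?k y"
      using AE_lborel_singleton[of "0::real"] by eventually_elim (subst f, simp)
  qed
  also have "\<dots> = - \<i> * (LINT y|lborel. ?k y)"
    by (rule integral_mult_right_zero)
  finally show ?thesis
    by (simp add: F0_def field_simps)
qed

lemma mellin_zero_of_continuation:
  assumes \<rho>: "1 / 2 < Re \<rho>" "Re \<rho> < 1" "Zf \<rho> = 0"
    and G: "G analytic_on {s. Re s > 3 / 2}" "\<And>s. Re s > 2 \<Longrightarrow> G s = F0 v u s"
  shows "mellin \<rho> = 0"
proof -
  \<comment> \<open>A quarter of the distance from \<rho> to the critical line, so that \<rho> + 1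
    has real part 3/2 + 4\<epsilon>, beyond the left edge 3/2 + 2\<epsilon> of the rectangle
    below.\<close>
  define \<epsilon> where "\<epsilon> = (Re \<rho> - 1 / 2) / 4"
  have \<epsilon>: "\<epsilon> > 0" "\<epsilon> \<le> 1 / 8" "Re \<rho> = 1 / 2 + 4 * \<epsilon>"
    using \<rho>(1,2) by (auto simp: \<epsilon>_def field_simps)
  define M where "M = \<bar>Im \<rho>\<bar> + 1"
  \<comment> \<open>With c = 1 + \<epsilon>, the left edge gives Re(s - \<nu>) > 1/2 + \<epsilon> on
    the new line, and the right edge keeps s - 1 at distance \<epsilon>/2 to its left. The rectangle
    meets Re s > 2 and contains \<rho> + 1.\<close>
  define U where "U = box (Complex (3 / 2 + 2 * \<epsilon>) (- M)) (Complex (2 + \<epsilon> / 2) M)"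
  have U: "s \<in> U \<longleftrightarrow> 3 / 2 + 2 * \<epsilon> < Re s \<and> Re s < 2 + \<epsilon> / 2 \<and> - M < Im s \<and> Im s < M" for s
    by (auto simp: U_def in_box_complex_iff)
  have Uo: "open U" "convex U" by (auto simp: U_def convex_box)
  have nU: "norm s \<le> 3 + M" if "s \<in> U" for s
    using that cmod_le[of s] \<epsilon> by (auto simp: U)
  define c where "c = 1 + \<epsilon>"
  have M: "3 + M \<ge> 0" by (simp add: M_def)
  obtain B where B: "B \<ge> 0" "\<And>s \<nu>. norm s \<le> 3 + M \<Longrightarrow> Re s - Re \<nu> \<ge> 1 / 2 + \<epsilon> \<Longrightarrow> 1 \<le> Re \<nu> \<Longrightarrow> Re \<nu> \<le> 2 \<Longrightarrow>
     norm (zeta_factor (s - \<nu>) * mellin_factor \<nu>) \<le> B / (1 + (Im \<nu>)\<^sup>2)"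
    using zeta_mellin_factor_bound[OF \<epsilon>(1) M] by metis
  define L where "L = (\<lambda>s. LINT y|lborel. zeta_factor (s - Complex c y) / (s - Complex c y - 1) * mellin_factor (Complex c y))"
  have cC: "continuous_on S (\<lambda>y. Complex b y)" for S b
    unfolding Complex_eq by (intro continuous_intros)
  have cN: "continuous_on UNIV (\<lambda>y. mellin_factor (Complex b y))" if "b \<ge> 1" for b
    by (rule continuous_on_compose2[OF holomorphic_on_imp_continuous_on[OF mellin_factor_holomorphic] cC]) (use that in auto)
  have L: "L holomorphic_on U"
    unfolding L_def
  proof (rule line_convolution_holomorphic[where \<Omega> = "{w. Re w > 1 / 2} \<inter> - {1}" and B = "B / (\<epsilon> / 2)" and A = "\<lambda>w. zeta_factor w / (w - 1)"])
    show "(\<lambda>w. zeta_factor w / (w - 1)) holomorphic_on {w. Re w > 1 / 2} \<inter> - {1}"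
      by (intro holomorphic_intros holomorphic_on_subset[OF zeta_factor_holomorphic]) auto
    show "open ({w. Re w > 1 / 2} \<inter> - {1 :: complex})"
      by (intro open_Int open_halfspace_Re_gt open_Compl) auto
    show "continuous_on UNIV (\<lambda>y. mellin_factor (Complex c y))"
      by (rule cN) (use \<epsilon> in \<open>simp add: c_def\<close>)
    fix s y assume s: "s \<in> U"
    show "s - Complex c y \<in> {w. Re w > 1 / 2} \<inter> - {1}"
      using s \<epsilon> by (auto simp: U c_def complex_eq_iff)
    have b: "norm (zeta_factor (s - Complex c y) * mellin_factor (Complex c y)) \<le> B / (1 + y\<^sup>2)"
      using B(2)[OF nU[OF s], of "Complex c y"] s \<epsilon> by (auto simp: U c_def)
    have "Re (s - Complex c y - 1) \<le> - (\<epsilon> / 2)"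
      using s by (simp add: U c_def)
    then have "\<epsilon> / 2 \<le> \<bar>Re (s - Complex c y - 1)\<bar>"
      by linarith
    also have "\<dots> \<le> norm (s - Complex c y - 1)" by (rule abs_Re_le_cmod)
    finally have "norm (zeta_factor (s - Complex c y) * mellin_factor (Complex c y)) / norm (s - Complex c y - 1) \<le> (B / (1 + y\<^sup>2)) / (\<epsilon> / 2)"
      using b \<epsilon> B(1) by (intro frac_le divide_nonneg_nonneg) (auto simp: add_nonneg_nonneg)
    then show "norm (zeta_factor (s - Complex c y) / (s - Complex c y - 1) * mellin_factor (Complex c y)) \<le> B / (\<epsilon> / 2) / (1 + y\<^sup>2)"
      by (simp add: norm_divide norm_mult mult_ac)
  qed (rule Uo)+
  \<comment> \<open>The residue identity with its denominators cleared, so that it makes sense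
    across the zeros of \<open>Zf (s - 1)\<close>. At s = \<rho> + 1 the first product vanishes and
    only the Mellin term is left.\<close>
  define E where "E = (\<lambda>s. (G s - L s / (2 * pi)) * (Zf (s - 1) * (1 - 2 powr (- (s - 1)))) - zeta_factor 1 * ((s - 2) * mellin (s - 1)))"
  \<comment> \<open>For Re s > 2 inside the rectangle, s - 1 lies strictly between the two lines,
    and Cauchy's formula in the strip expresses the difference of the line integrals by the
    residue.\<close>
  have GL: "G s - L s / (2 * pi) = zeta_factor 1 * mellin_factor (s - 1)" if s: "s \<in> U" "Re s > 2" for s
  proof -
    have sr: "2 < Re s" "Re s < 2 + \<epsilon> / 2" using s by (auto simp: U)
    let ?H = "\<lambda>\<nu>. zeta_factor (s - \<nu>) * mellin_factor \<nu>"
    have holo: "?H holomorphic_on {\<nu>. 1 \<le> Re \<nu> \<and> Re \<nu> \<le> c}"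
    proof (intro holomorphic_intros)
      show "(\<lambda>\<nu>. zeta_factor (s - \<nu>)) holomorphic_on {\<nu>. 1 \<le> Re \<nu> \<and> Re \<nu> \<le> c}"
        using holomorphic_on_compose_gen[of "\<lambda>\<nu>. s - \<nu>" "{\<nu>. 1 \<le> Re \<nu> \<and> Re \<nu> \<le> c}" zeta_factor "{w. Re w > 1 / 2}"]
          zeta_factor_holomorphic sr \<epsilon> by (fastforce simp: o_def c_def intro: holomorphic_intros)
      show "mellin_factor holomorphic_on {\<nu>. 1 \<le> Re \<nu> \<and> Re \<nu> \<le> c}"
        by (rule holomorphic_on_subset[OF mellin_factor_holomorphic]) auto
    qed
    have "2 * pi * \<i> * ?H (s - 1) = \<i> * (LINT y|lborel. ?H (Complex c y) / (Complex c y - (s - 1)))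
        - \<i> * (LINT y|lborel. ?H (Complex 1 y) / (Complex 1 y - (s - 1)))"
    proof (rule Cauchy_integral_formula_strip[OF holo, where B = B])
      show "1 < Re (s - 1)" "Re (s - 1) < c" using sr \<epsilon> by (auto simp: c_def)
      fix \<nu> assume "1 \<le> Re \<nu>" "Re \<nu> \<le> c"
      then show "norm (?H \<nu>) \<le> B / (1 + (Im \<nu>)\<^sup>2)"
        using nU[OF s(1)] sr \<epsilon> by (intro B(2)) (auto simp: c_def)
    qed
    also have "(LINT y|lborel. ?H (Complex c y) / (Complex c y - (s - 1))) = - L s"
    proof -
      have "?H (Complex c y) / (Complex c y - (s - 1)) = - (zeta_factor (s - Complex c y) / (s - Complex c y - 1) * mellin_factor (Complex c y))" for y
      proof -
        define p where "p = s - Complex c y - 1"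
        have "Complex c y - (s - 1) = - p" by (simp add: p_def)
        then show ?thesis unfolding p_def[symmetric] by simp
      qed
      then show ?thesis by (simp add: L_def)
    qed
    also have "(LINT y|lborel. ?H (Complex 1 y) / (Complex 1 y - (s - 1))) = - (2 * pi * F0 v u s)"
    proof (subst F0_eq[OF s(2)])
      have nz: "Complex 1 y - (s - 1) \<noteq> 0" for y using sr by (auto simp: complex_eq_iff)
      have "continuous_on UNIV (\<lambda>y. ?H (Complex 1 y))"
        by (rule continuous_on_compose2[OF holomorphic_on_imp_continuous_on[OF holo] cC]) (use \<epsilon> in \<open>auto simp: c_def\<close>)
      then show "continuous_on UNIV (\<lambda>y. ?H (Complex 1 y) / (Complex 1 y - (s - 1)))"
        by (rule continuous_on_divide) (use nz in \<open>auto intro!: continuous_on_diff cC continuous_on_const\<close>)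
    qed simp
    finally have "\<i> * (2 * pi * (zeta_factor 1 * mellin_factor (s - 1))) = \<i> * (2 * pi * F0 v u s - L s)"
      by (simp add: algebra_simps)
    then have "2 * pi * (zeta_factor 1 * mellin_factor (s - 1)) = 2 * pi * F0 v u s - L s"
      by (simp only: mult_left_cancel[OF complex_i_not_zero])
    then have "zeta_factor 1 * mellin_factor (s - 1) = F0 v u s - L s / (2 * pi)"
      by (simp add: field_simps)
    then show ?thesis using G(2)[OF s(2)] by simp
  qed
  have sh: "(\<lambda>s. f (s - 1)) holomorphic_on U" if "f holomorphic_on UNIV" for f :: "complex \<Rightarrow> complex"
    using holomorphic_on_compose_gen[of "\<lambda>s. s - 1" U f UNIV] that by (simp add: o_def holomorphic_intros)
  have "G holomorphic_on U"
    by (rule holomorphic_on_subset[OF analytic_imp_holomorphic[OF G(1)]]) (use \<epsilon> in \<open>auto simp: U\<close>)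
  then have Eh: "E holomorphic_on U"
    unfolding E_def by (intro holomorphic_intros L sh Zf_holomorphic mellin_holomorphic) auto
  have "E (\<rho> + 1) = 0"
  proof (rule analytic_continuation_open[of "U \<inter> {s. Re s > 2}" U E "\<lambda>_. 0"])
    show "open (U \<inter> {s. Re s > 2})" by (intro open_Int Uo open_halfspace_Re_gt)
    have "Complex (2 + \<epsilon> / 4) 0 \<in> U \<inter> {s. Re s > 2}" using \<epsilon> by (auto simp: U M_def)
    then show "U \<inter> {s. Re s > 2} \<noteq> {}" by blast
    show "connected U" using Uo(2) by (rule convex_connected)
    show "\<rho> + 1 \<in> U" using \<rho> \<epsilon> by (auto simp: U M_def)
    fix s assume s: "s \<in> U \<inter> {s. Re s > 2}"
    have r: "Re (s - 1) \<ge> 1" using s by auto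
    have "1 - 2 powr (- (s - 1)) \<noteq> 0" using norm_one_minus_two_powr[OF r] by auto
    with Zf_nonzero[OF r] have "Zf (s - 1) * (1 - 2 powr (- (s - 1))) \<noteq> 0" by simp
    then have "mellin_factor (s - 1) * (Zf (s - 1) * (1 - 2 powr (- (s - 1)))) = (s - 2) * mellin (s - 1)"
      by (simp add: mellin_factor_def)
    then show "E s = 0" using s GL[of s] unfolding E_def by (simp add: mult.assoc)
  qed (use Uo Eh in auto)
  then have "zeta_factor 1 * ((\<rho> - 1) * mellin \<rho>) = 0"
    using \<rho>(3) by (simp add: E_def)
  moreover have "\<rho> \<noteq> 1" using \<rho> by auto
  ultimately show ?thesis using zeta_factor_1 by simp
qed

end

section \<open>A bump pair with nonvanishing Mellin transform\<close>

lemma bump_pair_bump: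
  assumes "0 < r" "r \<le> 1 / 8"
  shows "bump_pair (bump r (5 / 2)) (bump r (3 / 2))"
proof
  show "bump r (5 / 2) x = 0" if "x \<notin> {19/8<..<21/8}" for x
    by (rule bump_zero) (use that assms in \<open>auto simp: abs_if\<close>)
  show "bump r (3 / 2) x = 0" if "x \<notin> {11/8<..<13/8}" for x
    by (rule bump_zero) (use that assms in \<open>auto simp: abs_if\<close>)
qed (rule Csmooth_bump)+

text \<open>On the support |ln(t/2)| \<le> r, so the phase Im \<rho> ln(t/2) is at most 1 < \<pi>/2
  in size. After normalisation at t = 2 the real part of the integrand is nonnegative, and positive
  at t = 2, so no cancellation can occur.\<close>

lemma mellin_bump_nonzero:
  assumes r: "0 < r" "r \<le> 1 / 8" "r * \<bar>Im \<rho>\<bar> \<le> 1"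
  shows "bump_pair.mellin (bump r (5 / 2)) (bump r (3 / 2)) \<rho> \<noteq> 0"
proof
  interpret bump_pair "bump r (5 / 2)" "bump r (3 / 2)"
    by (rule bump_pair_bump) fact+
  assume mellin0: "mellin \<rho> = 0"
  define P where "P = (\<lambda>t::real. bump r (5 / 2) (t + 1 / t) * bump r (3 / 2) (t - 1 / t))"
  have \<phi>P: "\<phi> t = of_real (P t)" for t
    by (simp add: \<phi>_def v_def u_def P_def)
  have P0: "P t \<ge> 0" for t
    by (simp add: P_def bump_nonneg)
  \<comment> \<open>Adding the two support conditions cancels 1/t and leaves |2t - 4| < 2r.\<close>
  have near: "\<bar>t - 2\<bar> < r" if "P t \<noteq> 0" for t
  proof -
    have "\<not> r \<le> \<bar>t + 1 / t - 5 / 2\<bar>" "\<not> r \<le> \<bar>t - 1 / t - 3 / 2\<bar>"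
      using that bump_zero by (auto simp: P_def)
    then show ?thesis by (auto simp: abs_if split: if_splits)
  qed
  let ?k = "\<lambda>t. of_real (t / 2) powr (\<rho> - 1) * \<phi> t"
  have kc: "continuous_on {1..3} ?k"
    by (auto intro!: continuous_intros \<phi>_cont simp: complex_nonpos_Reals_iff)
  \<comment> \<open>Pulling out the constant 2^(\<rho> - 1) centres the phase at t = 2.\<close>
  have "of_real t powr (\<rho> - 1) * \<phi> t = 2 powr (\<rho> - 1) * ?k t" if "t \<in> {1..3}" for t
    using powr_times_real[of 2 "of_real (t / 2)" "\<rho> - 1"] that by simp
  then have "mellin \<rho> = integral {1..3} (\<lambda>t. 2 powr (\<rho> - 1) * ?k t)"
    unfolding mellin_def by (intro Henstock_Kurzweil_Integration.integral_cong)
  also have "\<dots> = 2 powr (\<rho> - 1) * integral {1..3} ?k"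
    by simp
  finally have "integral {1..3} ?k = 0" using mellin0 by simp
  then have "(?k has_integral 0) {1..3}"
    using integrable_integral[OF integrable_continuous_real[OF kc]] by simp
  from has_integral_Re[OF this] have I: "((\<lambda>t. Re (?k t)) has_integral 0) {1..3}" by simp
  have Rk: "Re (?k t) = P t * ((t / 2) powr (Re \<rho> - 1) * cos (Im \<rho> * ln (t / 2)))" if "t \<in> {1..3}" for t
  proof -
    have "complex_of_real (t / 2) powr (\<rho> - 1) = exp ((\<rho> - 1) * of_real (ln (t / 2)))"
      using that by (simp add: powr_def Ln_of_real del: of_real_divide)
    then have "Re (complex_of_real (t / 2) powr (\<rho> - 1)) = (t / 2) powr (Re \<rho> - 1) * cos (Im \<rho> * ln (t / 2))"
      using that by (simp add: Re_exp powr_def)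
    then show ?thesis by (simp add: \<phi>P mult.commute)
  qed
  have cos_pos: "cos (Im \<rho> * ln (t / 2)) > 0" if t: "t \<in> {1..3}" "P t \<noteq> 0" for t
  proof -
    have tr: "\<bar>t - 2\<bar> < r" by (rule near) fact
    have "ln (t / 2) \<le> t / 2 - 1" using t by (intro ln_le_minus_one) auto
    moreover have "- ln (t / 2) \<le> 2 / t - 1"
      using ln_le_minus_one[of "2 / t"] t by (simp add: ln_div)
    moreover have "2 / t - 1 = (2 - t) / t" using t by (simp add: field_simps)
    moreover have "(2 - t) / t \<le> \<bar>t - 2\<bar>"
    proof -
      have "(2 - t) / t \<le> \<bar>t - 2\<bar> / t" using t by (intro divide_right_mono) auto
      also have "\<dots> \<le> \<bar>t - 2\<bar> / 1" using t by (intro divide_left_mono) auto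
      finally show ?thesis by simp
    qed
    ultimately have "\<bar>ln (t / 2)\<bar> \<le> r" using tr by (simp add: abs_le_iff)
    then have "\<bar>Im \<rho> * ln (t / 2)\<bar> \<le> \<bar>Im \<rho>\<bar> * r"
      unfolding abs_mult by (intro mult_left_mono) auto
    then have "\<bar>Im \<rho> * ln (t / 2)\<bar> \<le> 1" using r(3) by (simp add: mult.commute)
    then show ?thesis
      using pi_gt3 by (intro cos_gt_zero_pi) (auto simp: abs_le_iff)
  qed
  have "Re (?k t) \<ge> 0" if "t \<in> {1..3}" for t
    unfolding Rk[OF that] using cos_pos[OF that] P0[of t] by (cases "P t = 0") auto
  moreover have "continuous_on {1..3} (\<lambda>t. Re (?k t))"
    by (intro continuous_intros kc)
  \<comment> \<open>A nonnegative continuous function with integral 0 vanishes identically; t = 2,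
    where both bumps are evaluated at their centres, gives the contradiction.\<close>
  ultimately have "\<forall>t\<in>{1..3}. Re (?k t) = 0"
    using integral_eq_0_iff[of 1 3 "\<lambda>t. Re (?k t)"] integral_unique[OF I] by simp
  then have "Re (?k 2) = 0" by (rule bspec) simp
  moreover have "P 2 > 0"
    using r(1) by (simp add: P_def bump_pos)
  ultimately show False
    using Rk[of 2] cos_pos[of 2] by simp
qed

theorem theorem5p3:
  assumes "\<And>v u :: real \<Rightarrow> complex.
      smooth v \<Longrightarrow> compactly_supported v \<Longrightarrow> smooth u \<Longrightarrow> compactly_supported u \<Longrightarrow>
      \<exists>G. G analytic_on {s. Re s > 3 / 2} \<and> (\<forall>s. Re s > 2 \<longrightarrow> G s = F0 v u s)"
  shows "\<forall>\<rho>. \<rho> \<noteq> 1 \<and> zeta \<rho> = 0 \<longrightarrow> Re \<rho> \<le> 1 / 2"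
proof (intro allI impI, rule ccontr)
  fix \<rho> :: complex
  assume \<rho>: "\<rho> \<noteq> 1 \<and> zeta \<rho> = 0" and "\<not> Re \<rho> \<le> 1 / 2"
  then have Z: "Zf \<rho> = 0" and half: "1 / 2 < Re \<rho>"
    by (simp_all add: Zf_eq)
  have less1: "Re \<rho> < 1"
    using Zf_nonzero[of \<rho>] Z by force
  \<comment> \<open>1/8 fits the supports into those of \<open>bump_pair\<close>; the second bound
    makes r |Im \<rho>| \<le> 1.\<close>
  define r where "r = min (1 / 8) (1 / (1 + \<bar>Im \<rho>\<bar>))"
  have r: "0 < r" "r \<le> 1 / 8" by (auto simp: r_def)
  have "r * \<bar>Im \<rho>\<bar> \<le> 1 / (1 + \<bar>Im \<rho>\<bar>) * \<bar>Im \<rho>\<bar>"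
    by (intro mult_right_mono) (auto simp: r_def)
  also have "\<dots> \<le> 1" by (simp add: divide_le_eq)
  finally have r3: "r * \<bar>Im \<rho>\<bar> \<le> 1" .
  interpret bump_pair "bump r (5 / 2)" "bump r (3 / 2)"
    by (rule bump_pair_bump) fact+
  have "smooth v" "smooth u"
    using Csmooth_imp_smooth[OF Vs] Csmooth_imp_smooth[OF Us] by (simp_all add: v_def[abs_def] u_def[abs_def])
  moreover have "compactly_supported v"
  proof (rule compactly_supportedI[of "19/8" "21/8"])
    show "v x = 0" if "x \<notin> {19/8..21/8}" for x
      using V0[of x] that by (force simp: v_def)
  qed
  moreover have "compactly_supported u"
  proof (rule compactly_supportedI[of "11/8" "13/8"])
    show "u x = 0" if "x \<notin> {11/8..13/8}" for x
      using U0[of x] that by (force simp: u_def)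
  qed
  ultimately obtain G where "G analytic_on {s. Re s > 3 / 2}" "\<And>s. Re s > 2 \<Longrightarrow> G s = F0 v u s"
    using assms[of v u] by blast
  from mellin_zero_of_continuation[OF half less1 Z this] mellin_bump_nonzero[OF r r3]
  show False by simp
qed



end
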